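(* Let $k$ be a field and let $V$ be a $k$-vector space of finite dimension $n\ge 2$. For every integer $t\geq 1$, the complex of $GL(V)$-representations $$0 \to T_t^1 \xrightarrow{\delta} T_t^2 \xrightarrow{\delta} \cdots \xrightarrow{\delta} T_t^t \xrightarrow{\pi} S^tV \to 0$$ is exact (at every term, including $T_t^1$ and $S^tV$), where the spaces $T_t^p$ and the maps $\delta$ and $\pi$ are as defined in the context.
   Context: All tensor products are over $k$. $\wedge^i V$ and $S^tV$ denote the exterior and symmetric powers of $V$, with $\wedge^i V=0$ unless $0\le i\le n$; $GL(V)$ acts on these and on their tensor products in the natural way. For $1\le p\le t$ put $$T_t^p=\bigoplus_{\substack{1\le i_1,\dots,i_p\le n\\ i_1+\cdots+i_p=t}} \bigl(\wedge^{i_1}V\otimes\cdots\otimes\wedge^{i_p}V\bigr).$$ In particular $T_t^1=\wedge^tV$ (which may be zero) and $T_t^t=V^{\otimes t}$. The map $\delta$ on $\wedge^iV=T_i^1$ ($i\ge 1$): given $v_1,\dots,v_i\in V$ and a nonempty $A=\{a_1<\dots<a_j\}\subset\{1,\dots,i\}$, write $v_A=v_{a_1}\wedge\cdots\wedge v_{a_j}\in\wedge^jV$. For disjoint nonempty $A,B\subset\{1,\dots,i\}$ let $s(A,B)\in\{\pm1\}$ be the sign such that $v_{A\cup B}=s(A,B)\,v_A\wedge v_B$ for all $v_1,\dots,v_i$ (this sign depends only on $A$ and $B$: it is $(-1)^m$ with $m$ the number of pairs $(a,b)\in A\times B$ with $a>b$). Then define, for $v_1,\dots,v_i\in V$, $$\delta(v_1\wedge\cdots\wedge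 v_i)=\sum_{\substack{A,B\neq\emptyset,\ A\cap B=\emptyset\\ A\cup B=\{1,\dots,i\}}} s(A,B)\,v_A\otimes v_B\in T_i^2,$$ extended linearly; this is well defined, and $\delta=0$ on $\wedge^1V=V$. The map $\delta:T_t^p\to T_t^{p+1}$ for $1\le p\le t-1$: on $\alpha_1\otimes\cdots\otimes\alpha_p\in\wedge^{i_1}V\otimes\cdots\otimes\wedge^{i_p}V\subset T_t^p$, $$\delta(\alpha_1\otimes\cdots\otimes\alpha_p)=\sum_{j=1}^p(-1)^{j-1}\alpha_1\otimes\cdots\otimes\alpha_{j-1}\otimes\delta(\alpha_j)\otimes\alpha_{j+1}\otimes\cdots\otimes\alpha_p.$$ The map $\pi:T_t^t=V^{\otimes t}\to S^tV$ is the natural projection. For $t=1$ the sequence reads $0\to V\xrightarrow{\pi}S^1V\to0$. *)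

theory Defs
  imports "HOL-Algebra.AbelCoset" "Jordan_Normal_Form.VS_Connect" "HOL-Library.Poly_Mapping"
begin

text \<open>
  Vector spaces over a field \<open>'k\<close> are HOL-Algebra module records over \<open>class_ring\<close>, the field
  \<open>'k\<close> seen as a ring record. The ring fields \<open>mult\<close> and \<open>one\<close> of these records are
  irrelevant; as in the AFP entry on vector spaces they are filled with zero.
\<close>

section \<open>Vector spaces given by generators and relations\<close>

text \<open>\<open>'x \<Rightarrow>\<^sub>0 'k\<close> is the free vector space on the type \<open>'x\<close>.\<close>

definition free_scale :: "'k::field \<Rightarrow> ('x \<Rightarrow>\<^sub>0 'k) \<Rightarrow> ('x \<Rightarrow>\<^sub>0 'k)" where
  "free_scale c = Poly_Mapping.map ((*) c)"

definition gen :: "'x \<Rightarrow> ('x \<Rightarrow>\<^sub>0 'k::field)" where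
  "gen x = Poly_Mapping.single x 1"

definition cls :: "('x \<Rightarrow>\<^sub>0 'k::field) set \<Rightarrow> ('x \<Rightarrow>\<^sub>0 'k) \<Rightarrow> ('x \<Rightarrow>\<^sub>0 'k) set" where
  "cls R u = {u + r | r. r \<in> Modules.module.span free_scale R}"

text \<open>The quotient of the free vector space on the set \<open>X\<close> by the span of \<open>R\<close>, as a space of
  cosets. It is only used when the elements of \<open>R\<close> are supported in \<open>X\<close>.\<close>

definition presented :: "'x set \<Rightarrow> ('x \<Rightarrow>\<^sub>0 'k::field) set \<Rightarrow> ('k, ('x \<Rightarrow>\<^sub>0 'k) set) module" where
  "presented X R =
    \<lparr> carrier = cls R ` {u. Poly_Mapping.keys u \<subseteq> X},
      mult = (\<lambda>C D. cls R 0), one = cls R 0, zero = cls R 0,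
      add = (\<lambda>C D. {u + v | u v. u \<in> C \<and> v \<in> D}),
      smult = (\<lambda>c C. {free_scale c u + r | u r. u \<in> C \<and> r \<in> Modules.module.span free_scale R}) \<rparr>"

definition free_lift :: "('k::field, 'b) module \<Rightarrow> ('x \<Rightarrow> 'b) \<Rightarrow> ('x \<Rightarrow>\<^sub>0 'k) \<Rightarrow> 'b" where
  "free_lift M f u = (\<Oplus>\<^bsub>M\<^esub>x\<in>Poly_Mapping.keys u. Poly_Mapping.lookup u x \<odot>\<^bsub>M\<^esub> f x)"

text \<open>The linear map on a presented space with prescribed values \<open>f x\<close> on the classes of the
  generators \<open>x\<close>. If the linear extension of \<open>f\<close> to the free space kills the relations, then its
  image of a coset is a singleton.\<close>

definition quot_lift :: "('k::field, 'b) module \<Rightarrow> ('x \<Rightarrow> 'b) \<Rightarrow> ('x \<Rightarrow>\<^sub>0 'k) set \<Rightarrow> 'b" where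
  "quot_lift M f C = the_elem (free_lift M f ` C)"

section \<open>Direct sums and tensor products\<close>

definition dsum :: "'i set \<Rightarrow> ('i \<Rightarrow> ('k, 'a) module) \<Rightarrow> ('k, 'i \<Rightarrow> 'a) module" where
  "dsum I M =
    \<lparr> carrier = {x \<in> (\<Pi>\<^sub>E i\<in>I. carrier (M i)). finite {i \<in> I. x i \<noteq> \<zero>\<^bsub>M i\<^esub>}},
      mult = (\<lambda>x y. \<lambda>i\<in>I. \<zero>\<^bsub>M i\<^esub>), one = (\<lambda>i\<in>I. \<zero>\<^bsub>M i\<^esub>), zero = (\<lambda>i\<in>I. \<zero>\<^bsub>M i\<^esub>),
      add = (\<lambda>x y. \<lambda>i\<in>I. x i \<oplus>\<^bsub>M i\<^esub> y i),
      smult = (\<lambda>c x. \<lambda>i\<in>I. c \<odot>\<^bsub>M i\<^esub> x i) \<rparr>"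

definition dsum_in :: "'i set \<Rightarrow> ('i \<Rightarrow> ('k, 'a) module) \<Rightarrow> 'i \<Rightarrow> 'a \<Rightarrow> ('i \<Rightarrow> 'a)" where
  "dsum_in I M j a = (\<lambda>i\<in>I. if i = j then a else \<zero>\<^bsub>M i\<^esub>)"

definition multilinear_rels :: "('k::field, 'a) module list \<Rightarrow> ('a list \<Rightarrow>\<^sub>0 'k) set" where
  "multilinear_rels Ms =
    {gen (xs[j := x \<oplus>\<^bsub>Ms ! j\<^esub> y]) - gen (xs[j := x]) - gen (xs[j := y]) | xs j x y.
       xs \<in> listset (map carrier Ms) \<and> j < length Ms \<and>
       x \<in> carrier (Ms ! j) \<and> y \<in> carrier (Ms ! j)} \<union>
    {gen (xs[j := c \<odot>\<^bsub>Ms ! j\<^esub> x]) - free_scale c (gen (xs[j := x])) | xs j c x.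
       xs \<in> listset (map carrier Ms) \<and> j < length Ms \<and> x \<in> carrier (Ms ! j)}"

definition tensor :: "('k::field, 'a) module list \<Rightarrow> ('k, ('a list \<Rightarrow>\<^sub>0 'k) set) module" where
  "tensor Ms = presented (listset (map carrier Ms)) (multilinear_rels Ms)"

definition pure_tensor :: "('k::field, 'a) module list \<Rightarrow> 'a list \<Rightarrow> ('a list \<Rightarrow>\<^sub>0 'k) set" where
  "pure_tensor Ms xs = cls (multilinear_rels Ms) (gen xs)"

section \<open>Exterior and symmetric powers\<close>

text \<open>In the rest of the theory \<open>scale\<close> is the scalar multiplication of a vector space \<open>V\<close> whose
  underlying set is the whole type \<open>'v\<close>.\<close>

definition vec_module :: "('k::field \<Rightarrow> 'v::ab_group_add \<Rightarrow> 'v) \<Rightarrow> ('k, 'v) module" where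
  "vec_module scale =
    \<lparr> carrier = UNIV, mult = (\<lambda>v w. 0), one = 0, zero = 0, add = (+), smult = scale \<rparr>"

definition ext_rels :: "('k::field \<Rightarrow> 'v::ab_group_add \<Rightarrow> 'v) \<Rightarrow> nat \<Rightarrow> ('v list \<Rightarrow>\<^sub>0 'k) set" where
  "ext_rels scale i = multilinear_rels (replicate i (vec_module scale)) \<union>
     {gen vs | vs. length vs = i \<and> \<not> distinct vs}"

definition ext_power ::
    "('k::field \<Rightarrow> 'v::ab_group_add \<Rightarrow> 'v) \<Rightarrow> nat \<Rightarrow> ('k, ('v list \<Rightarrow>\<^sub>0 'k) set) module" where
  "ext_power scale i = presented {vs. length vs = i} (ext_rels scale i)"

definition wedge ::
    "('k::field \<Rightarrow> 'v::ab_group_add \<Rightarrow> 'v) \<Rightarrow> 'v list \<Rightarrow> ('v list \<Rightarrow>\<^sub>0 'k) set" where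
  "wedge scale vs = cls (ext_rels scale (length vs)) (gen vs)"

definition sym_rels :: "('k::field \<Rightarrow> 'v::ab_group_add \<Rightarrow> 'v) \<Rightarrow> nat \<Rightarrow> ('v list \<Rightarrow>\<^sub>0 'k) set" where
  "sym_rels scale t = multilinear_rels (replicate t (vec_module scale)) \<union>
     {gen vs - gen ws | vs ws. length vs = t \<and> mset vs = mset ws}"

definition sym_power ::
    "('k::field \<Rightarrow> 'v::ab_group_add \<Rightarrow> 'v) \<Rightarrow> nat \<Rightarrow> ('k, ('v list \<Rightarrow>\<^sub>0 'k) set) module" where
  "sym_power scale t = presented {vs. length vs = t} (sym_rels scale t)"

definition sym_prod ::
    "('k::field \<Rightarrow> 'v::ab_group_add \<Rightarrow> 'v) \<Rightarrow> 'v list \<Rightarrow> ('v list \<Rightarrow>\<^sub>0 'k) set" where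
  "sym_prod scale vs = cls (sym_rels scale (length vs)) (gen vs)"

section \<open>The spaces $T_t^p$\<close>

abbreviation vdim :: "('k::field \<Rightarrow> 'v::ab_group_add \<Rightarrow> 'v) \<Rightarrow> nat" where
  "vdim scale \<equiv> vector_space.dim scale UNIV"

definition comps :: "nat \<Rightarrow> nat \<Rightarrow> nat \<Rightarrow> nat list set" where
  "comps n t p = {c. length c = p \<and> set c \<subseteq> {1..n} \<and> sum_list c = t}"

text \<open>For \<open>c = [i\<^sub>1, \<dots>, i\<^sub>p]\<close> this is the tensor product of the exterior powers of degrees
  \<open>i\<^sub>1, \<dots>, i\<^sub>p\<close>.\<close>

definition ext_tensor :: "('k::field \<Rightarrow> 'v::ab_group_add \<Rightarrow> 'v) \<Rightarrow> nat list
    \<Rightarrow> ('k, (('v list \<Rightarrow>\<^sub>0 'k) set list \<Rightarrow>\<^sub>0 'k) set) module" where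
  "ext_tensor scale c = tensor (map (ext_power scale) c)"

definition ext_pure :: "('k::field \<Rightarrow> 'v::ab_group_add \<Rightarrow> 'v) \<Rightarrow> nat list
    \<Rightarrow> ('v list \<Rightarrow>\<^sub>0 'k) set list \<Rightarrow> (('v list \<Rightarrow>\<^sub>0 'k) set list \<Rightarrow>\<^sub>0 'k) set" where
  "ext_pure scale c \<alpha>s = pure_tensor (map (ext_power scale) c) \<alpha>s"

definition T_space :: "('k::field \<Rightarrow> 'v::ab_group_add \<Rightarrow> 'v) \<Rightarrow> nat \<Rightarrow> nat
    \<Rightarrow> ('k, nat list \<Rightarrow> (('v list \<Rightarrow>\<^sub>0 'k) set list \<Rightarrow>\<^sub>0 'k) set) module" where
  "T_space scale t p = dsum (comps (vdim scale) t p) (ext_tensor scale)"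

definition T_in :: "('k::field \<Rightarrow> 'v::ab_group_add \<Rightarrow> 'v) \<Rightarrow> nat \<Rightarrow> nat \<Rightarrow> nat list
    \<Rightarrow> (('v list \<Rightarrow>\<^sub>0 'k) set list \<Rightarrow>\<^sub>0 'k) set
    \<Rightarrow> (nat list \<Rightarrow> (('v list \<Rightarrow>\<^sub>0 'k) set list \<Rightarrow>\<^sub>0 'k) set)" where
  "T_in scale t p c = dsum_in (comps (vdim scale) t p) (ext_tensor scale) c"

section \<open>The maps\<close>

definition shuffle_sign :: "nat set \<Rightarrow> nat set \<Rightarrow> 'k::field" where
  "shuffle_sign A B = (-1) ^ card {(a, b). a \<in> A \<and> b \<in> B \<and> a > b}"

text \<open>The map $\wedge^i V \to T_i^2$. Positions in a list are counted from 0, and \<open>nths vs A\<close> lists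
  the vectors at the positions in \<open>A\<close> in increasing order.\<close>

definition ext_delta :: "('k::field \<Rightarrow> 'v::ab_group_add \<Rightarrow> 'v) \<Rightarrow> nat \<Rightarrow> ('v list \<Rightarrow>\<^sub>0 'k) set
    \<Rightarrow> (nat list \<Rightarrow> (('v list \<Rightarrow>\<^sub>0 'k) set list \<Rightarrow>\<^sub>0 'k) set)" where
  "ext_delta scale i = quot_lift (T_space scale i 2) (\<lambda>vs.
     finsum (T_space scale i 2)
       (\<lambda>(A, B). shuffle_sign A B \<odot>\<^bsub>T_space scale i 2\<^esub>
         T_in scale i 2 [card A, card B]
           (ext_pure scale [card A, card B] [wedge scale (nths vs A), wedge scale (nths vs B)]))
       {(A, B). A \<noteq> {} \<and> B \<noteq> {} \<and> A \<inter> B = {} \<and> A \<union> B = {..<i}})"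

text \<open>For \<open>\<alpha>s = [\<alpha>\<^sub>1, \<dots>, \<alpha>\<^sub>p]\<close> with \<open>\<alpha>\<^sub>i\<close> in the exterior power of degree \<open>c ! (i - 1)\<close>: the tensor
  $\alpha_1 \otimes \dots \otimes \delta(\alpha_{j+1}) \otimes \dots \otimes \alpha_p$, where
  the component of $\delta(\alpha_{j+1})$ of degree \<open>d = [a, b]\<close> is inserted by
  means of $\beta \otimes \gamma \mapsto
  \alpha_1 \otimes \dots \otimes \beta \otimes \gamma \otimes \dots \otimes \alpha_p$.\<close>

definition delta_at :: "('k::field \<Rightarrow> 'v::ab_group_add \<Rightarrow> 'v) \<Rightarrow> nat \<Rightarrow> nat \<Rightarrow> nat list \<Rightarrow> nat
    \<Rightarrow> ('v list \<Rightarrow>\<^sub>0 'k) set list \<Rightarrow> (nat list \<Rightarrow> (('v list \<Rightarrow>\<^sub>0 'k) set list \<Rightarrow>\<^sub>0 'k) set)" where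
  "delta_at scale t p c j \<alpha>s =
     (\<Oplus>\<^bsub>T_space scale t (p + 1)\<^esub>d\<in>comps (vdim scale) (c ! j) 2.
       (let c' = take j c @ d @ drop (j + 1) c in
         T_in scale t (p + 1) c'
           (quot_lift (ext_tensor scale c')
             (\<lambda>\<beta>s. ext_pure scale c' (take j \<alpha>s @ \<beta>s @ drop (j + 1) \<alpha>s))
             (ext_delta scale (c ! j) (\<alpha>s ! j) d))))"

text \<open>The map $\delta : T_t^p \to T_t^{p+1}$.\<close>

definition T_delta :: "('k::field \<Rightarrow> 'v::ab_group_add \<Rightarrow> 'v) \<Rightarrow> nat \<Rightarrow> nat
    \<Rightarrow> (nat list \<Rightarrow> (('v list \<Rightarrow>\<^sub>0 'k) set list \<Rightarrow>\<^sub>0 'k) set)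
    \<Rightarrow> (nat list \<Rightarrow> (('v list \<Rightarrow>\<^sub>0 'k) set list \<Rightarrow>\<^sub>0 'k) set)" where
  "T_delta scale t p x =
     (\<Oplus>\<^bsub>T_space scale t (p + 1)\<^esub>c\<in>comps (vdim scale) t p.
       quot_lift (T_space scale t (p + 1))
         (\<lambda>\<alpha>s. \<Oplus>\<^bsub>T_space scale t (p + 1)\<^esub>j\<in>{..<p}.
            (-1) ^ j \<odot>\<^bsub>T_space scale t (p + 1)\<^esub> delta_at scale t p c j \<alpha>s)
         (x c))"

text \<open>The projection $T_t^t = V^{\otimes t} \to S^t V$: the only summand of $T_t^t$ is the one of degree
  \<open>[1, \<dots>, 1]\<close>, and the first exterior power is identified with \<open>V\<close> along \<open>v \<mapsto> wedge scale [v]\<close>.\<close>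

definition sym_proj :: "('k::field \<Rightarrow> 'v::ab_group_add \<Rightarrow> 'v) \<Rightarrow> nat
    \<Rightarrow> (nat list \<Rightarrow> (('v list \<Rightarrow>\<^sub>0 'k) set list \<Rightarrow>\<^sub>0 'k) set) \<Rightarrow> ('v list \<Rightarrow>\<^sub>0 'k) set" where
  "sym_proj scale t x =
     quot_lift (sym_power scale t)
       (\<lambda>\<alpha>s. sym_prod scale (map (the_inv (\<lambda>v. wedge scale [v])) \<alpha>s))
       (x (replicate t 1))"

section \<open>The action of the general linear group\<close>

definition GL :: "('k::field \<Rightarrow> 'v::ab_group_add \<Rightarrow> 'v) \<Rightarrow> ('v \<Rightarrow> 'v) set" where
  "GL scale = {g. Vector_Spaces.linear scale scale g \<and> bij g}"

definition GL_representation :: "('k::field \<Rightarrow> 'v::ab_group_add \<Rightarrow> 'v) \<Rightarrow> ('k, 'a) module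
    \<Rightarrow> (('v \<Rightarrow> 'v) \<Rightarrow> 'a \<Rightarrow> 'a) \<Rightarrow> bool" where
  "GL_representation scale M act \<longleftrightarrow>
     (\<forall>g\<in>GL scale. linear_map class_ring M M (act g)) \<and>
     (\<forall>x\<in>carrier M. act id x = x) \<and>
     (\<forall>g\<in>GL scale. \<forall>h\<in>GL scale. \<forall>x\<in>carrier M. act (g \<circ> h) x = act g (act h x))"

definition GL_hom :: "('k::field \<Rightarrow> 'v::ab_group_add \<Rightarrow> 'v)
    \<Rightarrow> ('k, 'a) module \<Rightarrow> (('v \<Rightarrow> 'v) \<Rightarrow> 'a \<Rightarrow> 'a)
    \<Rightarrow> ('k, 'b) module \<Rightarrow> (('v \<Rightarrow> 'v) \<Rightarrow> 'b \<Rightarrow> 'b) \<Rightarrow> ('a \<Rightarrow> 'b) \<Rightarrow> bool" where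
  "GL_hom scale M actM N actN f \<longleftrightarrow>
     linear_map class_ring M N f \<and>
     (\<forall>g\<in>GL scale. \<forall>x\<in>carrier M. f (actM g x) = actN g (f x))"

definition ext_act :: "('k::field \<Rightarrow> 'v::ab_group_add \<Rightarrow> 'v) \<Rightarrow> nat \<Rightarrow> ('v \<Rightarrow> 'v)
    \<Rightarrow> ('v list \<Rightarrow>\<^sub>0 'k) set \<Rightarrow> ('v list \<Rightarrow>\<^sub>0 'k) set" where
  "ext_act scale i g = quot_lift (ext_power scale i) (\<lambda>vs. wedge scale (map g vs))"

definition ext_tensor_act :: "('k::field \<Rightarrow> 'v::ab_group_add \<Rightarrow> 'v) \<Rightarrow> nat list \<Rightarrow> ('v \<Rightarrow> 'v)
    \<Rightarrow> (('v list \<Rightarrow>\<^sub>0 'k) set list \<Rightarrow>\<^sub>0 'k) set \<Rightarrow> (('v list \<Rightarrow>\<^sub>0 'k) set list \<Rightarrow>\<^sub>0 'k) set" where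
  "ext_tensor_act scale c g = quot_lift (ext_tensor scale c)
     (\<lambda>\<alpha>s. ext_pure scale c (map2 (\<lambda>i \<alpha>. ext_act scale i g \<alpha>) c \<alpha>s))"

definition T_act :: "('k::field \<Rightarrow> 'v::ab_group_add \<Rightarrow> 'v) \<Rightarrow> nat \<Rightarrow> nat \<Rightarrow> ('v \<Rightarrow> 'v)
    \<Rightarrow> (nat list \<Rightarrow> (('v list \<Rightarrow>\<^sub>0 'k) set list \<Rightarrow>\<^sub>0 'k) set)
    \<Rightarrow> (nat list \<Rightarrow> (('v list \<Rightarrow>\<^sub>0 'k) set list \<Rightarrow>\<^sub>0 'k) set)" where
  "T_act scale t p g x = (\<lambda>c\<in>comps (vdim scale) t p. ext_tensor_act scale c g (x c))"

definition sym_act :: "('k::field \<Rightarrow> 'v::ab_group_add \<Rightarrow> 'v) \<Rightarrow> nat \<Rightarrow> ('v \<Rightarrow> 'v)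
    \<Rightarrow> ('v list \<Rightarrow>\<^sub>0 'k) set \<Rightarrow> ('v list \<Rightarrow>\<^sub>0 'k) set" where
  "sym_act scale t g = quot_lift (sym_power scale t) (\<lambda>vs. sym_prod scale (map g vs))"

end

theory Submission
  imports Defs "HOL-Library.Sublist"
begin

text \<open>
  Fix a basis \<open>b 0, \<dots>, b (n - 1)\<close> of \<open>V\<close>. Then $T_t^p$ has a basis indexed by lists of \<open>p\<close>
  nonempty strictly increasing blocks of indices with \<open>t\<close> letters in all, and the differential cuts one
  block \<open>S\<close> into two blocks \<open>A\<close>, \<open>B\<close> in all possible ways, with the sign of the unshuffle. Reading a list of
  blocks as a word with bars, the cuts fall into two kinds. If \<open>A\<close> is a prefix of \<open>S\<close>, the word stays the
  same and one more bar is put at an ascent. Otherwise the word changes, and it gains inversions because \<open>S\<close>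
  was increasing. Filtering by the number of inversions of the word, only the first kind survives in
  the associated graded complex. There a fixed word gives the complex of all subsets of its ascents
  (the other positions always carry a bar), and this complex is contractible as soon as the word has an
  ascent: remove the bar at the first ascent if there is one. For \<open>p < t\<close> some block has two letters, so
  there is an ascent. Hence a cycle differs from a boundary by a cycle with more inversions, and since
  the number of inversions is at most \<open>t * t\<close> the cycle is a boundary. This is \<open>homotopy_leading\<close> and
  \<open>rcobar_exact\<close>; the case \<open>p = 1\<close> is included, as there are no lists of \<open>0\<close> blocks with \<open>t > 0\<close> letters.

  In $T_t^t = V^{\otimes t}$ no basis is needed. By definition the kernel of the projection to $S^t V$ is
  spanned by the differences of tensors that are permutations of each other, hence by the differences for
  adjacent transpositions, and
  \<open>v\<^sub>1 \<otimes> \<dots> \<otimes> (x \<otimes> y - y \<otimes> x) \<otimes> \<dots> \<otimes> v\<^sub>t\<close> is up to sign the boundary of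
  \<open>v\<^sub>1 \<otimes> \<dots> \<otimes> (x \<and> y) \<otimes> \<dots> \<otimes> v\<^sub>t\<close> (\<open>swap_boundary\<close>, \<open>sym_proj_kernel\<close>).

  The differential on $T_t^p$ is a map between quotients of free spaces. It is compared with a
  differential \<open>rcobar\<close> on the free space on lists of lists, which is defined by recursion and for which
  the square zero property, the compatibility with maps of letters and the estimates for inversions are proved by
  induction. The two are linked by \<open>T_delta_btensor\<close>: on the tensor of the wedges of the
  blocks of \<open>vss\<close> the differential of $T_t^p$ is obtained by applying the same construction to \<open>rcobar vss\<close>.
  As these tensors span $T_t^p$, this formula also gives the equivariance under the linear group and
  the vanishing of the square. That the tensors of basis wedges are linearly independent follows from coordinate
  maps \<open>T_coords\<close>, which are built from the action of \<open>V\<close> on its exterior algebra by left multiplication.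
\<close>

section \<open>Linear extension on free vector spaces\<close>

lemma lookup_free_scale [simp]: "Poly_Mapping.lookup (free_scale c u) x = c * Poly_Mapping.lookup u x"
  unfolding free_scale_def by (simp add: Poly_Mapping.map.rep_eq when_def)

lemma vector_space_free_scale: "vector_space (free_scale :: 'k::field \<Rightarrow> ('x \<Rightarrow>\<^sub>0 'k) \<Rightarrow> _)"
  by standard (auto intro!: poly_mapping_eqI simp: lookup_add algebra_simps)

interpretation free: vector_space "free_scale :: 'k::field \<Rightarrow> ('x \<Rightarrow>\<^sub>0 'k) \<Rightarrow> _"
  by (rule vector_space_free_scale)

lemma keys_free_scale: "Poly_Mapping.keys (free_scale c u) \<subseteq> Poly_Mapping.keys u"
  by (auto simp: in_keys_iff)

lemma keys_gen [simp]: "Poly_Mapping.keys (gen x :: 'x \<Rightarrow>\<^sub>0 'k::field) = {x}"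
  by (simp add: gen_def)

lemma lookup_gen: "Poly_Mapping.lookup (gen x :: 'x \<Rightarrow>\<^sub>0 'k::field) y = (if y = x then 1 else 0)"
  by (simp add: gen_def lookup_single when_def)

definition supported :: "'x set \<Rightarrow> ('x \<Rightarrow>\<^sub>0 'k::field) set" where
  "supported X = {u. Poly_Mapping.keys u \<subseteq> X}"

lemma subspace_supported: "free.subspace (supported X :: ('x \<Rightarrow>\<^sub>0 'k::field) set)"
proof (rule free.subspaceI)
  fix u v :: "'x \<Rightarrow>\<^sub>0 'k" and c :: 'k
  show "u \<in> supported X \<Longrightarrow> v \<in> supported X \<Longrightarrow> u + v \<in> supported X"
    using Poly_Mapping.keys_add[of u v] by (auto simp: supported_def)
  show "u \<in> supported X \<Longrightarrow> free_scale c u \<in> supported X"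
    using keys_free_scale[of c u] by (auto simp: supported_def)
qed (simp add: supported_def)

lemma supported_0 [simp]: "0 \<in> supported X"
  and supported_gen [simp]: "gen x \<in> supported X \<longleftrightarrow> x \<in> X"
  by (simp_all add: supported_def)

lemmas supported_add = free.subspace_add[OF subspace_supported]
  and supported_diff = free.subspace_diff[OF subspace_supported]
  and supported_scale = free.subspace_scale[OF subspace_supported]
  and supported_sum = free.subspace_sum[OF subspace_supported]
  and supported_neg = free.subspace_neg[OF subspace_supported]

lemma supported_mono: "u \<in> supported X \<Longrightarrow> X \<subseteq> Y \<Longrightarrow> u \<in> supported Y"
  by (auto simp: supported_def)

lemma supported_keys [simp]: "u \<in> supported (Poly_Mapping.keys u)"
  by (simp add: supported_def)

lemma supported_empty: "u \<in> supported {} \<Longrightarrow> u = 0"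
  by (simp add: supported_def)

text \<open>The linear extension of \<open>f\<close> from generators to the free space. Nearly all maps
  between free spaces below have this form, and identities between them are reduced to generators by
  \<open>free_ext_comp\<close> and \<open>free_ext_cong\<close>.\<close>

definition free_ext :: "('x \<Rightarrow> ('y \<Rightarrow>\<^sub>0 'k::field)) \<Rightarrow> ('x \<Rightarrow>\<^sub>0 'k) \<Rightarrow> ('y \<Rightarrow>\<^sub>0 'k)" where
  "free_ext f u = (\<Sum>x\<in>Poly_Mapping.keys u. free_scale (Poly_Mapping.lookup u x) (f x))"

lemma free_ext_superset:
  assumes "finite A" "Poly_Mapping.keys u \<subseteq> A"
  shows "free_ext f u = (\<Sum>x\<in>A. free_scale (Poly_Mapping.lookup u x) (f x))"
  unfolding free_ext_def by (rule sum.mono_neutral_left) (use assms in \<open>auto simp: in_keys_iff\<close>)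

lemma free_ext_add: "free_ext f (u + v) = free_ext f u + free_ext f v"
proof -
  let ?A = "Poly_Mapping.keys u \<union> Poly_Mapping.keys v"
  have "Poly_Mapping.keys (u + v) \<subseteq> ?A" by (rule Poly_Mapping.keys_add)
  then show ?thesis
    by (simp add: free_ext_superset[of ?A] lookup_add free.scale_left_distrib sum.distrib)
qed

lemma free_ext_scale: "free_ext f (free_scale c u) = free_scale c (free_ext f u)"
  using keys_free_scale[of c u]
  by (simp add: free_ext_superset[of "Poly_Mapping.keys u"] free.scale_sum_right)

lemma free_ext_0 [simp]: "free_ext f 0 = 0"
  by (simp add: free_ext_def)

lemma free_ext_gen [simp]: "free_ext f (gen x) = f x"
  by (simp add: free_ext_def lookup_gen)

lemma free_ext_neg: "free_ext f (- u) = - free_ext f u"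
  using free_ext_scale[of f "-1" u] by simp

lemma free_ext_diff: "free_ext f (u - v) = free_ext f u - free_ext f v"
  using free_ext_add[of f u "- v"] by (simp add: free_ext_neg)

lemma free_ext_sum: "free_ext f (sum g A) = (\<Sum>a\<in>A. free_ext f (g a))"
  by (induct A rule: infinite_finite_induct) (auto simp: free_ext_add)

lemmas free_ext_simps = free_ext_add free_ext_diff free_ext_neg free_ext_scale free_ext_sum

lemma free_ext_cong: "(\<And>x. x \<in> Poly_Mapping.keys u \<Longrightarrow> f x = g x) \<Longrightarrow> free_ext f u = free_ext g u"
  by (simp add: free_ext_def)

lemma free_ext_cong_supported: "u \<in> supported X \<Longrightarrow> (\<And>x. x \<in> X \<Longrightarrow> f x = g x) \<Longrightarrow> free_ext f u = free_ext g u"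
  by (rule free_ext_cong) (auto simp: supported_def)

lemma free_ext_eq_id: "u \<in> supported X \<Longrightarrow> (\<And>x. x \<in> X \<Longrightarrow> f x = gen x) \<Longrightarrow> free_ext f u = u"
proof -
  have *: "free_ext gen u = u"
    by (rule poly_mapping_eqI)
      (simp add: free_ext_def lookup_sum lookup_gen if_distrib sum.delta in_keys_iff cong: if_cong)
  assume "u \<in> supported X" "\<And>x. x \<in> X \<Longrightarrow> f x = gen x"
  then show ?thesis using free_ext_cong_supported[of u X f gen] * by simp
qed

lemma free_ext_comp: "free_ext f (free_ext g u) = free_ext (\<lambda>x. free_ext f (g x)) u"
  by (simp add: free_ext_def[of g] free_ext_def[of "\<lambda>x. free_ext f (g x)"] free_ext_sum free_ext_scale)

lemma free_ext_fun_add: "free_ext (\<lambda>x. f x + g x) u = free_ext f u + free_ext g u"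
  by (simp add: free_ext_def free.scale_right_distrib sum.distrib)

lemma free_ext_fun_diff: "free_ext (\<lambda>x. f x - g x) u = free_ext f u - free_ext g u"
  by (simp add: free_ext_def free.scale_right_diff_distrib sum_subtractf)

lemma free_ext_fun_neg: "free_ext (\<lambda>x. - f x) u = - free_ext f u"
  by (simp add: free_ext_def sum_negf)

lemma free_ext_fun_scale: "free_ext (\<lambda>x. free_scale c (f x)) u = free_scale c (free_ext f u)"
  by (simp add: free_ext_def free.scale_sum_right mult.commute)

lemma free_ext_fun_zero [simp]: "free_ext (\<lambda>x. 0) u = 0"
  by (simp add: free_ext_def)

lemma free_ext_fun_sum: "free_ext (\<lambda>x. \<Sum>k\<in>A. g k x) u = (\<Sum>k\<in>A. free_ext (g k) u)"
  by (induct A rule: infinite_finite_induct) (simp_all add: free_ext_fun_add)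

lemma free_ext_commute:
  "free_ext (\<lambda>x. free_ext (\<lambda>y. f x y) v) u = free_ext (\<lambda>y. free_ext (\<lambda>x. f x y) u) v"
proof -
  have "free_ext (\<lambda>x. free_ext (\<lambda>y. f x y) v) u = (\<Sum>x\<in>Poly_Mapping.keys u. \<Sum>y\<in>Poly_Mapping.keys v.
      free_scale (Poly_Mapping.lookup u x * Poly_Mapping.lookup v y) (f x y))"
    by (simp add: free_ext_def free.scale_sum_right)
  also have "\<dots> = (\<Sum>y\<in>Poly_Mapping.keys v. \<Sum>x\<in>Poly_Mapping.keys u.
      free_scale (Poly_Mapping.lookup v y * Poly_Mapping.lookup u x) (f x y))"
    by (subst sum.swap) (simp add: mult.commute)
  finally show ?thesis by (simp add: free_ext_def free.scale_sum_right)
qed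

lemma free_ext_supported:
  assumes "u \<in> supported X" "\<And>x. x \<in> X \<Longrightarrow> f x \<in> supported Y"
  shows "free_ext f u \<in> supported Y"
  unfolding free_ext_def by (intro supported_sum supported_scale assms(2)) (use assms(1) in \<open>auto simp: supported_def\<close>)

section \<open>The cobar differential on lists of blocks\<close>

text \<open>The coproduct of the tensor algebra with signs: every letter goes to the left or to the right
  part, and a letter that goes to the right has to pass the letters of the left part. Empty parts are allowed
  here; they make the recursion uniform and are removed later by \<open>prune\<close>.\<close>

fun unshuffle :: "'a list \<Rightarrow> ('a list \<times> 'a list \<Rightarrow>\<^sub>0 'k::field)" where
  "unshuffle [] = gen ([], [])"
| "unshuffle (v # vs) = free_ext (\<lambda>(A, B). gen (v # A, B) + free_scale ((-1) ^ length A) (gen (A, v # B))) (unshuffle vs)"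

lemma unshuffle_keys:
  "unshuffle vs \<in> supported {(A, B). subseq A vs \<and> subseq B vs \<and> mset A + mset B = mset vs}"
proof (induct vs)
  case (Cons v vs)
  show ?case unfolding unshuffle.simps
    by (rule free_ext_supported[OF Cons]) (auto intro!: supported_add supported_scale)
qed simp

lemma unshuffle_length: "unshuffle vs \<in> supported {(A, B). length A + length B = length vs}"
  by (rule supported_mono[OF unshuffle_keys]) (auto dest: arg_cong[of _ _ size])

lemma unshuffle_map: "unshuffle (map g vs) = free_ext (\<lambda>(A, B). gen (map g A, map g B)) (unshuffle vs)"
proof (induct vs)
  case (Cons v vs)
  show ?case unfolding unshuffle.simps list.map Cons
    by (auto simp: free_ext_comp free_ext_simps intro!: free_ext_cong split: prod.splits)
qed simp

text \<open>Both sides are the sum over all ways to distribute the letters among three parts. Each of them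
  satisfies the recursion that inserts the first letter into one of the three parts.\<close>

lemma unshuffle_coassoc:
  "free_ext (\<lambda>(A, B). free_ext (\<lambda>(A1, A2). gen (A1, A2, B)) (unshuffle A)) (unshuffle vs)
   = (free_ext (\<lambda>(A, B). free_ext (\<lambda>(B1, B2). gen (A, B1, B2)) (unshuffle B)) (unshuffle vs)
      :: 'a list \<times> 'a list \<times> 'a list \<Rightarrow>\<^sub>0 'k::field)"
proof (induct vs)
  case (Cons v vs)
  \<comment> \<open>the recursion step for three parts: the first letter passes all letters of the parts to the left of its own\<close>
  define ins :: "'a list \<times> 'a list \<times> 'a list \<Rightarrow> ('a list \<times> 'a list \<times> 'a list \<Rightarrow>\<^sub>0 'k)" where
    "ins = (\<lambda>(A, B, C). gen (v # A, B, C) + free_scale ((-1) ^ length A) (gen (A, v # B, C))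
       + free_scale ((-1) ^ (length A + length B)) (gen (A, B, v # C)))"
  have L: "free_ext (\<lambda>(A, B). free_ext (\<lambda>(A1, A2). gen (A1, A2, B)) (unshuffle A)) (unshuffle (v # vs))
    = free_ext ins (free_ext (\<lambda>(A, B). free_ext (\<lambda>(A1, A2). gen (A1, A2, B)) (unshuffle A)) (unshuffle vs))"
    unfolding unshuffle.simps free_ext_comp
  proof (rule free_ext_cong, clarsimp simp: free_ext_simps free_ext_comp)
    fix A B :: "'a list"
    show "free_ext (\<lambda>x. free_ext (\<lambda>(A1, A2). gen (A1, A2, B)) (case x of (A', B') \<Rightarrow> gen (v # A', B') + free_scale ((-1) ^ length A') (gen (A', v # B')))) (unshuffle A) +
       free_scale ((-1) ^ length A) (free_ext (\<lambda>(A1, A2). gen (A1, A2, v # B)) (unshuffle A)) =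
       free_ext (\<lambda>x. free_ext ins (case x of (A1, A2) \<Rightarrow> gen (A1, A2, B))) (unshuffle A)"
      unfolding free_ext_fun_scale[symmetric] free_ext_fun_add[symmetric]
      by (rule free_ext_cong_supported[OF unshuffle_length]) (auto simp: ins_def free_ext_simps)
  qed
  have R: "free_ext (\<lambda>(A, B). free_ext (\<lambda>(B1, B2). gen (A, B1, B2)) (unshuffle B)) (unshuffle (v # vs))
    = free_ext ins (free_ext (\<lambda>(A, B). free_ext (\<lambda>(B1, B2). gen (A, B1, B2)) (unshuffle B)) (unshuffle vs))"
    unfolding unshuffle.simps free_ext_comp
    by (rule free_ext_cong)
      (auto simp: free_ext_simps free_ext_comp free_ext_fun_scale[symmetric] free_ext_fun_add[symmetric]
        ins_def power_add algebra_simps intro!: free_ext_cong)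
  show ?case unfolding L R Cons ..
qed simp

text \<open>The cobar differential, written as a graded derivation for the concatenation of lists of blocks:
  each block has degree 1, hence the sign in the recursion.\<close>

fun cobar :: "'a list list \<Rightarrow> ('a list list \<Rightarrow>\<^sub>0 'k::field)" where
  "cobar [] = 0"
| "cobar (b # bs) = free_ext (\<lambda>(A, B). gen (A # B # bs)) (unshuffle b) - free_ext (\<lambda>cs. gen (b # cs)) (cobar bs)"

text \<open>The square of a derivation of degree 1 is a derivation, so only a single block matters; there the
  square is the difference of the two sides of coassociativity.\<close>

lemma cobar_cobar: "free_ext cobar (cobar bs) = (0 :: 'a list list \<Rightarrow>\<^sub>0 'k::field)"
proof (induct bs)
  case (Cons b bs)
  let ?u = "unshuffle b :: 'a list \<times> 'a list \<Rightarrow>\<^sub>0 'k"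
  let ?c = "cobar bs :: 'a list list \<Rightarrow>\<^sub>0 'k"
  let ?h = "\<lambda>(A, B, C). gen (A # B # C # bs) :: 'a list list \<Rightarrow>\<^sub>0 'k"
  have "free_ext cobar (cobar (b # bs)) = free_ext (\<lambda>(A, B). cobar (A # B # bs)) ?u - free_ext (\<lambda>cs. cobar (b # cs)) ?c"
    unfolding cobar.simps(2)[of b bs] free_ext_diff free_ext_comp by (simp add: split_def del: cobar.simps)
  also have "free_ext (\<lambda>cs. cobar (b # cs)) ?c
     = free_ext (\<lambda>cs. free_ext (\<lambda>(A, B). gen (A # B # cs)) ?u) ?c
       - free_ext (\<lambda>cs. gen (b # cs)) (free_ext cobar ?c)"
    by (simp add: free_ext_fun_diff free_ext_comp)
  also have "\<dots> = free_ext (\<lambda>(A, B). free_ext (\<lambda>cs. gen (A # B # cs)) ?c) ?u"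
    unfolding Cons by (subst free_ext_commute) (auto intro!: free_ext_cong)
  also have "free_ext (\<lambda>(A, B). cobar (A # B # bs)) ?u =
      free_ext (\<lambda>(A, B). free_ext (\<lambda>(A1, A2). gen (A1 # A2 # B # bs)) (unshuffle A)) ?u
    - free_ext (\<lambda>(A, B). free_ext (\<lambda>(B1, B2). gen (A # B1 # B2 # bs)) (unshuffle B)) ?u
    + free_ext (\<lambda>(A, B). free_ext (\<lambda>cs. gen (A # B # cs)) ?c) ?u"
    unfolding free_ext_fun_add[symmetric] free_ext_fun_diff[symmetric]
    by (rule free_ext_cong) (auto simp: free_ext_simps free_ext_comp split_def)
  also have "free_ext (\<lambda>(A, B). free_ext (\<lambda>(A1, A2). gen (A1 # A2 # B # bs)) (unshuffle A)) ?u
     = free_ext ?h (free_ext (\<lambda>(A, B). free_ext (\<lambda>(A1, A2). gen (A1, A2, B)) (unshuffle A)) ?u)"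
    by (simp add: free_ext_comp split_def)
  also have "\<dots> = free_ext (\<lambda>(A, B). free_ext (\<lambda>(B1, B2). gen (A # B1 # B2 # bs)) (unshuffle B)) ?u"
    unfolding unshuffle_coassoc by (simp add: free_ext_comp split_def)
  finally show ?case by simp
qed simp

definition prune :: "'a list list \<Rightarrow> ('a list list \<Rightarrow>\<^sub>0 'k::field)" where
  "prune bs = (if [] \<in> set bs then 0 else gen bs)"

text \<open>The differential of the reduced complex. Lists with an empty block span a subcomplex of the
  complex with differential \<open>cobar\<close> (\<open>cobar_empty_block\<close>), and \<open>rcobar\<close>
  is the differential of the quotient.\<close>

definition rcobar :: "'a list list \<Rightarrow> ('a list list \<Rightarrow>\<^sub>0 'k::field)" where
  "rcobar bs = free_ext prune (cobar bs)"

text \<open>The empty block is only cut into two empty blocks, so a list with an empty block stays in the span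
  of such lists.\<close>

lemma cobar_empty_block: "[] \<in> set bs \<Longrightarrow> free_ext prune (cobar bs) = (0 :: 'a list list \<Rightarrow>\<^sub>0 'k::field)"
proof (induct bs)
  case (Cons b bs)
  have 1: "free_ext prune (free_ext (\<lambda>(A, B). gen (A # B # bs)) (unshuffle b)) = (0 :: 'a list list \<Rightarrow>\<^sub>0 'k)"
  proof (cases "b = []")
    case False
    then show ?thesis using Cons.prems
      by (auto simp: free_ext_comp prune_def split_def)
  qed (simp add: prune_def)
  have 2: "free_ext prune (free_ext (\<lambda>cs. gen (b # cs)) (cobar bs)) = (0 :: 'a list list \<Rightarrow>\<^sub>0 'k)"
  proof (cases "b = []")
    case False
    have "free_ext prune (free_ext (\<lambda>cs. gen (b # cs)) (cobar bs))
      = free_ext (\<lambda>cs. gen (b # cs)) (free_ext prune (cobar bs) :: 'a list list \<Rightarrow>\<^sub>0 'k)"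
      using False unfolding free_ext_comp by (intro free_ext_cong) (auto simp: prune_def)
    also have "\<dots> = 0" using Cons False by auto
    finally show ?thesis .
  qed (simp add: prune_def free_ext_comp)
  show ?case by (simp add: free_ext_diff 1 2)
qed simp

lemma rcobar_rcobar: "free_ext rcobar (rcobar bs) = (0 :: 'a list list \<Rightarrow>\<^sub>0 'k::field)"
proof -
  have "free_ext rcobar (rcobar bs) = free_ext (\<lambda>cs. free_ext rcobar (prune cs)) (cobar bs :: 'a list list \<Rightarrow>\<^sub>0 'k)"
    by (simp add: rcobar_def[of bs] free_ext_comp)
  also have "\<dots> = free_ext rcobar (cobar bs :: 'a list list \<Rightarrow>\<^sub>0 'k)"
    by (rule free_ext_cong) (simp add: prune_def rcobar_def cobar_empty_block)
  also have "\<dots> = free_ext prune (free_ext cobar (cobar bs))"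
    by (simp add: rcobar_def[abs_def] free_ext_comp)
  finally show ?thesis by (simp add: cobar_cobar)
qed

lemma cobar_map: "cobar (map (map g) bs) = free_ext (\<lambda>cs. gen (map (map g) cs)) (cobar bs)"
proof (induct bs)
  case (Cons b bs)
  show ?case unfolding cobar.simps list.map Cons unshuffle_map
    by (auto simp: free_ext_comp free_ext_simps intro!: free_ext_cong arg_cong2[of _ _ _ _ "(-)"])
qed simp

lemma rcobar_map: "rcobar (map (map g) bs) = free_ext (\<lambda>cs. gen (map (map g) cs)) (rcobar bs)"
  unfolding rcobar_def cobar_map free_ext_comp
  by (rule free_ext_cong) (auto simp: prune_def)

lemma rcobar_Cons:
  assumes "b \<noteq> []" "[] \<notin> set bs"
  shows "rcobar (b # bs) = free_ext (\<lambda>(A, B). if A = [] \<or> B = [] then 0 else gen (A # B # bs)) (unshuffle b)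
    - free_ext (\<lambda>cs. gen (b # cs)) (rcobar bs)"
  unfolding rcobar_def cobar.simps free_ext_diff free_ext_comp
  using assms by (intro arg_cong2[of _ _ _ _ "(-)"] free_ext_cong) (auto simp: prune_def)

section \<open>Exactness on strictly increasing blocks\<close>

definition inc_blocks :: "'a::linorder list list \<Rightarrow> bool" where
  "inc_blocks bs \<longleftrightarrow> (\<forall>b\<in>set bs. b \<noteq> [] \<and> sorted_wrt (<) b)"

lemma inc_blocks_Cons [simp]: "inc_blocks (b # bs) \<longleftrightarrow> b \<noteq> [] \<and> sorted_wrt (<) b \<and> inc_blocks bs"
  and inc_blocks_Nil [simp]: "inc_blocks []"
  by (auto simp: inc_blocks_def)

lemma sorted_wrt_subseq: "subseq A B \<Longrightarrow> sorted_wrt P B \<Longrightarrow> sorted_wrt P A"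
proof (induct rule: list_emb.induct)
  case (list_emb_Cons2 x y xs ys)
  from list_emb_Cons2(2) have "set xs \<subseteq> set ys" by (metis notin_set_nthsI subseq_conv_nths subsetI)
  with list_emb_Cons2 show ?case by auto
qed auto

lemma rcobar_inc:
  "inc_blocks bs \<Longrightarrow> rcobar bs \<in> supported {cs. inc_blocks cs \<and> mset (concat cs) = mset (concat bs) \<and> length cs = Suc (length bs)}"
proof (induct bs)
  case Nil
  then show ?case by (simp add: rcobar_def)
next
  case (Cons b bs)
  have b: "b \<noteq> []" "[] \<notin> set bs" using Cons.prems by (auto simp: inc_blocks_def)
  show ?case unfolding rcobar_Cons[OF b]
  proof (intro supported_diff, goal_cases)
    case 1 show ?case
      by (rule free_ext_supported[OF unshuffle_keys]) (use Cons.prems in \<open>auto intro: sorted_wrt_subseq simp flip: union_assoc\<close>)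
  next
    case 2 show ?case
      by (rule free_ext_supported[OF Cons.hyps]) (use Cons.prems in auto)
  qed
qed

subsection \<open>Inversions\<close>

fun inversions :: "'a::linorder list \<Rightarrow> nat" where
  "inversions [] = 0"
| "inversions (x # xs) = size {#y \<in># mset xs. y < x#} + inversions xs"

definition cross_inversions :: "'a::linorder multiset \<Rightarrow> 'a multiset \<Rightarrow> nat" where
  "cross_inversions M N = (\<Sum>x\<in>#M. size {#y \<in># N. y < x#})"

text \<open>The last term depends only on the letters of the two parts. So rearranging the letters of a middle
  segment changes the number of inversions of a word by the same amount as that of the segment.\<close>

lemma inversions_append:
  "inversions (xs @ ys) = inversions xs + inversions ys + cross_inversions (mset xs) (mset ys)"
  by (induct xs) (auto simp: cross_inversions_def)

lemma inversions_eq_0_iff: "inversions xs = 0 \<longleftrightarrow> sorted xs"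
proof (induct xs)
  case (Cons x xs)
  have "size {#y \<in># mset xs. y < x#} = 0 \<longleftrightarrow> (\<forall>y\<in>set xs. x \<le> y)"
    by (auto simp: not_less)
  with Cons show ?case by auto
qed simp

lemma inversions_le: "inversions xs \<le> length xs * length xs"
proof (induct xs)
  case (Cons x xs)
  have "size {#y \<in># mset xs. y < x#} \<le> length xs"
    by (metis size_filter_mset_lesseq size_mset)
  with Cons show ?case by simp
qed simp

text \<open>A word without inversions is sorted, and there is only one sorted rearrangement.\<close>

lemma inversions_gt_0:
  assumes "sorted_wrt (<) S" "mset (A @ B) = mset S" "A @ B \<noteq> S"
  shows "0 < inversions (A @ B)"
proof (rule ccontr)
  assume "\<not> ?thesis"
  then have "sorted (A @ B)" by (metis inversions_eq_0_iff neq0_conv)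
  moreover have "sorted S" using assms(1) by (simp add: strict_sorted_imp_sorted)
  ultimately show False using assms(2,3) by (metis properties_for_sort sorted_sort_id)
qed

lemma not_increasing_split: "\<not> sorted_wrt (<) S \<Longrightarrow> \<exists>pre x y post. S = pre @ x # y # post \<and> (y :: 'a::linorder) \<le> x"
proof (induct S)
  case (Cons a S)
  show ?case
  proof (cases "sorted_wrt (<) S")
    case True
    then obtain y post where S: "S = y # post" using Cons.prems by (cases S) auto
    have "y \<le> a"
    proof (rule ccontr)
      assume "\<not> y \<le> a"
      then have "sorted_wrt (<) (a # S)" using True S by auto
      then show False using Cons.prems by simp
    qed
    then show ?thesis using S by (intro exI[of _ "[]"] exI[of _ a] exI[of _ y] exI[of _ post]) simp
  next
    case False
    then obtain pre x y post where "S = pre @ x # y # post" "y \<le> x" using Cons.hyps by blast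
    then show ?thesis by (intro exI[of _ "a # pre"] exI[of _ x] exI[of _ y] exI[of _ post]) simp
  qed
qed simp

subsection \<open>The leading part of the differential\<close>

fun cuts :: "'a list \<Rightarrow> ('a list \<times> 'a list \<Rightarrow>\<^sub>0 'k::field)" where
  "cuts (x # y # S) = gen ([x], y # S) + free_ext (\<lambda>(A, B). gen (x # A, B)) (cuts (y # S))"
| "cuts _ = 0"

text \<open>The part of the differential that keeps the underlying word: blocks are only cut into a prefix and
  a suffix.\<close>

fun leading :: "'a list list \<Rightarrow> ('a list list \<Rightarrow>\<^sub>0 'k::field)" where
  "leading [] = 0"
| "leading (b # bs) = free_ext (\<lambda>(A, B). gen (A # B # bs)) (cuts b) - free_ext (\<lambda>cs. gen (b # cs)) (leading bs)"

lemma cuts_keys: "cuts b \<in> supported {(A, B). A \<noteq> [] \<and> B \<noteq> [] \<and> A @ B = b}"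
proof (induct b rule: cuts.induct)
  case (1 x y S)
  show ?case unfolding cuts.simps
    by (intro supported_add free_ext_supported[OF 1]) auto
qed auto

lemma leading_keys:
  "inc_blocks bs \<Longrightarrow> leading bs \<in> supported {cs. inc_blocks cs \<and> concat cs = concat bs \<and> cs \<noteq> [] \<and> hd (hd cs) = hd (hd bs)}"
proof (induct bs)
  case (Cons b bs)
  show ?case unfolding leading.simps
  proof (intro supported_diff, goal_cases)
    case 1 show ?case
      by (rule free_ext_supported[OF cuts_keys]) (use Cons.prems in \<open>auto simp: sorted_wrt_append\<close>)
  next
    case 2 show ?case
      by (rule free_ext_supported[OF Cons.hyps]) (use Cons.prems in auto)
  qed
qed simp

definition prune_pair :: "'a list \<times> 'a list \<Rightarrow> ('a list \<times> 'a list \<Rightarrow>\<^sub>0 'k::field)" where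
  "prune_pair = (\<lambda>(A, B). if A = [] \<or> B = [] then 0 else gen (A, B))"

text \<open>The variant of \<open>cuts\<close> with the two trivial cuts; its recursion has the same shape as
  that of \<open>unshuffle\<close>.\<close>

fun all_cuts :: "'a list \<Rightarrow> ('a list \<times> 'a list \<Rightarrow>\<^sub>0 'k::field)" where
  "all_cuts [] = gen ([], [])"
| "all_cuts (x # S) = gen ([], x # S) + free_ext (\<lambda>(A, B). gen (x # A, B)) (all_cuts S)"

lemma all_cuts_cuts: "b \<noteq> [] \<Longrightarrow> all_cuts b = gen ([], b) + cuts b + gen (b, [])"
proof (induct b rule: cuts.induct)
  case (1 x y S)
  show ?case unfolding all_cuts.simps(2)[of x] cuts.simps(1)
    by (simp only: 1(1)[OF list.distinct(2)] free_ext_add) (simp add: algebra_simps)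
qed (simp_all add: free_ext_simps)

text \<open>A cut into a prefix and a suffix has sign 1 in the unshuffle, as no letter of the right part
  precedes a letter of the left part. No other unshuffle of an increasing word concatenates to the word
  itself, because its letters are distinct.\<close>

lemma unshuffle_all_cuts:
  "sorted_wrt (<) (S :: 'a::linorder list) \<Longrightarrow> unshuffle S - all_cuts S \<in> supported {(A, B). mset (A @ B) = mset S \<and> A @ B \<noteq> S}"
proof (induct S)
  case (Cons x S)
  let ?X = "{(A, B). mset (A @ B) = mset (x # S) \<and> A @ B \<noteq> x # S}"
  let ?f = "\<lambda>(A, B). gen (x # A, B) :: 'a list \<times> 'a list \<Rightarrow>\<^sub>0 'b"
  let ?g = "\<lambda>(A, B). free_scale ((-1) ^ length A) (gen (A, x # B)) :: 'a list \<times> 'a list \<Rightarrow>\<^sub>0 'b"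
  have x: "x \<notin> set S" using Cons.prems by auto
  have ac: "all_cuts S \<in> supported {(A, B). A @ B = S}" for S :: "'a list"
    by (induct S) (auto intro!: supported_add free_ext_supported)
  have "unshuffle (x # S) - all_cuts (x # S) = free_ext ?f (unshuffle S - all_cuts S) + (free_ext ?g (unshuffle S) - gen ([], x # S))"
    by (simp add: split_def free_ext_fun_add free_ext_diff)
  also have "free_ext ?g (unshuffle S) = free_ext ?g (unshuffle S - all_cuts S) + free_ext ?g (all_cuts S)"
    by (simp add: free_ext_diff)
  also have "free_ext ?f (unshuffle S - all_cuts S) + (\<dots> - gen ([], x # S))
    = free_ext ?f (unshuffle S - all_cuts S) + free_ext ?g (unshuffle S - all_cuts S) + (free_ext ?g (all_cuts S) - gen ([], x # S))"
    by simp
  also have "\<dots> \<in> supported ?X"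
  proof (intro supported_add)
    have ne: "A @ x # B \<noteq> x # S" if "A @ B \<noteq> S \<or> A \<noteq> []" "mset (A @ B) = mset S" for A B
      using that x by (cases A) (auto dest: mset_eq_setD)
    show "free_ext ?f (unshuffle S - all_cuts S) \<in> supported ?X"
      by (rule free_ext_supported[OF Cons.hyps]) (use Cons.prems in auto)
    show "free_ext ?g (unshuffle S - all_cuts S) \<in> supported ?X"
      by (rule free_ext_supported[OF Cons.hyps]) (use Cons.prems ne in \<open>auto intro!: supported_scale\<close>)
    show "free_ext ?g (all_cuts S) - gen ([], x # S) \<in> supported ?X"
    proof (cases S)
      case (Cons y S')
      have "free_ext ?g (all_cuts S) - gen ([], x # S) = free_ext ?g (free_ext (\<lambda>(A, B). gen (y # A, B)) (all_cuts S'))"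
        by (simp add: Cons free_ext_add)
      also have "\<dots> \<in> supported ?X" unfolding free_ext_comp
        by (rule free_ext_supported[OF ac]) (use Cons x in \<open>auto intro!: supported_scale supported_neg\<close>)
      finally show ?thesis .
    qed simp
  qed
  finally show ?case .
qed simp

text \<open>The terms of \<open>rcobar\<close> other than those of \<open>leading\<close> replace a block by a
  rearrangement with inversions.\<close>

lemma rcobar_leading:
  "inc_blocks bs \<Longrightarrow> rcobar bs - leading bs \<in> supported {cs. mset (concat cs) = mset (concat bs) \<and> inversions (concat cs) > inversions (concat bs)}"
proof (induct bs)
  case Nil
  show ?case by (simp add: rcobar_def)
next
  case (Cons b bs)
  let ?X = "{cs. mset (concat cs) = mset (concat (b # bs)) \<and> inversions (concat cs) > inversions (concat (b # bs))}"
  let ?f = "\<lambda>(A, B). gen (A # B # bs) :: 'a list list \<Rightarrow>\<^sub>0 'b"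
  let ?s = "prune_pair :: _ \<Rightarrow> 'a list \<times> 'a list \<Rightarrow>\<^sub>0 'b"
  have b: "b \<noteq> []" "[] \<notin> set bs" using Cons.prems by (auto simp: inc_blocks_def)
  have s: "sorted_wrt (<) b" "inversions b = 0" using Cons.prems
    by (auto simp: inversions_eq_0_iff strict_sorted_imp_sorted)
  have r: "rcobar (b # bs) = free_ext ?f (free_ext ?s (unshuffle b)) - free_ext (\<lambda>cs. gen (b # cs)) (rcobar bs)"
    unfolding rcobar_Cons[OF b] free_ext_comp
    by (intro arg_cong2[of _ _ _ _ "(-)"] free_ext_cong) (auto simp: prune_pair_def)
  have "free_ext ?s (cuts b) = cuts b"
    by (rule free_ext_eq_id[OF cuts_keys]) (auto simp: prune_pair_def)
  then have c: "cuts b = free_ext ?s (all_cuts b)"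
    by (simp add: all_cuts_cuts[OF b(1)] free_ext_add) (simp add: prune_pair_def)
  have "rcobar (b # bs) - leading (b # bs) = free_ext ?f (free_ext ?s (unshuffle b - all_cuts b)) - free_ext (\<lambda>cs. gen (b # cs)) (rcobar bs - leading bs)"
    unfolding r leading.simps c by (simp add: free_ext_diff)
  also have "\<dots> \<in> supported ?X" unfolding free_ext_comp
  proof (intro supported_diff, goal_cases)
    case 1 show ?case
    proof (rule free_ext_supported[OF unshuffle_all_cuts[OF s(1)]])
      fix AB assume "AB \<in> {(A, B). mset (A @ B) = mset b \<and> A @ B \<noteq> b}"
      then obtain A B where AB: "AB = (A, B)" "mset (A @ B) = mset b" "A @ B \<noteq> b" by auto
      have "inversions (concat (A # B # bs)) > inversions (concat (b # bs))"
        using inversions_gt_0[OF s(1) AB(2,3)] AB(2) s(2) inversions_append[of "A @ B" "concat bs"]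
        by (simp add: inversions_append[of b])
      moreover have "mset (concat (A # B # bs)) = mset (concat (b # bs))" using AB(2) by (simp flip: union_assoc)
      ultimately show "free_ext ?f (?s AB) \<in> supported ?X" by (auto simp: AB prune_pair_def)
    qed
  next
    case 2 show ?case
      by (rule free_ext_supported[OF Cons.hyps]) (use Cons.prems in \<open>auto simp: inversions_append\<close>)
  qed
  finally show ?case .
qed

subsection \<open>The homotopy\<close>

text \<open>Remove the bar at the first ascent of the word. As long as no ascent has been met, all blocks are
  single letters \<open>[x]\<close>, and the bar after \<open>[x]\<close> sits at an ascent iff
  \<open>x\<close> is smaller than the head of the next block. If the first block has more letters, then the
  first ascent carries no bar and the result is zero. Passing over a block costs a sign.\<close>

fun homotopy :: "'a::linorder list list \<Rightarrow> ('a list list \<Rightarrow>\<^sub>0 'k::field)" where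
  "homotopy ([x] # c # bs) = (if x < hd c then gen ((x # c) # bs) else - free_ext (\<lambda>cs. gen ([x] # cs)) (homotopy (c # bs)))"
| "homotopy _ = 0"

lemma homotopy_keys:
  "inc_blocks bs \<Longrightarrow> homotopy bs \<in> supported {cs. inc_blocks cs \<and> concat cs = concat bs \<and> Suc (length cs) = length bs}"
proof (induct bs rule: homotopy.induct)
  case (1 x c bs)
  show ?case
  proof (cases "x < hd c")
    case True
    then show ?thesis using 1(2) by (cases c) auto
  next
    case False
    then show ?thesis using 1(2)
      by (auto intro!: supported_neg free_ext_supported[OF 1(1)])
  qed
qed auto

text \<open>If the first block \<open>b\<close> has at least two letters, only the cut after its first letter
  has a nonzero image under the homotopy, and this image is the original list. If \<open>b = [x]\<close> and
  \<open>x\<close> is below the head of the next block \<open>c\<close>, the bar after \<open>x\<close> is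
  removed, and cutting \<open>x # c\<close> after \<open>x\<close> restores the list while all other terms
  cancel. In the remaining case both operators act on the tail, up to two signs that cancel.\<close>

lemma homotopy_leading:
  "inc_blocks bs \<Longrightarrow> \<exists>b\<in>set bs. length b \<ge> 2 \<Longrightarrow>
    free_ext homotopy (leading bs) + free_ext leading (homotopy bs) = (gen bs :: 'a::linorder list list \<Rightarrow>\<^sub>0 'k::field)"
proof (induct bs)
  case (Cons b bs)
  consider (long) x y S where "b = x # y # S" | (short) x where "b = [x]"
    using Cons.prems by (cases b rule: cuts.cases) auto
  then show ?case
  proof cases
    case long
    have "free_ext homotopy (free_ext (\<lambda>(A, B). gen (A # B # bs)) (free_ext (\<lambda>(A, B). gen (x # A, B)) (cuts (y # S)))) = (0 :: 'a list list \<Rightarrow>\<^sub>0 'k)"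
      unfolding free_ext_comp
      by (subst free_ext_cong_supported[OF cuts_keys, where g = "\<lambda>_. 0"]) (auto simp: neq_Nil_conv)
    moreover have "free_ext homotopy (free_ext (\<lambda>cs. gen ((x # y # S) # cs)) (leading bs)) = (0 :: 'a list list \<Rightarrow>\<^sub>0 'k)"
      by (simp add: free_ext_comp)
    ultimately show ?thesis using Cons.prems by (simp add: long free_ext_diff free_ext_add)
  next
    case short
    with Cons.prems obtain c cs where bs: "bs = c # cs" by (cases bs) auto
    have inc: "inc_blocks (c # cs)" and c: "c \<noteq> []" "sorted_wrt (<) c" and big: "\<exists>b\<in>set (c # cs). length b \<ge> 2"
      using Cons.prems by (auto simp: short bs)
    let ?p = "\<lambda>x. free_ext (\<lambda>cs. gen ([x] # cs)) :: _ \<Rightarrow> ('a list list \<Rightarrow>\<^sub>0 'k)"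
    show ?thesis
    proof (cases "x < hd c")
      case True
      \<comment> \<open>here \<open>1\<close> lists the cuts of \<open>x # c\<close>; the terms in \<open>3\<close> and \<open>4\<close> cancel against all of them but the first\<close>
      obtain y S where y: "c = y # S" using c by (cases c) auto
      have 1: "leading ((x # c) # cs) = gen ([x] # c # cs) + free_ext (\<lambda>(A, B). gen ((x # A) # B # cs)) (cuts c) - free_ext (\<lambda>ds. gen ((x # c) # ds)) (leading cs)"
        by (simp add: y free_ext_add free_ext_comp split_def)
      have 2: "free_ext homotopy (leading ([x] # c # cs)) = - free_ext (\<lambda>(A, B). homotopy ([x] # A # B # cs)) (cuts c) + free_ext (\<lambda>ds. homotopy ([x] # c # ds)) (leading cs)"
        by (simp add: free_ext_diff free_ext_neg free_ext_comp split_def)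
      have 3: "free_ext (\<lambda>(A, B). homotopy ([x] # A # B # cs)) (cuts c) = (free_ext (\<lambda>(A, B). gen ((x # A) # B # cs)) (cuts c) :: 'a list list \<Rightarrow>\<^sub>0 'k)"
        by (rule free_ext_cong_supported[OF cuts_keys]) (use True in auto)
      have 4: "free_ext (\<lambda>ds. homotopy ([x] # c # ds)) (leading cs) = (free_ext (\<lambda>ds. gen ((x # c) # ds)) (leading cs) :: 'a list list \<Rightarrow>\<^sub>0 'k)"
        using True by simp
      have 5: "homotopy ([x] # c # cs) = gen ((x # c) # cs)" using True by simp
      show ?thesis unfolding short bs 2 3 4 5 free_ext_gen 1 by simp
    next
      case False
      let ?p = "free_ext (\<lambda>cs. gen ([x] # cs)) :: ('a list list \<Rightarrow>\<^sub>0 'k) \<Rightarrow> _"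
      let ?l = "leading (c # cs) :: 'a list list \<Rightarrow>\<^sub>0 'k" and ?h = "homotopy (c # cs) :: 'a list list \<Rightarrow>\<^sub>0 'k"
      have 1: "free_ext (\<lambda>ds. homotopy ([x] # ds)) ?l = - ?p (free_ext homotopy ?l)"
        unfolding free_ext_comp free_ext_fun_neg[symmetric]
        by (rule free_ext_cong_supported[OF leading_keys[OF inc]]) (use False in \<open>auto simp: neq_Nil_conv free_ext_fun_neg\<close>)
      have "leading ([x] # ds) = - ?p (leading ds)" for ds by simp
      then have 2: "free_ext (\<lambda>ds. leading ([x] # ds)) ?h = - ?p (free_ext leading ?h)"
        by (simp only: free_ext_fun_neg free_ext_comp)
      have "free_ext homotopy (leading ([x] # c # cs)) = - free_ext (\<lambda>ds. homotopy ([x] # ds)) ?l"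
        unfolding leading.simps(2)[of "[x]"] by (simp add: free_ext_neg free_ext_comp del: leading.simps)
      moreover have "free_ext leading (homotopy ([x] # c # cs)) = - free_ext (\<lambda>ds. leading ([x] # ds)) ?h"
        using False by (simp add: free_ext_neg free_ext_comp del: leading.simps)
      ultimately have "free_ext homotopy (leading ([x] # c # cs)) + free_ext leading (homotopy ([x] # c # cs))
        = ?p (free_ext homotopy ?l + free_ext leading ?h)"
        unfolding 1 2 by (simp add: free_ext_add)
      also have "\<dots> = gen ([x] # c # cs)"
        using Cons.hyps inc big by (simp add: bs del: leading.simps)
      finally show ?thesis by (simp only: short bs)
    qed
  qed
qed simp

subsection \<open>Exactness\<close>

definition inc_words :: "nat \<Rightarrow> nat \<Rightarrow> nat \<Rightarrow> nat list list set" where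
  "inc_words n t p = {bs. inc_blocks bs \<and> length bs = p \<and> length (concat bs) = t \<and> set (concat bs) \<subseteq> {..<n}}"

lemma inc_words_mset:
  "bs \<in> inc_words n t p \<Longrightarrow> inc_blocks cs \<Longrightarrow> mset (concat cs) = mset (concat bs) \<Longrightarrow> cs \<in> inc_words n t (length cs)"
  unfolding inc_words_def using mset_eq_length[of "concat cs" "concat bs"] mset_eq_setD[of "concat cs" "concat bs"] by simp

lemma rcobar_inc_words: "bs \<in> inc_words n t p \<Longrightarrow> rcobar bs \<in> supported (inc_words n t (Suc p))"
proof (rule supported_mono[OF rcobar_inc])
  assume bs: "bs \<in> inc_words n t p"
  then show "{cs. inc_blocks cs \<and> mset (concat cs) = mset (concat bs) \<and> length cs = Suc (length bs)} \<subseteq> inc_words n t (Suc p)"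
    using inc_words_mset[OF bs] by (auto simp: inc_words_def[of n t p]) metis
qed (simp add: inc_words_def)

lemma homotopy_inc_words:
  assumes "bs \<in> inc_words n t (Suc p)"
  shows "homotopy bs \<in> supported (inc_words n t p)"
  using assms by (intro supported_mono[OF homotopy_keys]) (auto simp: inc_words_def simp del: set_concat length_concat)

lemma homotopy_error:
  assumes "bs \<in> inc_words n t (Suc p)" "Suc p < t"
  shows "gen bs - free_ext rcobar (homotopy bs) - free_ext homotopy (rcobar bs)
    \<in> supported {cs. inversions (concat cs) > inversions (concat bs)}"
proof -
  have inc: "inc_blocks bs" and len: "length bs = Suc p" "length (concat bs) = t"
    using assms(1) by (auto simp: inc_words_def)
  have "\<exists>b\<in>set bs. length b \<ge> 2"
  proof (rule ccontr)
    assume "\<not> ?thesis"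
    then have "length (concat bs) \<le> length bs"
      by (induct bs) (auto simp: not_le less_2_cases_iff)
    then show False using len assms(2) by simp
  qed
  note hl = homotopy_leading[OF inc this]
  have "gen bs - free_ext rcobar (homotopy bs) - free_ext homotopy (rcobar bs)
    = - (free_ext (\<lambda>cs. rcobar cs - leading cs) (homotopy bs) + free_ext homotopy (rcobar bs - leading bs))"
    unfolding hl[symmetric] by (simp add: free_ext_fun_diff free_ext_diff)
  also have "\<dots> \<in> supported {cs. inversions (concat cs) > inversions (concat bs)}"
  proof (intro supported_neg supported_add)
    show "free_ext (\<lambda>cs. rcobar cs - leading cs) (homotopy bs) \<in> supported {cs. inversions (concat cs) > inversions (concat bs)}"
      by (rule free_ext_supported[OF homotopy_keys[OF inc]]) (auto intro: supported_mono[OF rcobar_leading])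
    show "free_ext homotopy (rcobar bs - leading bs) \<in> supported {cs. inversions (concat cs) > inversions (concat bs)}"
    proof (rule free_ext_supported)
      have "rcobar bs - leading bs \<in> supported {cs. inc_blocks cs}"
        using rcobar_inc[OF inc] leading_keys[OF inc] by (auto intro!: supported_diff elim: supported_mono)
      with rcobar_leading[OF inc] show "rcobar bs - leading bs \<in> supported {cs. inc_blocks cs \<and> inversions (concat cs) > inversions (concat bs)}"
        by (auto simp: supported_def)
    qed (auto intro: supported_mono[OF homotopy_keys])
  qed
  finally show ?thesis .
qed

lemma inc_words_inversions: "bs \<in> inc_words n t p \<Longrightarrow> inversions (concat bs) \<le> t * t"
  using inversions_le[of "concat bs"] by (simp add: inc_words_def del: length_concat)

text \<open>Induction on a bound for the number of inversions that are still possible: if \<open>y\<close> is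
  the image of the cycle under the homotopy, then subtracting the boundary of \<open>y\<close> leaves a cycle
  all of whose words have more inversions.\<close>

theorem rcobar_exact:
  assumes "u \<in> supported (inc_words n t (Suc p))" "Suc p < t" "free_ext rcobar u = 0"
  shows "\<exists>y\<in>supported (inc_words n t p). free_ext rcobar y = (u :: _ \<Rightarrow>\<^sub>0 'k::field)"
proof -
  have "\<exists>y\<in>supported (inc_words n t p). free_ext rcobar y = u"
    if "u \<in> supported {bs \<in> inc_words n t (Suc p). t * t < inversions (concat bs) + m}"
      and "free_ext rcobar u = 0" for m and u :: "nat list list \<Rightarrow>\<^sub>0 'k"
    using that
  proof (induct m arbitrary: u)
    case 0
    have "{bs \<in> inc_words n t (Suc p). t * t < inversions (concat bs) + 0} = {}"
      using inc_words_inversions[of _ n t "Suc p"] by (auto simp: not_less)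
    with 0 have "u = 0" by (metis supported_empty)
    then show ?case by (intro bexI[of _ 0]) simp_all
  next
    case (Suc m)
    have u: "u \<in> supported (inc_words n t (Suc p))" using Suc.prems(1) by (auto elim!: supported_mono)
    let ?y = "free_ext homotopy u" let ?u = "u - free_ext rcobar ?y"
    have y: "?y \<in> supported (inc_words n t p)" by (rule free_ext_supported[OF u homotopy_inc_words])
    \<comment> \<open>since the boundary of \<open>u\<close> vanishes, the other half of the homotopy formula may be subtracted for free\<close>
    have "?u = free_ext (\<lambda>bs. gen bs - free_ext rcobar (homotopy bs) - free_ext homotopy (rcobar bs)) u"
      using free_ext_eq_id[of u UNIV gen] free_ext_comp[of homotopy rcobar u] Suc.prems(2)
      by (simp add: free_ext_fun_diff free_ext_comp supported_def)
    moreover have "\<dots> \<in> supported {bs. t * t < inversions (concat bs) + m}"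
      by (rule free_ext_supported[OF Suc.prems(1)], rule supported_mono, rule homotopy_error)
        (use assms(2) in auto)
    moreover have "?u \<in> supported (inc_words n t (Suc p))"
      by (intro supported_diff u free_ext_supported[OF y] rcobar_inc_words)
    ultimately have "?u \<in> supported {bs \<in> inc_words n t (Suc p). t * t < inversions (concat bs) + m}"
      by (auto simp: supported_def)
    moreover have "free_ext rcobar ?u = 0"
      using Suc.prems(2) by (simp add: free_ext_diff free_ext_comp[of rcobar rcobar] rcobar_rcobar)
    ultimately obtain z where z: "z \<in> supported (inc_words n t p)" "free_ext rcobar z = ?u"
      using Suc.hyps by blast
    show ?case
      by (rule bexI[of _ "?y + z"]) (simp_all add: free_ext_add z supported_add y)
  qed
  from this[of u "Suc (t * t)"] assms show ?thesis by (simp add: less_Suc_eq_le)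
qed

section \<open>Closed formulas for the coproduct and the differential\<close>

definition splits :: "nat \<Rightarrow> (nat set \<times> nat set) set" where
  "splits i = {(A, B). A \<inter> B = {} \<and> A \<union> B = {..<i}}"

lemma finite_splits: "finite (splits i)"
  by (rule finite_subset[of _ "Pow {..<i} \<times> Pow {..<i}"]) (auto simp: splits_def)

lemma splits_0: "splits 0 = {({}, {})}"
  by (auto simp: splits_def)

lemma splits_Suc:
  "splits (Suc i) = (\<lambda>(A, B). (insert 0 (Suc ` A), Suc ` B)) ` splits i \<union> (\<lambda>(A, B). (Suc ` A, insert 0 (Suc ` B))) ` splits i"
    (is "_ = ?L ` _ \<union> ?R ` _")
proof (intro equalityI subsetI)
  fix AB assume "AB \<in> splits (Suc i)"
  then obtain A B where AB: "AB = (A, B)" "A \<inter> B = {}" "A \<union> B = {..<Suc i}" by (auto simp: splits_def)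
  let ?A = "{j. Suc j \<in> A}" and ?B = "{j. Suc j \<in> B}"
  have s: "(?A, ?B) \<in> splits i"
    using AB(2,3) by (auto simp: splits_def set_eq_iff)
  have *: "0 \<in> X \<Longrightarrow> X = insert 0 (Suc ` {j. Suc j \<in> X})" "0 \<notin> X \<Longrightarrow> X = Suc ` {j. Suc j \<in> X}" for X
    by (auto simp: image_iff) (metis not0_implies_Suc)+
  have "0 \<in> A \<and> 0 \<notin> B \<or> 0 \<notin> A \<and> 0 \<in> B" using AB(2,3) by (auto simp: set_eq_iff)
  then have "AB = ?L (?A, ?B) \<or> AB = ?R (?A, ?B)"
    using *(1)[of A] *(2)[of A] *(1)[of B] *(2)[of B] unfolding AB(1) prod.case prod.inject by metis
  then show "AB \<in> ?L ` splits i \<union> ?R ` splits i" using s by blast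
qed (auto simp: splits_def lessThan_Suc_eq_insert_0)

lemma shuffle_sign_left: "shuffle_sign (insert 0 (Suc ` A)) (Suc ` B) = shuffle_sign A B"
proof -
  have "{(a, b). a \<in> insert 0 (Suc ` A) \<and> b \<in> Suc ` B \<and> a > b} = map_prod Suc Suc ` {(a, b). a \<in> A \<and> b \<in> B \<and> a > b}"
    by force
  moreover have "inj_on (map_prod Suc Suc) X" for X by (auto simp: inj_on_def)
  ultimately show ?thesis by (simp add: shuffle_sign_def card_image)
qed

lemma shuffle_sign_right:
  assumes "finite A" "finite B"
  shows "shuffle_sign (Suc ` A) (insert 0 (Suc ` B)) = (-1) ^ card A * shuffle_sign A B"
proof -
  let ?P = "{(a, b). a \<in> A \<and> b \<in> B \<and> a > b}"
  have "finite ?P" by (rule finite_subset[of _ "A \<times> B"]) (use assms in auto)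
  moreover have "{(a, b). a \<in> Suc ` A \<and> b \<in> insert 0 (Suc ` B) \<and> a > b} = Suc ` A \<times> {0} \<union> map_prod Suc Suc ` ?P"
    by force
  moreover have "Suc ` A \<times> {0} \<inter> map_prod Suc Suc ` ?P = {}" by auto
  moreover have "inj_on (map_prod Suc Suc) X" for X by (auto simp: inj_on_def)
  ultimately have "card {(a, b). a \<in> Suc ` A \<and> b \<in> insert 0 (Suc ` B) \<and> a > b} = card A + card ?P"
    using assms by (simp add: card_Un_disjoint card_image card_cartesian_product)
  then show ?thesis by (simp add: shuffle_sign_def power_add)
qed

lemma nths_Cons_Suc: "nths (v # vs) (insert 0 (Suc ` A)) = v # nths vs A" "nths (v # vs) (Suc ` A) = nths vs A"
  by (simp_all add: nths_Cons inj_image_mem_iff)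

lemma length_nths_subset: "A \<subseteq> {..<length vs} \<Longrightarrow> length (nths vs A) = card A"
  by (auto simp: length_nths intro!: arg_cong[where f = card])

text \<open>The recursion agrees with the sum over complementary sets of positions: the sets that contain
  position 0 on the left leave the sign unchanged, and those that contain it on the right multiply it by
  \<open>-1\<close> for every letter on the left.\<close>

lemma unshuffle_sum:
  "unshuffle vs = (\<Sum>(A, B)\<in>splits (length vs). free_scale (shuffle_sign A B) (gen (nths vs A, nths vs B)) :: _ \<Rightarrow>\<^sub>0 'k::field)"
proof (induct vs)
  case Nil
  show ?case by (simp add: splits_0 shuffle_sign_def)
next
  case (Cons v vs)
  let ?S = "splits (length vs)"
  let ?L = "\<lambda>(A, B). (insert 0 (Suc ` A), Suc ` B)" and ?R = "\<lambda>(A, B). (Suc ` A, insert 0 (Suc ` B))"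
  let ?g = "\<lambda>(A, B). free_scale (shuffle_sign A B) (gen (nths (v # vs) A, nths (v # vs) B)) :: _ \<Rightarrow>\<^sub>0 'k"
  have fin: "finite A" "finite B" "A \<subseteq> {..<length vs}" if "(A, B) \<in> ?S" for A B
    using that finite_subset[of _ "{..<length vs}"] by (auto simp: splits_def)
  have ins: "insert 0 (Suc ` A) = insert 0 (Suc ` B) \<longleftrightarrow> A = B" "Suc ` A = Suc ` B \<longleftrightarrow> A = B" for A B
    by (auto simp: inj_image_eq_iff insert_ident)
  have "(\<Sum>AB\<in>splits (length (v # vs)). ?g AB) = (\<Sum>AB\<in>?L ` ?S. ?g AB) + (\<Sum>AB\<in>?R ` ?S. ?g AB)"
    unfolding length_Cons splits_Suc
    by (rule sum.union_disjoint) (auto simp: finite_splits)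
  also have "(\<Sum>AB\<in>?L ` ?S. ?g AB) = (\<Sum>AB\<in>?S. ?g (?L AB))"
    by (subst sum.reindex) (auto simp: inj_on_def ins)
  also have "(\<Sum>AB\<in>?R ` ?S. ?g AB) = (\<Sum>AB\<in>?S. ?g (?R AB))"
    by (subst sum.reindex) (auto simp: inj_on_def ins)
  also have "(\<Sum>AB\<in>?S. ?g (?L AB)) + (\<Sum>AB\<in>?S. ?g (?R AB)) = unshuffle (v # vs)"
    unfolding unshuffle.simps Cons free_ext_sum sum.distrib[symmetric]
    by (rule sum.cong) (auto simp: free_ext_scale free.scale_right_distrib nths_Cons_Suc shuffle_sign_left
        shuffle_sign_right length_nths_subset fin mult.commute)
  finally show ?case by (simp add: split_def)
qed

lemma rcobar_single:
  "rcobar [b] = free_ext (\<lambda>(A, B). if A = [] \<or> B = [] then 0 else gen [A, B]) (unshuffle b)"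
proof (cases "b = []")
  case True
  then show ?thesis by (simp add: rcobar_def cobar_empty_block del: cobar.simps)
next
  case False
  then show ?thesis by (simp add: rcobar_Cons) (simp add: rcobar_def)
qed

text \<open>The shape of the sum by which the differential on $T_t^p$ is defined.\<close>

lemma rcobar_sum:
  "[] \<notin> set bs \<Longrightarrow> rcobar bs = (\<Sum>j<length bs. free_scale ((-1) ^ j)
     (free_ext (\<lambda>ds. gen (take j bs @ ds @ drop (j + 1) bs)) (rcobar [bs ! j])))"
proof (induct bs)
  case Nil
  then show ?case by (simp add: rcobar_def)
next
  case (Cons b bs)
  have b: "b \<noteq> []" "[] \<notin> set bs" using Cons.prems by auto
  have 1: "free_ext (\<lambda>(A, B). if A = [] \<or> B = [] then 0 else gen (A # B # bs)) (unshuffle b)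
    = free_ext (\<lambda>ds. gen (ds @ bs)) (rcobar [b])"
    unfolding rcobar_single free_ext_comp by (rule free_ext_cong) auto
  show ?case
    unfolding rcobar_Cons[OF b] 1 Cons.hyps[OF b(2)] free_ext_sum length_Cons
    by (subst sum.lessThan_Suc_shift) (simp add: free_ext_scale free_ext_comp sum_negf)
qed

lemma rcobar_blocks:
  "\<forall>b\<in>set bs. b \<noteq> [] \<and> length b \<le> m \<Longrightarrow> rcobar bs \<in> supported {cs. (\<forall>b\<in>set cs. b \<noteq> [] \<and> length b \<le> m)
     \<and> length (concat cs) = length (concat bs) \<and> length cs = Suc (length bs)}"
proof (induct bs)
  case Nil
  then show ?case by (simp add: rcobar_def)
next
  case (Cons b bs)
  have b: "b \<noteq> []" "[] \<notin> set bs" "\<forall>b\<in>set bs. b \<noteq> [] \<and> length b \<le> m" using Cons.prems by auto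
  show ?case unfolding rcobar_Cons[OF b(1,2)]
  proof (intro supported_diff, goal_cases)
    case 1
    show ?case by (rule free_ext_supported[OF unshuffle_length]) (use Cons.prems in auto)
  next
    case 2
    show ?case by (rule free_ext_supported[OF Cons.hyps[OF b(3)]]) (use Cons.prems in auto)
  qed
qed

abbreviation singles :: "'a list \<Rightarrow> 'a list list" where
  "singles \<equiv> map (\<lambda>v. [v])"

lemma rcobar_singles: "rcobar (singles vs) = 0"
proof (induct vs)
  case Nil
  show ?case by (simp add: rcobar_def)
next
  case (Cons v vs)
  then show ?case by (simp add: rcobar_Cons image_iff free_ext_add)
qed

text \<open>The commutator of two adjacent letters is a boundary up to sign: a block of two letters is cut in
  two ways, and single letters cannot be cut.\<close>

lemma rcobar_one_pair:
  "rcobar (singles pre @ [x, y] # singles post) = free_scale ((-1) ^ length pre)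
     (gen (singles (pre @ x # y # post)) - gen (singles (pre @ y # x # post)))"
proof (induct pre)
  case Nil
  show ?case by (simp add: rcobar_Cons image_iff rcobar_singles free_ext_add free_ext_diff free_ext_neg)
next
  case (Cons v pre)
  then show ?case by (simp add: rcobar_Cons image_iff free_ext_add free_ext_scale free_ext_diff)
qed

lemma length_le_length_concat: "[] \<notin> set bs \<Longrightarrow> length bs \<le> length (concat bs)"
proof (induct bs)
  case (Cons b bs)
  then show ?case by (cases b) auto
qed simp

lemma blocks_all_singles: "[] \<notin> set bs \<Longrightarrow> length (concat bs) \<le> length bs \<Longrightarrow> \<exists>vs. bs = singles vs"
proof (induct bs)
  case (Cons b bs)
  have "length bs \<le> length (concat bs)"
    using Cons.prems(1) by (intro length_le_length_concat) simp
  moreover have "length b \<ge> 1" using Cons.prems(1) by (cases b) auto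
  ultimately have b: "length b = 1" "length (concat bs) \<le> length bs" using Cons.prems(2) by auto
  then obtain v where v: "b = [v]" by (cases b) auto
  obtain vs where "bs = singles vs" using Cons b by auto
  with v show ?case by (intro exI[of _ "v # vs"]) simp
qed simp

lemma blocks_one_pair:
  "[] \<notin> set bs \<Longrightarrow> length (concat bs) = Suc (length bs) \<Longrightarrow> \<exists>pre x y post. bs = singles pre @ [x, y] # singles post"
proof (induct bs)
  case (Cons b bs)
  have ge: "length bs \<le> length (concat bs)"
    using Cons.prems(1) by (intro length_le_length_concat) simp
  have "length b \<ge> 1" using Cons.prems(1) by (cases b) auto
  then consider "length b = 1" | "length b = 2" "length (concat bs) \<le> length bs"
    using Cons.prems(2) ge by (cases "length b = 1") auto
  then show ?case
  proof cases
    case 1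
    then obtain v where v: "b = [v]" by (cases b) auto
    obtain pre x y post where "bs = singles pre @ [x, y] # singles post" using Cons 1 by auto
    with v show ?thesis by (intro exI[of _ "v # pre"] exI[of _ x] exI[of _ y] exI[of _ post]) simp
  next
    case 2
    then obtain x y where xy: "b = [x, y]" by (cases b rule: cuts.cases) auto
    obtain vs where "bs = singles vs" using blocks_all_singles 2 Cons.prems(1) by (metis list.set_intros(2))
    with xy show ?thesis by (intro exI[of _ "[]"] exI[of _ x] exI[of _ y] exI[of _ vs]) simp
  qed
qed simp

section \<open>Vector spaces and linear maps\<close>

abbreviation vsp :: "('k::field, 'a) module \<Rightarrow> bool" where
  "vsp M \<equiv> vectorspace class_ring M"

abbreviation lin :: "('k::field, 'a) module \<Rightarrow> ('k, 'b) module \<Rightarrow> ('a \<Rightarrow> 'b) set" where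
  "lin M N \<equiv> LinearCombinations.module_hom class_ring M N"

lemma linI:
  assumes "\<And>x. x \<in> carrier M \<Longrightarrow> f x \<in> carrier N"
    "\<And>x y. x \<in> carrier M \<Longrightarrow> y \<in> carrier M \<Longrightarrow> f (x \<oplus>\<^bsub>M\<^esub> y) = f x \<oplus>\<^bsub>N\<^esub> f y"
    "\<And>c x. x \<in> carrier M \<Longrightarrow> f (c \<odot>\<^bsub>M\<^esub> x) = c \<odot>\<^bsub>N\<^esub> f x"
  shows "f \<in> lin M N"
  using assms by (auto simp: LinearCombinations.module_hom_def)

lemma lin_closed: "f \<in> lin M N \<Longrightarrow> x \<in> carrier M \<Longrightarrow> f x \<in> carrier N"
  and lin_add: "f \<in> lin M N \<Longrightarrow> x \<in> carrier M \<Longrightarrow> y \<in> carrier M \<Longrightarrow> f (x \<oplus>\<^bsub>M\<^esub> y) = f x \<oplus>\<^bsub>N\<^esub> f y"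
  and lin_smult: "f \<in> lin M N \<Longrightarrow> x \<in> carrier M \<Longrightarrow> f (c \<odot>\<^bsub>M\<^esub> x) = c \<odot>\<^bsub>N\<^esub> f x"
  by (auto simp: LinearCombinations.module_hom_def)

lemma linear_map_iff: "linear_map class_ring M N f \<longleftrightarrow> vsp M \<and> vsp N \<and> f \<in> lin M N"
  by (auto simp: linear_map_def mod_hom_def mod_hom_axioms_def vectorspace_def)

lemma vspI:
  fixes M :: "('k::field, 'a) module"
  assumes "abelian_group M"
    and "\<And>c x. x \<in> carrier M \<Longrightarrow> c \<odot>\<^bsub>M\<^esub> x \<in> carrier M"
    and "\<And>a b x. x \<in> carrier M \<Longrightarrow> (a + b) \<odot>\<^bsub>M\<^esub> x = a \<odot>\<^bsub>M\<^esub> x \<oplus>\<^bsub>M\<^esub> b \<odot>\<^bsub>M\<^esub> x"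
    and "\<And>a x y. x \<in> carrier M \<Longrightarrow> y \<in> carrier M \<Longrightarrow> a \<odot>\<^bsub>M\<^esub> (x \<oplus>\<^bsub>M\<^esub> y) = a \<odot>\<^bsub>M\<^esub> x \<oplus>\<^bsub>M\<^esub> a \<odot>\<^bsub>M\<^esub> y"
    and "\<And>a b x. x \<in> carrier M \<Longrightarrow> (a * b) \<odot>\<^bsub>M\<^esub> x = a \<odot>\<^bsub>M\<^esub> (b \<odot>\<^bsub>M\<^esub> x)"
    and "\<And>x. x \<in> carrier M \<Longrightarrow> 1 \<odot>\<^bsub>M\<^esub> x = x"
  shows "vsp M"
  unfolding vectorspace_def
  using assms by (auto intro!: Module.moduleI class_cring.is_cring class_field)

context
  fixes M :: "('k::field, 'a) module"
  assumes M: "vsp M"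
begin

interpretation M: vectorspace class_ring M by (rule M)

lemma vsp_zero_closed: "\<zero>\<^bsub>M\<^esub> \<in> carrier M"
  and vsp_add_closed: "x \<in> carrier M \<Longrightarrow> y \<in> carrier M \<Longrightarrow> x \<oplus>\<^bsub>M\<^esub> y \<in> carrier M"
  and vsp_smult_closed: "x \<in> carrier M \<Longrightarrow> c \<odot>\<^bsub>M\<^esub> x \<in> carrier M"
  by simp_all

lemma vsp_assoc: "x \<in> carrier M \<Longrightarrow> y \<in> carrier M \<Longrightarrow> z \<in> carrier M \<Longrightarrow> x \<oplus>\<^bsub>M\<^esub> y \<oplus>\<^bsub>M\<^esub> z = x \<oplus>\<^bsub>M\<^esub> (y \<oplus>\<^bsub>M\<^esub> z)"
  and vsp_comm: "x \<in> carrier M \<Longrightarrow> y \<in> carrier M \<Longrightarrow> x \<oplus>\<^bsub>M\<^esub> y = y \<oplus>\<^bsub>M\<^esub> x"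
  and vsp_lcomm: "x \<in> carrier M \<Longrightarrow> y \<in> carrier M \<Longrightarrow> z \<in> carrier M \<Longrightarrow> x \<oplus>\<^bsub>M\<^esub> (y \<oplus>\<^bsub>M\<^esub> z) = y \<oplus>\<^bsub>M\<^esub> (x \<oplus>\<^bsub>M\<^esub> z)"
  and vsp_l_zero: "x \<in> carrier M \<Longrightarrow> \<zero>\<^bsub>M\<^esub> \<oplus>\<^bsub>M\<^esub> x = x"
  and vsp_r_zero: "x \<in> carrier M \<Longrightarrow> x \<oplus>\<^bsub>M\<^esub> \<zero>\<^bsub>M\<^esub> = x"
  by (simp_all add: M.a_assoc M.a_comm M.a_lcomm)

lemma vsp_smult_zero: "c \<odot>\<^bsub>M\<^esub> \<zero>\<^bsub>M\<^esub> = \<zero>\<^bsub>M\<^esub>"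
  and vsp_zero_smult: "x \<in> carrier M \<Longrightarrow> 0 \<odot>\<^bsub>M\<^esub> x = \<zero>\<^bsub>M\<^esub>"
  and vsp_one_smult: "x \<in> carrier M \<Longrightarrow> 1 \<odot>\<^bsub>M\<^esub> x = x"
  using M.smult_r_null[of c] M.smult_l_null[of x] M.smult_one[of x] by simp_all

lemma vsp_smult_l_distr: "x \<in> carrier M \<Longrightarrow> (a + b) \<odot>\<^bsub>M\<^esub> x = a \<odot>\<^bsub>M\<^esub> x \<oplus>\<^bsub>M\<^esub> b \<odot>\<^bsub>M\<^esub> x"
  and vsp_smult_r_distr: "x \<in> carrier M \<Longrightarrow> y \<in> carrier M \<Longrightarrow> a \<odot>\<^bsub>M\<^esub> (x \<oplus>\<^bsub>M\<^esub> y) = a \<odot>\<^bsub>M\<^esub> x \<oplus>\<^bsub>M\<^esub> a \<odot>\<^bsub>M\<^esub> y"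
  and vsp_smult_assoc: "x \<in> carrier M \<Longrightarrow> (a * b) \<odot>\<^bsub>M\<^esub> x = a \<odot>\<^bsub>M\<^esub> (b \<odot>\<^bsub>M\<^esub> x)"
  using M.smult_l_distr[of a b x] M.smult_r_distr[of a x y] M.smult_assoc1[of a b x] by simp_all

lemma vsp_finsum_closed: "f \<in> A \<rightarrow> carrier M \<Longrightarrow> finsum M f A \<in> carrier M"
  by (rule M.finsum_closed)

lemma vsp_finsum_empty: "finsum M f {} = \<zero>\<^bsub>M\<^esub>"
  by simp

lemma vsp_finsum_insert:
  "finite A \<Longrightarrow> a \<notin> A \<Longrightarrow> f \<in> insert a A \<rightarrow> carrier M \<Longrightarrow> finsum M f (insert a A) = f a \<oplus>\<^bsub>M\<^esub> finsum M f A"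
  by (rule M.finsum_insert) auto

lemma vsp_finsum_cong: "(\<And>i. i \<in> A \<Longrightarrow> f i = g i) \<Longrightarrow> g \<in> A \<rightarrow> carrier M \<Longrightarrow> finsum M f A = finsum M g A"
  by (rule M.finsum_cong') auto

lemma vsp_finsum_zero: "(\<And>i. i \<in> A \<Longrightarrow> f i = \<zero>\<^bsub>M\<^esub>) \<Longrightarrow> finsum M f A = \<zero>\<^bsub>M\<^esub>"
  using vsp_finsum_cong[of A f "\<lambda>_. \<zero>\<^bsub>M\<^esub>"] by simp

lemma vsp_finsum_mono_neutral:
  assumes "finite B" "A \<subseteq> B" "\<And>i. i \<in> B - A \<Longrightarrow> f i = \<zero>\<^bsub>M\<^esub>" "f \<in> B \<rightarrow> carrier M"
  shows "finsum M f A = finsum M f B"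
  by (rule M.add.finprod_mono_neutral_cong_left) (use assms in auto)

lemma vsp_finsum_add:
  "f \<in> A \<rightarrow> carrier M \<Longrightarrow> g \<in> A \<rightarrow> carrier M \<Longrightarrow> finsum M (\<lambda>i. f i \<oplus>\<^bsub>M\<^esub> g i) A = finsum M f A \<oplus>\<^bsub>M\<^esub> finsum M g A"
  by (rule M.finsum_addf)

lemma vsp_finsum_single:
  assumes "finite A" "j \<in> A" "x \<in> carrier M"
  shows "finsum M (\<lambda>i. if i = j then x else \<zero>\<^bsub>M\<^esub>) A = x"
  using M.add.finprod_singleton_swap[of j A "\<lambda>_. x"] assms by simp

end

lemmas vsp_closed = vsp_zero_closed vsp_add_closed vsp_smult_closed vsp_finsum_closed

lemma lin_zero: "vsp M \<Longrightarrow> vsp N \<Longrightarrow> f \<in> lin M N \<Longrightarrow> f \<zero>\<^bsub>M\<^esub> = \<zero>\<^bsub>N\<^esub>"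
  by (metis lin_closed lin_smult vsp_zero_closed vsp_zero_smult)

lemma lin_finsum:
  assumes "vsp M" "vsp N" "f \<in> lin M N" "g \<in> A \<rightarrow> carrier M"
  shows "f (finsum M g A) = finsum N (\<lambda>i. f (g i)) A"
  using assms(4)
proof (induct A rule: infinite_finite_induct)
  case (infinite A)
  then show ?case using assms(1-3) by (simp add: finsum_def finprod_def lin_zero)
next
  case empty
  then show ?case using assms by (simp add: vsp_finsum_empty lin_zero)
next
  case (insert a A)
  then have "(\<lambda>i. f (g i)) \<in> insert a A \<rightarrow> carrier N" using assms(3) by (auto intro: lin_closed)
  with insert assms show ?case
    by (simp add: vsp_finsum_insert lin_add[OF assms(3)] vsp_finsum_closed Pi_iff)
qed

lemma lin_comp: "f \<in> lin M N \<Longrightarrow> g \<in> lin N P \<Longrightarrow> (\<lambda>x. g (f x)) \<in> lin M P"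
  by (rule linI) (auto simp: lin_closed lin_add lin_smult)

lemma lin_const_zero: "vsp N \<Longrightarrow> (\<lambda>x. \<zero>\<^bsub>N\<^esub>) \<in> lin M N"
  by (rule linI) (auto simp: vsp_zero_closed vsp_l_zero vsp_smult_zero)

lemma lin_plus:
  assumes "vsp N" "f \<in> lin M N" "g \<in> lin M N"
  shows "(\<lambda>x. f x \<oplus>\<^bsub>N\<^esub> g x) \<in> lin M N"
proof -
  have c: "f x \<in> carrier N" "g x \<in> carrier N" if "x \<in> carrier M" for x
    using assms that by (auto intro: lin_closed)
  show ?thesis
    by (rule linI) (simp_all add: c assms(1) vsp_add_closed lin_add[OF assms(2)] lin_add[OF assms(3)]
        lin_smult[OF assms(2)] lin_smult[OF assms(3)] vsp_smult_r_distr vsp_assoc vsp_lcomm)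
qed

lemma lin_scaled:
  assumes "vsp N" "f \<in> lin M N"
  shows "(\<lambda>x. c \<odot>\<^bsub>N\<^esub> f x) \<in> lin M N"
  using assms
  by (intro linI) (auto simp: lin_closed vsp_smult_closed lin_add lin_smult vsp_smult_r_distr
      mult.commute simp flip: vsp_smult_assoc)

lemma lin_cong:
  assumes "vsp M" "g \<in> lin M N" "\<And>x. x \<in> carrier M \<Longrightarrow> f x = g x"
  shows "f \<in> lin M N"
  using assms by (intro linI) (simp_all add: vsp_closed lin_closed lin_add lin_smult)

lemma lin_finsum_fun:
  assumes "vsp M" "vsp N" "\<And>i. i \<in> A \<Longrightarrow> f i \<in> lin M N"
  shows "(\<lambda>x. finsum N (\<lambda>i. f i x) A) \<in> lin M N"
proof (cases "finite A")
  case True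
  then show ?thesis using assms(3)
  proof (induct A)
    case (insert a A)
    have "(\<lambda>x. f a x \<oplus>\<^bsub>N\<^esub> finsum N (\<lambda>i. f i x) A) \<in> lin M N"
      by (intro lin_plus assms insert) (use insert in auto)
    then show ?case
      by (rule lin_cong[OF assms(1)]) (use insert in \<open>auto intro!: vsp_finsum_insert assms(2) intro: lin_closed\<close>)
  qed (simp add: vsp_finsum_empty assms lin_const_zero)
qed (simp add: finsum_def finprod_def lin_const_zero assms(2))

text \<open>The span as an inductive closure, so that statements about linear maps on generators extend by
  rule induction.\<close>

inductive_set lspan :: "('k::field, 'a) module \<Rightarrow> 'a set \<Rightarrow> 'a set" for M G where
  lspan_base: "x \<in> G \<Longrightarrow> x \<in> lspan M G"
| lspan_zero: "\<zero>\<^bsub>M\<^esub> \<in> lspan M G"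
| lspan_add: "x \<in> lspan M G \<Longrightarrow> y \<in> lspan M G \<Longrightarrow> x \<oplus>\<^bsub>M\<^esub> y \<in> lspan M G"
| lspan_smult: "x \<in> lspan M G \<Longrightarrow> c \<odot>\<^bsub>M\<^esub> x \<in> lspan M G"

lemma lspan_closed: "vsp M \<Longrightarrow> G \<subseteq> carrier M \<Longrightarrow> x \<in> lspan M G \<Longrightarrow> x \<in> carrier M"
proof -
  assume *: "vsp M" "G \<subseteq> carrier M"
  assume "x \<in> lspan M G" then show ?thesis
    using * by induct (auto intro: vsp_closed)
qed

lemma lspan_trans: "x \<in> lspan M G \<Longrightarrow> G \<subseteq> lspan M H \<Longrightarrow> x \<in> lspan M H"
  by (induct rule: lspan.induct) (auto intro: lspan.intros)

lemma lin_lspan: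
  assumes "vsp M" "vsp N" "f \<in> lin M N" "G \<subseteq> carrier M" "x \<in> lspan M G" "\<And>g. g \<in> G \<Longrightarrow> f g \<in> lspan N H"
  shows "f x \<in> lspan N H"
  using assms(5)
proof induct
  case lspan_zero
  then show ?case using assms(1-3) by (simp add: lin_zero lspan.lspan_zero)
qed (auto simp: assms(6) lin_add[OF assms(3)] lin_smult[OF assms(3)] lspan_closed[OF assms(1,4)] intro: lspan.intros)

lemma lin_eq_on_lspan:
  assumes "vsp M" "vsp N" "f \<in> lin M N" "h \<in> lin M N" "G \<subseteq> carrier M" "x \<in> lspan M G" "\<And>g. g \<in> G \<Longrightarrow> f g = h g"
  shows "f x = h x"
  using assms(6)
proof induct
  case lspan_zero
  then show ?case using assms(1-4) by (simp add: lin_zero)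
qed (auto simp: assms(7) lin_add[OF assms(3)] lin_add[OF assms(4)] lin_smult[OF assms(3)] lin_smult[OF assms(4)]
    lspan_closed[OF assms(1,5)])

text \<open>By induction on the span. This extends linear dependence on a parameter from pure tensors to all
  tensors.\<close>

lemma lin_param:
  assumes M: "vsp M" and N: "vsp N" and Z: "vsp Z" and H: "\<And>x. x \<in> carrier M \<Longrightarrow> H x \<in> lin Z N"
    and G: "\<And>g. g \<in> G \<Longrightarrow> (\<lambda>x. H x g) \<in> lin M N" "G \<subseteq> carrier Z" and z: "z \<in> lspan Z G"
  shows "(\<lambda>x. H x z) \<in> lin M N"
  using z
proof induct
  case lspan_zero
  then show ?case by (rule lin_cong[OF M lin_const_zero[OF N]]) (rule lin_zero[OF Z N H])
next
  case (lspan_add y z)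
  then show ?case
    by (intro lin_cong[OF M lin_plus[OF N lspan_add(2,4)]])
      (auto intro!: lin_add[OF H] lspan_closed[OF Z G(2)])
next
  case (lspan_smult z c)
  then show ?case
    by (intro lin_cong[OF M lin_scaled[OF N lspan_smult(2)]])
      (auto intro!: lin_smult[OF H] lspan_closed[OF Z G(2)])
qed (rule G)

lemma lin_image_closed:
  assumes "vsp M" "vsp N" "f \<in> lin M N"
  shows "\<zero>\<^bsub>N\<^esub> \<in> f ` carrier M"
    and "a \<in> f ` carrier M \<Longrightarrow> c \<in> f ` carrier M \<Longrightarrow> a \<oplus>\<^bsub>N\<^esub> c \<in> f ` carrier M"
    and "a \<in> f ` carrier M \<Longrightarrow> k \<odot>\<^bsub>N\<^esub> a \<in> f ` carrier M"
proof -
  show "\<zero>\<^bsub>N\<^esub> \<in> f ` carrier M"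
    by (rule image_eqI[of _ f, OF lin_zero[OF assms, symmetric]]) (rule vsp_zero_closed[OF assms(1)])
  show "a \<oplus>\<^bsub>N\<^esub> c \<in> f ` carrier M" if ac: "a \<in> f ` carrier M" "c \<in> f ` carrier M"
  proof -
    from ac obtain x y where xy: "x \<in> carrier M" "a = f x" "y \<in> carrier M" "c = f y" by blast
    then have "a \<oplus>\<^bsub>N\<^esub> c = f (x \<oplus>\<^bsub>M\<^esub> y)" by (simp add: lin_add[OF assms(3)])
    then show ?thesis by (rule image_eqI) (rule vsp_add_closed[OF assms(1) xy(1,3)])
  qed
  show "k \<odot>\<^bsub>N\<^esub> a \<in> f ` carrier M" if "a \<in> f ` carrier M"
  proof -
    from that obtain x where x: "x \<in> carrier M" "a = f x" by blast
    then have "k \<odot>\<^bsub>N\<^esub> a = f (k \<odot>\<^bsub>M\<^esub> x)" by (simp add: lin_smult[OF assms(3)])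
    then show ?thesis by (rule image_eqI) (rule vsp_smult_closed[OF assms(1) x(1)])
  qed
qed

section \<open>Linear maps out of free spaces\<close>

lemma supported_induct [consumes 1, case_names zero step]:
  assumes "u \<in> supported X" "P 0"
    and step: "\<And>c x v. x \<in> X \<Longrightarrow> v \<in> supported X \<Longrightarrow> P v \<Longrightarrow> P (free_scale c (gen x) + v)"
  shows "P u"
proof -
  have "P (\<Sum>x\<in>A. free_scale (Poly_Mapping.lookup u x) (gen x))" if "A \<subseteq> X" "finite A" for A
    using that(2,1)
    by (induct A) (auto intro!: step assms(2) supported_sum supported_scale)
  from this[of "Poly_Mapping.keys u"] assms(1) have "P (free_ext gen u)"
    by (auto simp: free_ext_def supported_def)
  then show ?thesis using free_ext_eq_id[OF assms(1), of gen] by simp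
qed

lemma free_lift_0: "vsp M \<Longrightarrow> free_lift M f 0 = \<zero>\<^bsub>M\<^esub>"
  by (simp add: free_lift_def vsp_finsum_empty)

context
  fixes M :: "('k::field, 'a) module" and f :: "'x \<Rightarrow> 'a" and X
  assumes M: "vsp M" and f: "\<And>x. x \<in> X \<Longrightarrow> f x \<in> carrier M"
begin

lemma free_lift_superset:
  assumes "u \<in> supported X" "finite A" "Poly_Mapping.keys u \<subseteq> A" "A \<subseteq> X"
  shows "free_lift M f u = finsum M (\<lambda>x. Poly_Mapping.lookup u x \<odot>\<^bsub>M\<^esub> f x) A"
  unfolding free_lift_def
  by (rule vsp_finsum_mono_neutral[OF M assms(2,3)])
    (use assms f in \<open>auto simp: in_keys_iff vsp_zero_smult[OF M] vsp_smult_closed[OF M] subset_iff\<close>)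

lemma free_lift_closed: "u \<in> supported X \<Longrightarrow> free_lift M f u \<in> carrier M"
  unfolding free_lift_def using f
  by (intro vsp_finsum_closed[OF M]) (auto simp: supported_def intro!: vsp_smult_closed[OF M])

lemma free_lift_gen: "x \<in> X \<Longrightarrow> free_lift M f (gen x) = f x"
  using f[of x] by (simp add: free_lift_def lookup_gen vsp_finsum_insert[OF M] vsp_finsum_empty[OF M]
      vsp_one_smult[OF M] vsp_r_zero[OF M])

lemma free_lift_add:
  assumes "u \<in> supported X" "v \<in> supported X"
  shows "free_lift M f (u + v) = free_lift M f u \<oplus>\<^bsub>M\<^esub> free_lift M f v"
proof -
  let ?A = "Poly_Mapping.keys u \<union> Poly_Mapping.keys v"
  have A: "finite ?A" "?A \<subseteq> X" "Poly_Mapping.keys (u + v) \<subseteq> ?A"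
    using assms Poly_Mapping.keys_add[of u v] by (auto simp: supported_def)
  have fx: "f x \<in> carrier M" if "x \<in> ?A" for x using that A(2) f by auto
  have "free_lift M f (u + v) = finsum M (\<lambda>x. Poly_Mapping.lookup (u + v) x \<odot>\<^bsub>M\<^esub> f x) ?A"
    by (rule free_lift_superset[OF supported_add[OF assms] A(1,3,2)])
  also have "\<dots> = finsum M (\<lambda>x. Poly_Mapping.lookup u x \<odot>\<^bsub>M\<^esub> f x \<oplus>\<^bsub>M\<^esub> Poly_Mapping.lookup v x \<odot>\<^bsub>M\<^esub> f x) ?A"
    by (intro vsp_finsum_cong[OF M]) (auto simp: lookup_add vsp_smult_l_distr[OF M] fx intro!: vsp_closed[OF M])
  also have "\<dots> = free_lift M f u \<oplus>\<^bsub>M\<^esub> free_lift M f v"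
    using assms A by (subst vsp_finsum_add[OF M]) (auto simp: free_lift_superset[of _ ?A] fx intro!: vsp_closed[OF M])
  finally show ?thesis .
qed

lemma free_lift_scale:
  assumes "u \<in> supported X"
  shows "free_lift M f (free_scale c u) = c \<odot>\<^bsub>M\<^esub> free_lift M f u"
proof -
  let ?A = "Poly_Mapping.keys u"
  have A: "?A \<subseteq> X" using assms by (simp add: supported_def)
  have fx: "f x \<in> carrier M" if "x \<in> ?A" for x using that A f by auto
  have l: "(\<lambda>x. c \<odot>\<^bsub>M\<^esub> x) \<in> lin M M"
    by (rule lin_scaled[OF M]) (auto intro: linI)
  have "c \<odot>\<^bsub>M\<^esub> free_lift M f u = finsum M (\<lambda>x. c \<odot>\<^bsub>M\<^esub> (Poly_Mapping.lookup u x \<odot>\<^bsub>M\<^esub> f x)) ?A"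
    unfolding free_lift_def
    by (rule lin_finsum[OF M M l]) (auto simp: fx intro!: vsp_closed[OF M])
  also have "\<dots> = finsum M (\<lambda>x. Poly_Mapping.lookup (free_scale c u) x \<odot>\<^bsub>M\<^esub> f x) ?A"
    by (intro vsp_finsum_cong[OF M]) (auto simp: fx vsp_smult_assoc[OF M] intro!: vsp_closed[OF M])
  also have "\<dots> = free_lift M f (free_scale c u)"
    by (rule free_lift_superset[symmetric]) (use assms A keys_free_scale[of c u] in \<open>auto intro: supported_scale\<close>)
  finally show ?thesis by simp
qed

lemma free_lift_neg: "u \<in> supported X \<Longrightarrow> free_lift M f (- u) = (- 1) \<odot>\<^bsub>M\<^esub> free_lift M f u"
  using free_lift_scale[of u "-1"] by simp

lemma lspan_free_lift: "x \<in> lspan M (f ` X) \<Longrightarrow> \<exists>u\<in>supported X. x = free_lift M f u"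
proof (induct rule: lspan.induct)
  case (lspan_base x)
  then show ?case by (force simp: free_lift_gen intro: bexI[of _ "gen _"])
next
  case lspan_zero
  then show ?case by (intro bexI[of _ 0]) (simp_all add: free_lift_0[OF M])
next
  case (lspan_add x y)
  then show ?case by (metis free_lift_add supported_add)
next
  case (lspan_smult x c)
  then show ?case by (metis free_lift_scale supported_scale)
qed

lemma lin_free_lift:
  assumes "vsp N" "h \<in> lin M N" "u \<in> supported X"
  shows "h (free_lift M f u) = free_lift N (\<lambda>x. h (f x)) u"
  unfolding free_lift_def
  by (subst lin_finsum[OF M assms(1,2)])
    (use assms f in \<open>auto simp: supported_def lin_smult[OF assms(2)] lin_closed[OF assms(2)]
      intro!: vsp_closed[OF M] vsp_finsum_cong vsp_closed[OF assms(1)]\<close>)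

lemma free_lift_cong:
  assumes "u \<in> supported X" "\<And>x. x \<in> X \<Longrightarrow> g x = f x"
  shows "free_lift M g u = free_lift M f u"
  unfolding free_lift_def
  by (rule vsp_finsum_cong[OF M]) (use assms f in \<open>auto simp: supported_def intro!: vsp_closed[OF M]\<close>)

end

lemma free_lift_free_ext:
  assumes "vsp M" "\<And>y. y \<in> Y \<Longrightarrow> f y \<in> carrier M" "\<And>x. x \<in> X \<Longrightarrow> g x \<in> supported Y" "u \<in> supported X"
  shows "free_lift M f (free_ext g u) = free_lift M (\<lambda>x. free_lift M f (g x)) u"
  using assms(4)
proof (induct rule: supported_induct)
  case zero
  then show ?case by (simp add: free_lift_def vsp_finsum_empty[OF assms(1)])
next
  case (step c x v)
  have g: "free_lift M f (g x) \<in> carrier M" if "x \<in> X" for x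
    using assms that by (auto intro: free_lift_closed)
  from step show ?case
    by (simp add: free_ext_add free_ext_scale free_lift_add[OF assms(1,2)] free_lift_add[OF assms(1) g]
        free_lift_scale[OF assms(1,2)] free_lift_scale[OF assms(1) g] free_lift_gen[OF assms(1) g]
        supported_scale assms(3) free_ext_supported[of _ X])
qed

lemma free_lift_sum:
  assumes "vsp N" "\<And>x. x \<in> X \<Longrightarrow> f x \<in> carrier N" "\<And>a. a \<in> A \<Longrightarrow> g a \<in> supported X" "finite A"
  shows "free_lift N f (\<Sum>a\<in>A. g a) = finsum N (\<lambda>a. free_lift N f (g a)) A"
  using assms(4,3)
proof induct
  case empty
  show ?case by (simp add: free_lift_0[OF assms(1)] vsp_finsum_empty[OF assms(1)])
next
  case (insert a A)
  have c: "free_lift N f u \<in> carrier N" if "u \<in> supported X" for u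
    by (rule free_lift_closed[OF assms(1,2) that])
  from insert show ?case
    by (simp add: free_lift_add[OF assms(1,2)] supported_sum vsp_finsum_insert[OF assms(1)] Pi_iff c)
qed

text \<open>Transports the recursion of \<open>unshuffle\<close> to the functional \<open>\<Phi>\<close>. This
  allows inductions on the word in which \<open>\<Phi>\<close> changes.\<close>

lemma free_lift_unshuffle_Cons:
  fixes vs :: "'v list"
  assumes N: "vsp N" and cl: "\<And>A B. length A + length B = Suc (length vs) \<Longrightarrow> \<Phi> (A, B) \<in> carrier N"
  shows "free_lift N \<Phi> (unshuffle (v # vs)) =
      free_lift N (\<lambda>(A, B). \<Phi> (v # A, B) \<oplus>\<^bsub>N\<^esub> (-1) ^ length A \<odot>\<^bsub>N\<^esub> \<Phi> (A, v # B)) (unshuffle vs)"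
proof -
  define X where "X = {(A :: 'v list, B :: 'v list). length A + length B = Suc (length vs)}"
  have cl': "\<Phi> x \<in> carrier N" if "x \<in> X" for x
    using that cl by (auto simp: X_def)
  note fl = free_lift_add[where X = X and f = \<Phi>, OF N cl'] free_lift_scale[where X = X and f = \<Phi>, OF N cl']
    free_lift_gen[where X = X and f = \<Phi>, OF N cl']
  have X: "(v # A, B) \<in> X" "(A, v # B) \<in> X" if "(A, B) \<in> {(A, B). length A + length B = length vs}" for A B
    using that by (auto simp: X_def)
  have "free_lift N \<Phi> (unshuffle (v # vs)) = free_lift N (\<lambda>x. free_lift N \<Phi>
      (case x of (A, B) \<Rightarrow> gen (v # A, B) + free_scale ((-1) ^ length A) (gen (A, v # B)))) (unshuffle vs)"
    unfolding unshuffle.simps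
    by (rule free_lift_free_ext[where Y = X, OF N cl' _ unshuffle_length]) (auto intro!: supported_add supported_scale X)
  also have "\<dots> = free_lift N (\<lambda>(A, B). \<Phi> (v # A, B) \<oplus>\<^bsub>N\<^esub> (-1) ^ length A \<odot>\<^bsub>N\<^esub> \<Phi> (A, v # B)) (unshuffle vs)"
    by (rule free_lift_cong[OF N _ unshuffle_length])
      (auto simp: fl supported_scale X intro!: vsp_closed[OF N] cl)
  finally show ?thesis .
qed

lemma free_lift_diff:
  assumes "vsp N" "\<And>x. x \<in> X \<Longrightarrow> f x \<in> carrier N" "u \<in> supported X" "v \<in> supported X"
  shows "free_lift N f (u - v) = free_lift N f u \<oplus>\<^bsub>N\<^esub> (- 1) \<odot>\<^bsub>N\<^esub> free_lift N f v"
  using free_lift_add[OF assms(1,2), of X "\<lambda>x. x" u "- v"] free_lift_neg[OF assms(1,2), of X "\<lambda>x. x" v] assms(3,4)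
  by (simp add: supported_neg)

lemma vsp_minus_self: "vsp N \<Longrightarrow> x \<in> carrier N \<Longrightarrow> x \<oplus>\<^bsub>N\<^esub> (- 1) \<odot>\<^bsub>N\<^esub> x = \<zero>\<^bsub>N\<^esub>"
  using vsp_smult_l_distr[of N x 1 "-1"] by (simp add: vsp_zero_smult vsp_one_smult)

lemma free_lift_rcobar_pair:
  assumes N: "vsp N" and "f (singles (pre @ x # y # post)) \<in> carrier N" "f (singles (pre @ y # x # post)) \<in> carrier N"
  shows "free_lift N f (rcobar (singles pre @ [x, y] # singles post)) = (-1) ^ length pre \<odot>\<^bsub>N\<^esub>
    (f (singles (pre @ x # y # post)) \<oplus>\<^bsub>N\<^esub> (-1) \<odot>\<^bsub>N\<^esub> f (singles (pre @ y # x # post)))"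
proof -
  define p q where "p = singles (pre @ x # y # post)" and "q = singles (pre @ y # x # post)"
  have f: "f bs \<in> carrier N" if "bs \<in> {p, q}" for bs using that assms(2,3) by (auto simp only: p_def q_def)
  have s: "gen p \<in> supported {p, q}" "gen q \<in> supported {p, q}" by simp_all
  show ?thesis
    unfolding rcobar_one_pair p_def[symmetric] q_def[symmetric]
    using free_lift_scale[OF N f supported_diff[OF s]] free_lift_diff[OF N f s]
      free_lift_gen[of N "{p, q}" f p, OF N f] free_lift_gen[of N "{p, q}" f q, OF N f] by simp
qed

section \<open>Presented spaces\<close>

lemma cls_eq: "cls R u = {v. v - u \<in> free.span R}"
  unfolding cls_def by (auto simp: algebra_simps) (metis add.commute diff_add_cancel)

lemma cls_eq_iff: "cls R u = cls R v \<longleftrightarrow> u - v \<in> free.span R"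
proof
  assume "cls R u = cls R v"
  moreover have "u \<in> cls R u" by (simp add: cls_eq free.span_zero)
  ultimately show "u - v \<in> free.span R" by (simp add: cls_eq)
next
  assume uv: "u - v \<in> free.span R"
  have "w - u \<in> free.span R \<longleftrightarrow> w - v \<in> free.span R" for w
    using free.span_add[OF _ uv, of "w - u"] free.span_diff[OF _ uv, of "w - v"] by auto
  then show "cls R u = cls R v" by (simp add: cls_eq)
qed

lemma mem_cls_self: "u \<in> cls R u"
  by (simp add: cls_eq free.span_zero)

lemma presented_zero: "\<zero>\<^bsub>presented X R\<^esub> = cls R 0"
  and carrier_presented: "carrier (presented X R) = cls R ` supported X"
  by (simp_all add: presented_def supported_def)

lemma presented_add: "cls R u \<oplus>\<^bsub>presented X R\<^esub> cls R v = cls R (u + v)"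
proof -
  have "{a + b | a b. a \<in> cls R u \<and> b \<in> cls R v} = cls R (u + v)"
  proof safe
    fix a b assume "a \<in> cls R u" "b \<in> cls R v"
    then show "a + b \<in> cls R (u + v)"
      using free.span_add[of "a - u" R "b - v"] by (simp add: cls_eq algebra_simps)
  next
    fix w assume "w \<in> cls R (u + v)"
    then show "\<exists>a b. w = a + b \<and> a \<in> cls R u \<and> b \<in> cls R v"
      by (intro exI[of _ "w - v"] exI[of _ v]) (simp add: cls_eq algebra_simps free.span_zero)
  qed
  then show ?thesis by (simp add: presented_def)
qed

lemma presented_smult: "c \<odot>\<^bsub>presented X R\<^esub> cls R u = cls R (free_scale c u)"
proof -
  have "{free_scale c a + r | a r. a \<in> cls R u \<and> r \<in> free.span R} = cls R (free_scale c u)"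
  proof safe
    fix a r assume "a \<in> cls R u" "r \<in> free.span R"
    then show "free_scale c a + r \<in> cls R (free_scale c u)"
      using free.span_add[OF free.span_scale[of "a - u" R c], of r]
      by (simp add: cls_eq free.scale_right_diff_distrib algebra_simps)
  next
    fix w assume "w \<in> cls R (free_scale c u)"
    then show "\<exists>a r. w = free_scale c a + r \<and> a \<in> cls R u \<and> r \<in> free.span R"
      by (intro exI[of _ u] exI[of _ "w - free_scale c u"]) (simp add: cls_eq free.span_zero)
  qed
  then show ?thesis by (simp add: presented_def)
qed

lemma vsp_presented: "vsp (presented X R)"
proof (rule vspI)
  show "abelian_group (presented X R)"
  proof (rule abelian_groupI, simp_all only: carrier_presented presented_zero)
    fix x assume "x \<in> cls R ` supported X"
    then obtain u where u: "u \<in> supported X" "x = cls R u" by blast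
    show "\<exists>y\<in>cls R ` supported X. y \<oplus>\<^bsub>presented X R\<^esub> x = cls R 0"
      by (rule bexI[of _ "cls R (- u)"]) (auto simp: u presented_add intro!: supported_neg)
  qed (auto simp: presented_add add_ac intro!: supported_add)
qed (auto simp: carrier_presented presented_add presented_smult free.scale_left_distrib
    free.scale_right_distrib intro!: supported_scale)

lemma presented_generators:
  assumes "x \<in> carrier (presented X R)"
  shows "x \<in> lspan (presented X R) ((\<lambda>x. cls R (gen x)) ` X)"
proof -
  from assms obtain u where u: "u \<in> supported X" "x = cls R u" by (auto simp: carrier_presented)
  have "cls R u \<in> lspan (presented X R) ((\<lambda>x. cls R (gen x)) ` X)"
    using u(1)
  proof (induct rule: supported_induct)
    case zero
    then show ?case by (simp add: lspan_zero flip: presented_zero[of X])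
  next
    case (step c x v)
    then show ?case
      by (auto simp flip: presented_add[where X = X] presented_smult[where X = X] intro!: lspan_add lspan_smult intro: lspan_base)
  qed
  then show ?thesis by (simp add: u)
qed

lemma free_lift_presented:
  assumes "u \<in> supported Y" "\<And>y. y \<in> Y \<Longrightarrow> g y \<in> supported X"
  shows "free_lift (presented X R) (\<lambda>y. cls R (g y)) u = cls R (free_ext g u)"
  using assms(1)
proof (induct rule: supported_induct)
  case zero
  then show ?case by (simp add: free_lift_0[OF vsp_presented] presented_zero)
next
  case (step c y v)
  have g: "cls R (g y) \<in> carrier (presented X R)" if "y \<in> Y" for y
    using assms(2) that by (auto simp: carrier_presented)
  from step show ?case
    by (simp add: free_lift_add[OF vsp_presented g] free_lift_scale[OF vsp_presented g]
        free_lift_gen[OF vsp_presented g] supported_scale free_ext_add free_ext_scale presented_add presented_smult)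
qed

lemma span_supported: "R \<subseteq> supported X \<Longrightarrow> r \<in> free.span R \<Longrightarrow> r \<in> supported X"
  by (meson free.span_minimal subsetD subspace_supported)

lemma free_lift_span_kill:
  assumes N: "vsp N" and f: "\<And>x. x \<in> X \<Longrightarrow> f x \<in> carrier N"
    and R: "R \<subseteq> supported X" and kill: "\<And>r. r \<in> R \<Longrightarrow> free_lift N f r = \<zero>\<^bsub>N\<^esub>"
    and r: "r \<in> free.span R"
  shows "free_lift N f r = \<zero>\<^bsub>N\<^esub>"
proof -
  have "r \<in> supported X \<and> free_lift N f r = \<zero>\<^bsub>N\<^esub>"
    using r
  proof (induct rule: free.span_induct_alt)
    case base
    show ?case by (simp add: free_lift_0[OF N])
  next
    case (step c r r')
    then have "r \<in> supported X" using R by auto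
    with step show ?case
      by (simp add: free_lift_add[OF N f] free_lift_scale[OF N f] supported_scale supported_add kill vsp_smult_zero[OF N]
          vsp_l_zero[OF N] vsp_zero_closed[OF N])
  qed
  then show ?thesis ..
qed

text \<open>A coset is mapped to a singleton, because the linear extension of \<open>f\<close> is constant on
  it.\<close>

lemma quot_lift_cls:
  assumes N: "vsp N" and f: "\<And>x. x \<in> X \<Longrightarrow> f x \<in> carrier N"
    and R: "R \<subseteq> supported X" and kill: "\<And>r. r \<in> R \<Longrightarrow> free_lift N f r = \<zero>\<^bsub>N\<^esub>"
    and u: "u \<in> supported X"
  shows "quot_lift N f (cls R u) = free_lift N f u"
proof -
  have "free_lift N f v = free_lift N f u" if "v \<in> cls R u" for v
  proof -
    have r: "v - u \<in> free.span R" using that by (simp add: cls_eq)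
    have "v - u \<in> supported X" by (rule span_supported[OF R r])
    then have "free_lift N f ((v - u) + u) = free_lift N f (v - u) \<oplus>\<^bsub>N\<^esub> free_lift N f u"
      using u by (intro free_lift_add[OF N f])
    then show ?thesis using free_lift_span_kill[OF N f R kill r] vsp_l_zero[OF N free_lift_closed[OF N f u]]
      by simp
  qed
  then have "free_lift N f ` cls R u = {free_lift N f u}" using mem_cls_self[of u R] by blast
  then show ?thesis by (simp add: quot_lift_def)
qed

lemma quot_lift_lin:
  assumes N: "vsp N" and f: "\<And>x. x \<in> X \<Longrightarrow> f x \<in> carrier N"
    and R: "R \<subseteq> supported X" and kill: "\<And>r. r \<in> R \<Longrightarrow> free_lift N f r = \<zero>\<^bsub>N\<^esub>"
  shows "quot_lift N f \<in> lin (presented X R) N"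
proof (rule linI)
  note q = quot_lift_cls[OF assms]
  fix x y c assume "x \<in> carrier (presented X R)"
  then obtain u where u: "u \<in> supported X" "x = cls R u" by (auto simp: carrier_presented)
  show "quot_lift N f x \<in> carrier N" using u by (simp add: q free_lift_closed[OF N f])
  show "quot_lift N f (c \<odot>\<^bsub>presented X R\<^esub> x) = c \<odot>\<^bsub>N\<^esub> quot_lift N f x"
    using u by (simp add: q presented_smult supported_scale free_lift_scale[OF N f])
  assume "y \<in> carrier (presented X R)"
  then obtain v where v: "v \<in> supported X" "y = cls R v" by (auto simp: carrier_presented)
  show "quot_lift N f (x \<oplus>\<^bsub>presented X R\<^esub> y) = quot_lift N f x \<oplus>\<^bsub>N\<^esub> quot_lift N f y"
    using u v by (simp add: q presented_add supported_add free_lift_add[OF N f])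
qed

section \<open>Direct sums\<close>

context
  fixes I :: "'i set" and M :: "'i \<Rightarrow> ('k::field, 'a) module"
  assumes M: "\<And>i. i \<in> I \<Longrightarrow> vsp (M i)" and I: "finite I"
begin

lemma dsum_carrier: "carrier (dsum I M) = (\<Pi>\<^sub>E i\<in>I. carrier (M i))"
  using I by (simp add: dsum_def)

lemma dsum_simps: "\<zero>\<^bsub>dsum I M\<^esub> = (\<lambda>i\<in>I. \<zero>\<^bsub>M i\<^esub>)" "x \<oplus>\<^bsub>dsum I M\<^esub> y = (\<lambda>i\<in>I. x i \<oplus>\<^bsub>M i\<^esub> y i)"
  "c \<odot>\<^bsub>dsum I M\<^esub> x = (\<lambda>i\<in>I. c \<odot>\<^bsub>M i\<^esub> x i)"
  by (simp_all add: dsum_def)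

lemma vsp_dsum: "vsp (dsum I M)"
proof (rule vspI)
  show "abelian_group (dsum I M)"
  proof (rule abelian_groupI)
    fix x assume x: "x \<in> carrier (dsum I M)"
    show "\<exists>y\<in>carrier (dsum I M). y \<oplus>\<^bsub>dsum I M\<^esub> x = \<zero>\<^bsub>dsum I M\<^esub>"
    proof (rule bexI[of _ "\<lambda>i\<in>I. (-1) \<odot>\<^bsub>M i\<^esub> x i"])
      have "(-1) \<odot>\<^bsub>M i\<^esub> x i \<oplus>\<^bsub>M i\<^esub> x i = \<zero>\<^bsub>M i\<^esub>" if "i \<in> I" for i
      proof -
        have xi: "x i \<in> carrier (M i)" using x that by (auto simp: dsum_carrier)
        have "(-1) \<odot>\<^bsub>M i\<^esub> x i \<oplus>\<^bsub>M i\<^esub> x i = (-1 + 1) \<odot>\<^bsub>M i\<^esub> x i"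
          by (simp only: vsp_smult_l_distr[OF M[OF that] xi] vsp_one_smult[OF M[OF that] xi])
        then show ?thesis by (simp add: vsp_zero_smult[OF M[OF that] xi])
      qed
      then show "(\<lambda>i\<in>I. (-1) \<odot>\<^bsub>M i\<^esub> x i) \<oplus>\<^bsub>dsum I M\<^esub> x = \<zero>\<^bsub>dsum I M\<^esub>"
        by (auto simp: dsum_simps)
    qed (use x in \<open>auto simp: dsum_carrier PiE_iff vsp_smult_closed[OF M]\<close>)
  qed (auto simp: dsum_carrier dsum_simps PiE_iff vsp_closed[OF M] vsp_assoc[OF M] vsp_comm[OF M] vsp_lcomm[OF M] vsp_l_zero[OF M] vsp_r_zero[OF M]
      extensional_def fun_eq_iff intro: vsp_zero_closed[OF M] vsp_add_closed[OF M])
qed (auto simp: dsum_carrier dsum_simps PiE_iff vsp_smult_l_distr[OF M] vsp_smult_r_distr[OF M]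
    vsp_smult_assoc[OF M] vsp_one_smult[OF M] extensional_def fun_eq_iff intro: vsp_smult_closed[OF M])

lemma dsum_proj_lin: "i \<in> I \<Longrightarrow> (\<lambda>x. x i) \<in> lin (dsum I M) (M i)"
  by (rule linI) (auto simp: dsum_carrier dsum_simps PiE_iff)

lemma dsum_in_lin:
  assumes "j \<in> I"
  shows "dsum_in I M j \<in> lin (M j) (dsum I M)"
  using assms
  by (intro linI) (auto simp: dsum_carrier dsum_simps dsum_in_def vsp_zero_closed[OF M] vsp_l_zero[OF M]
      vsp_smult_zero[OF M] fun_eq_iff)

lemma dsum_in_component: "i \<in> I \<Longrightarrow> dsum_in I M j a i = (if i = j then a else \<zero>\<^bsub>M i\<^esub>)"
  by (simp add: dsum_in_def)

lemma dsum_decompose: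
  assumes x: "x \<in> carrier (dsum I M)"
  shows "x = finsum (dsum I M) (\<lambda>j. dsum_in I M j (x j)) I"
proof
  fix i
  have c: "(\<lambda>j. dsum_in I M j (x j)) \<in> I \<rightarrow> carrier (dsum I M)"
    using x by (auto simp: dsum_carrier intro!: lin_closed[OF dsum_in_lin, unfolded dsum_carrier])
  show "x i = finsum (dsum I M) (\<lambda>j. dsum_in I M j (x j)) I i"
  proof (cases "i \<in> I")
    case True
    have xi: "x i \<in> carrier (M i)" using x True by (auto simp: dsum_carrier)
    have "finsum (dsum I M) (\<lambda>j. dsum_in I M j (x j)) I i = finsum (M i) (\<lambda>j. dsum_in I M j (x j) i) I"
      by (rule lin_finsum[OF vsp_dsum M dsum_proj_lin c]) (use True in auto)
    also have "\<dots> = finsum (M i) (\<lambda>j. if j = i then x i else \<zero>\<^bsub>M i\<^esub>) I"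
      by (rule vsp_finsum_cong[OF M]) (use True xi in \<open>auto simp: dsum_in_component vsp_zero_closed[OF M]\<close>)
    also have "\<dots> = x i" by (rule vsp_finsum_single[OF M]) (use True I xi in auto)
    finally show ?thesis by simp
  next
    case False
    have "finsum (dsum I M) (\<lambda>j. dsum_in I M j (x j)) I \<in> carrier (dsum I M)"
      by (rule vsp_finsum_closed[OF vsp_dsum c])
    then show ?thesis using x False by (auto simp: dsum_carrier PiE_iff extensional_def)
  qed
qed

lemma dsum_generators:
  assumes x: "x \<in> carrier (dsum I M)"
    and G: "\<And>i a. i \<in> I \<Longrightarrow> a \<in> carrier (M i) \<Longrightarrow> a \<in> lspan (M i) (G i)" "\<And>i. i \<in> I \<Longrightarrow> G i \<subseteq> carrier (M i)"
  shows "x \<in> lspan (dsum I M) (\<Union>i\<in>I. dsum_in I M i ` G i)"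
proof -
  let ?H = "\<Union>i\<in>I. dsum_in I M i ` G i"
  have "finsum (dsum I M) (\<lambda>j. dsum_in I M j (x j)) J \<in> lspan (dsum I M) ?H" if "finite J" "J \<subseteq> I" for J
    using that
  proof (induct J)
    case (insert j J)
    have xj: "x j \<in> carrier (M j)" "j \<in> I" using x insert by (auto simp: dsum_carrier)
    have "dsum_in I M j (x j) \<in> lspan (dsum I M) ?H"
      by (rule lin_lspan[OF M vsp_dsum dsum_in_lin G(2) G(1)]) (use xj in \<open>auto intro: lspan_base\<close>)
    moreover have "(\<lambda>j. dsum_in I M j (x j)) \<in> insert j J \<rightarrow> carrier (dsum I M)"
      using x insert by (auto simp: dsum_carrier intro!: lin_closed[OF dsum_in_lin, unfolded dsum_carrier])
    ultimately show ?case using insert by (simp add: vsp_finsum_insert[OF vsp_dsum] lspan_add)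
  qed (simp add: vsp_finsum_empty[OF vsp_dsum] lspan_zero)
  from this[OF I] dsum_decompose[OF x] show ?thesis by simp
qed

text \<open>The universal property of a finite direct sum.\<close>

lemma dsum_lift_in:
  assumes N: "vsp N" and f: "\<And>i. i \<in> I \<Longrightarrow> f i \<in> lin (M i) N"
  shows "(\<lambda>x. finsum N (\<lambda>i. f i (x i)) I) \<in> lin (dsum I M) N"
    "j \<in> I \<Longrightarrow> a \<in> carrier (M j) \<Longrightarrow> finsum N (\<lambda>i. f i (dsum_in I M j a i)) I = f j a"
proof -
  show "(\<lambda>x. finsum N (\<lambda>i. f i (x i)) I) \<in> lin (dsum I M) N"
    by (intro lin_finsum_fun vsp_dsum N) (rule lin_comp[OF dsum_proj_lin f])
  assume j: "j \<in> I" "a \<in> carrier (M j)"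
  have "finsum N (\<lambda>i. f i (dsum_in I M j a i)) I = finsum N (\<lambda>i. if i = j then f j a else \<zero>\<^bsub>N\<^esub>) I"
    by (rule vsp_finsum_cong[OF N])
      (use j in \<open>auto simp: dsum_in_component lin_zero[OF M N f] vsp_zero_closed[OF N] intro: lin_closed[OF f]\<close>)
  also have "\<dots> = f j a" by (rule vsp_finsum_single[OF N]) (use j I in \<open>auto intro: lin_closed[OF f]\<close>)
  finally show "finsum N (\<lambda>i. f i (dsum_in I M j a i)) I = f j a" .
qed

end

lemma dsum_map:
  assumes "\<And>i. i \<in> I \<Longrightarrow> vsp (M i)" "\<And>i. i \<in> I \<Longrightarrow> vsp (N i)" "finite I" "\<And>i. i \<in> I \<Longrightarrow> f i \<in> lin (M i) (N i)"
  shows "(\<lambda>x. \<lambda>i\<in>I. f i (x i)) \<in> lin (dsum I M) (dsum I N)"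
    "j \<in> I \<Longrightarrow> a \<in> carrier (M j) \<Longrightarrow> (\<lambda>i\<in>I. f i (dsum_in I M j a i)) = dsum_in I N j (f j a)"
proof -
  note f = lin_closed[OF assms(4)] lin_add[OF assms(4)] lin_smult[OF assms(4)]
  show "(\<lambda>x. \<lambda>i\<in>I. f i (x i)) \<in> lin (dsum I M) (dsum I N)"
    by (rule linI)
      (auto simp: dsum_carrier[OF assms(1,3)] dsum_carrier[OF assms(2,3)] dsum_simps[OF assms(1,3)] dsum_simps[OF assms(2,3)]
        PiE_iff f fun_eq_iff)
  show "j \<in> I \<Longrightarrow> a \<in> carrier (M j) \<Longrightarrow> (\<lambda>i\<in>I. f i (dsum_in I M j a i)) = dsum_in I N j (f j a)"
    by (auto simp: dsum_in_def fun_eq_iff lin_zero[OF assms(1,2,4)])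
qed

section \<open>Multilinear maps and tensor products\<close>

lemma mem_listset: "xs \<in> listset As \<longleftrightarrow> length xs = length As \<and> (\<forall>i<length As. xs ! i \<in> As ! i)"
proof (induct As arbitrary: xs)
  case (Cons A As)
  show ?case
  proof (cases xs)
    case (Cons y ys)
    then show ?thesis by (auto simp: set_Cons_def Cons.hyps nth_Cons less_Suc_eq_0_disj split: nat.splits)
  qed (auto simp: set_Cons_def)
qed auto

lemma mem_listset_carrier:
  "xs \<in> listset (map carrier Ms) \<longleftrightarrow> length xs = length Ms \<and> (\<forall>i<length Ms. xs ! i \<in> carrier (Ms ! i))"
  by (auto simp: mem_listset)

lemma listset_update:
  "xs \<in> listset (map carrier Ms) \<Longrightarrow> j < length Ms \<Longrightarrow> x \<in> carrier (Ms ! j) \<Longrightarrow> xs[j := x] \<in> listset (map carrier Ms)"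
  by (auto simp: mem_listset_carrier nth_list_update)

definition multilinear :: "('k::field, 'a) module list \<Rightarrow> ('k, 'b) module \<Rightarrow> ('a list \<Rightarrow> 'b) \<Rightarrow> bool" where
  "multilinear Ms N f \<longleftrightarrow> (\<forall>xs\<in>listset (map carrier Ms). f xs \<in> carrier N \<and>
     (\<forall>j<length Ms. (\<lambda>x. f (xs[j := x])) \<in> lin (Ms ! j) N))"

lemma multilinear_closed: "multilinear Ms N f \<Longrightarrow> xs \<in> listset (map carrier Ms) \<Longrightarrow> f xs \<in> carrier N"
  and multilinear_lin: "multilinear Ms N f \<Longrightarrow> xs \<in> listset (map carrier Ms) \<Longrightarrow> j < length Ms \<Longrightarrow> (\<lambda>x. f (xs[j := x])) \<in> lin (Ms ! j) N"
  by (auto simp: multilinear_def)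

lemma multilinear_cong:
  assumes "\<forall>M\<in>set Ms. vsp M" "multilinear Ms N g" "\<And>xs. xs \<in> listset (map carrier Ms) \<Longrightarrow> f xs = g xs"
  shows "multilinear Ms N f"
  unfolding multilinear_def
proof (intro ballI conjI allI impI)
  fix xs j assume xs: "xs \<in> listset (map carrier Ms)"
  then show "f xs \<in> carrier N" using assms by (simp add: multilinear_closed)
  assume j: "j < length Ms"
  then have "vsp (Ms ! j)" using assms(1) by simp
  then show "(\<lambda>x. f (xs[j := x])) \<in> lin (Ms ! j) N"
    by (rule lin_cong[OF _ multilinear_lin[OF assms(2) xs j]]) (intro assms(3) listset_update xs j)
qed

lemma multilinear_middle:
  assumes "multilinear (Ms1 @ Ms2 @ Ms3) N f" "xs \<in> listset (map carrier Ms1)" "zs \<in> listset (map carrier Ms3)"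
  shows "multilinear Ms2 N (\<lambda>ys. f (xs @ ys @ zs))"
  unfolding multilinear_def
proof (intro ballI conjI allI impI)
  fix ys assume ys: "ys \<in> listset (map carrier Ms2)"
  have mem: "xs @ ys @ zs \<in> listset (map carrier (Ms1 @ Ms2 @ Ms3))"
    using assms(2,3) ys unfolding mem_listset_carrier by (auto simp: nth_append)
  then show "f (xs @ ys @ zs) \<in> carrier N" by (rule multilinear_closed[OF assms(1)])
  fix j assume j: "j < length Ms2"
  then show "(\<lambda>y. f (xs @ ys[j := y] @ zs)) \<in> lin (Ms2 ! j) N"
    using multilinear_lin[OF assms(1) mem, of "length xs + j"] assms(2) ys
    by (simp add: mem_listset_carrier list_update_append nth_append)
qed

lemma multilinear_finsum:
  assumes "\<forall>M\<in>set Ms. vsp M" "vsp N" "\<And>i. i \<in> A \<Longrightarrow> multilinear Ms N (f i)"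
  shows "multilinear Ms N (\<lambda>xs. finsum N (\<lambda>i. f i xs) A)"
  unfolding multilinear_def
proof (intro ballI conjI allI impI)
  fix xs assume xs: "xs \<in> listset (map carrier Ms)"
  show "finsum N (\<lambda>i. f i xs) A \<in> carrier N"
    using assms(3) xs by (intro vsp_finsum_closed assms(2)) (auto intro: multilinear_closed)
  fix j assume "j < length Ms"
  then show "(\<lambda>x. finsum N (\<lambda>i. f i (xs[j := x])) A) \<in> lin (Ms ! j) N"
    using assms(1) xs by (intro lin_finsum_fun assms(2) multilinear_lin[OF assms(3)]) auto
qed

lemma multilinear_scaled: "vsp N \<Longrightarrow> multilinear Ms N f \<Longrightarrow> multilinear Ms N (\<lambda>xs. c \<odot>\<^bsub>N\<^esub> f xs)"
  unfolding multilinear_def by (auto intro: vsp_smult_closed lin_scaled)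

lemma multilinear_rels_supported:
  assumes "\<forall>M\<in>set Ms. vsp M"
  shows "multilinear_rels Ms \<subseteq> supported (listset (map carrier Ms))"
proof -
  have M: "vsp (Ms ! j)" if "j < length Ms" for j using assms that by auto
  show ?thesis unfolding multilinear_rels_def
    by (auto intro!: supported_diff supported_scale listset_update vsp_add_closed[OF M] vsp_smult_closed[OF M])
qed

lemma multilinear_kill:
  assumes M: "\<forall>M\<in>set Ms. vsp M" and N: "vsp N" and f: "multilinear Ms N f" and r: "r \<in> multilinear_rels Ms"
  shows "free_lift N f r = \<zero>\<^bsub>N\<^esub>"
proof -
  note fc = multilinear_closed[OF f]
  note fl = free_lift_diff[OF N fc] free_lift_gen[OF N fc] free_lift_scale[OF N fc]
  have Mj: "vsp (Ms ! j)" if "j < length Ms" for j using M that by auto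
  from r consider
    (add) xs j x y where "xs \<in> listset (map carrier Ms)" "j < length Ms" "x \<in> carrier (Ms ! j)" "y \<in> carrier (Ms ! j)"
      "r = gen (xs[j := x \<oplus>\<^bsub>Ms ! j\<^esub> y]) - gen (xs[j := x]) - gen (xs[j := y])"
  | (scale) xs j c x where "xs \<in> listset (map carrier Ms)" "j < length Ms" "x \<in> carrier (Ms ! j)"
      "r = gen (xs[j := c \<odot>\<^bsub>Ms ! j\<^esub> x]) - free_scale c (gen (xs[j := x]))"
    unfolding multilinear_rels_def by blast
  then show ?thesis
  proof cases
    case add
    note l = multilinear_lin[OF f add(1,2)]
    have c: "xs[j := x] \<in> listset (map carrier Ms)" "xs[j := y] \<in> listset (map carrier Ms)"
      "xs[j := x \<oplus>\<^bsub>Ms ! j\<^esub> y] \<in> listset (map carrier Ms)"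
      using add by (auto intro!: listset_update vsp_add_closed[OF Mj])
    let ?a = "f (xs[j := x])" and ?b = "f (xs[j := y])"
    have ab: "?a \<in> carrier N" "?b \<in> carrier N" using c fc by auto
    have "free_lift N f r = (?a \<oplus>\<^bsub>N\<^esub> ?b) \<oplus>\<^bsub>N\<^esub> (- 1) \<odot>\<^bsub>N\<^esub> ?a \<oplus>\<^bsub>N\<^esub> (- 1) \<odot>\<^bsub>N\<^esub> ?b"
      using c lin_add[OF l add(3,4)] by (simp add: add(5) fl supported_diff)
    also have "\<dots> = (?a \<oplus>\<^bsub>N\<^esub> (- 1) \<odot>\<^bsub>N\<^esub> ?a) \<oplus>\<^bsub>N\<^esub> (?b \<oplus>\<^bsub>N\<^esub> (- 1) \<odot>\<^bsub>N\<^esub> ?b)"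
      using ab by (simp add: vsp_assoc[OF N] vsp_lcomm[OF N] vsp_comm[OF N] vsp_closed[OF N])
    finally show ?thesis using ab by (simp add: vsp_minus_self[OF N] vsp_l_zero[OF N] vsp_closed[OF N])
  next
    case scale
    note l = multilinear_lin[OF f scale(1,2)]
    have c: "xs[j := x] \<in> listset (map carrier Ms)" "xs[j := c \<odot>\<^bsub>Ms ! j\<^esub> x] \<in> listset (map carrier Ms)"
      using scale by (auto intro!: listset_update vsp_smult_closed[OF Mj])
    have "free_lift N f r = c \<odot>\<^bsub>N\<^esub> f (xs[j := x]) \<oplus>\<^bsub>N\<^esub> (- 1) \<odot>\<^bsub>N\<^esub> (c \<odot>\<^bsub>N\<^esub> f (xs[j := x]))"
      using c lin_smult[OF l scale(3)] by (simp add: scale(4) fl supported_scale)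
    then show ?thesis using c by (simp add: vsp_minus_self[OF N] vsp_smult_closed[OF N] fc)
  qed
qed

lemma presented_multilinear:
  assumes "\<forall>M\<in>set Ms. vsp M" "multilinear_rels Ms \<subseteq> R" "listset (map carrier Ms) \<subseteq> X"
  shows "multilinear Ms (presented X R) (\<lambda>xs. cls R (gen xs))"
  unfolding multilinear_def
proof (intro ballI conjI allI impI linI)
  fix xs j x y c assume xs: "xs \<in> listset (map carrier Ms)"
  then show "cls R (gen xs) \<in> carrier (presented X R)" using assms(3) by (auto simp: carrier_presented)
  assume j: "j < length Ms" and x: "x \<in> carrier (Ms ! j)"
  then show "cls R (gen (xs[j := x])) \<in> carrier (presented X R)"
    using listset_update[OF xs j x] assms(3) by (auto simp: carrier_presented)
  have "gen (xs[j := c \<odot>\<^bsub>Ms ! j\<^esub> x]) - free_scale c (gen (xs[j := x])) \<in> R"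
    using xs j x assms(2) unfolding multilinear_rels_def by blast
  then show "cls R (gen (xs[j := c \<odot>\<^bsub>Ms ! j\<^esub> x])) = c \<odot>\<^bsub>presented X R\<^esub> cls R (gen (xs[j := x]))"
    by (simp add: presented_smult cls_eq_iff free.span_base)
  assume y: "y \<in> carrier (Ms ! j)"
  have "gen (xs[j := x \<oplus>\<^bsub>Ms ! j\<^esub> y]) - gen (xs[j := x]) - gen (xs[j := y]) \<in> R"
    using xs j x y assms(2) unfolding multilinear_rels_def by blast
  then show "cls R (gen (xs[j := x \<oplus>\<^bsub>Ms ! j\<^esub> y])) = cls R (gen (xs[j := x])) \<oplus>\<^bsub>presented X R\<^esub> cls R (gen (xs[j := y]))"
    by (simp add: presented_add cls_eq_iff free.span_base diff_diff_eq)
qed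

text \<open>Replace the entries of \<open>xs\<close> one after the other by generators.\<close>

lemma multilinear_lspan:
  assumes M: "\<forall>M\<in>set Ms. vsp M" and N: "vsp N" and f: "multilinear Ms N f"
    and G: "\<And>j. j < length Ms \<Longrightarrow> G j \<subseteq> carrier (Ms ! j)"
      "\<And>j a. j < length Ms \<Longrightarrow> a \<in> carrier (Ms ! j) \<Longrightarrow> a \<in> lspan (Ms ! j) (G j)"
    and xs: "xs \<in> listset (map carrier Ms)"
  shows "f xs \<in> lspan N (f ` {gs. length gs = length Ms \<and> (\<forall>j<length Ms. gs ! j \<in> G j)})"
proof -
  let ?H = "f ` {gs. length gs = length Ms \<and> (\<forall>j<length Ms. gs ! j \<in> G j)}"
  have "f xs \<in> lspan N ?H"
    if "m \<le> length Ms" "xs \<in> listset (map carrier Ms)" "\<And>j. m \<le> j \<Longrightarrow> j < length Ms \<Longrightarrow> xs ! j \<in> G j" for m xs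
    using that
  proof (induct m arbitrary: xs)
    case 0
    then show ?case by (auto simp: mem_listset_carrier intro!: lspan_base)
  next
    case (Suc m)
    then have m: "m < length Ms" by simp
    have "f (xs[m := xs ! m]) \<in> lspan N ?H"
    proof (rule lin_lspan[OF _ N multilinear_lin[OF f Suc.prems(2) m] G(1)[OF m] G(2)[OF m]])
      show "vsp (Ms ! m)" using M m by auto
      show "xs ! m \<in> carrier (Ms ! m)" using Suc.prems(2) m by (auto simp: mem_listset_carrier)
      fix g assume g: "g \<in> G m"
      show "f (xs[m := g]) \<in> lspan N ?H"
      proof (rule Suc.hyps)
        show "xs[m := g] \<in> listset (map carrier Ms)"
          using g G(1)[OF m] by (intro listset_update Suc.prems m) auto
        fix j assume "m \<le> j" "j < length Ms"
        then show "xs[m := g] ! j \<in> G j"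
          using g Suc.prems(2,3)[of ] by (cases "j = m") (auto simp: mem_listset_carrier)
      qed (use m in simp)
    qed
    then show ?case by simp
  qed
  from this[of "length Ms"] xs show ?thesis by simp
qed

context
  fixes Ms :: "('k::field, 'a) module list"
  assumes M: "\<forall>M\<in>set Ms. vsp M"
begin

lemma vsp_tensor: "vsp (tensor Ms)"
  unfolding tensor_def by (rule vsp_presented)

lemma pure_tensor_multilinear: "multilinear Ms (tensor Ms) (pure_tensor Ms)"
  unfolding tensor_def pure_tensor_def[abs_def] by (rule presented_multilinear[OF M]) auto

lemma tensor_generators: "x \<in> carrier (tensor Ms) \<Longrightarrow> x \<in> lspan (tensor Ms) (pure_tensor Ms ` listset (map carrier Ms))"
  unfolding tensor_def pure_tensor_def[abs_def] by (rule presented_generators)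

lemma tensor_lift_lin: "vsp N \<Longrightarrow> multilinear Ms N f \<Longrightarrow> quot_lift N f \<in> lin (tensor Ms) N"
  unfolding tensor_def
  by (rule quot_lift_lin[OF _ multilinear_closed multilinear_rels_supported[OF M] multilinear_kill[OF M]])

lemma tensor_lift_pure:
  "vsp N \<Longrightarrow> multilinear Ms N f \<Longrightarrow> xs \<in> listset (map carrier Ms) \<Longrightarrow> quot_lift N f (pure_tensor Ms xs) = f xs"
  unfolding pure_tensor_def
  by (subst quot_lift_cls[OF _ multilinear_closed multilinear_rels_supported[OF M] multilinear_kill[OF M]])
    (auto intro!: free_lift_gen multilinear_closed)

end

section \<open>Vector spaces on a type\<close>

lemma vec_module_simps [simp]: "carrier (vec_module scale) = UNIV" "\<zero>\<^bsub>vec_module scale\<^esub> = 0"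
  "x \<oplus>\<^bsub>vec_module scale\<^esub> y = x + y" "c \<odot>\<^bsub>vec_module scale\<^esub> x = scale c x"
  by (simp_all add: vec_module_def)

lemma vsp_vec_module:
  assumes "vector_space scale"
  shows "vsp (vec_module scale)"
proof (rule vspI)
  interpret vector_space scale by (rule assms)
  show "abelian_group (vec_module scale)"
  proof (rule abelian_groupI)
    fix x
    show "\<exists>y\<in>carrier (vec_module scale). y \<oplus>\<^bsub>vec_module scale\<^esub> x = \<zero>\<^bsub>vec_module scale\<^esub>"
      by (rule bexI[of _ "- x"]) auto
  qed (auto simp: add_ac)
qed (auto simp: vector_space.vector_space_assms[OF assms])

lemma finite_comps: "finite (comps n t p)"
proof (rule finite_subset)
  show "comps n t p \<subseteq> {c. set c \<subseteq> {1..n} \<and> length c = p}" by (auto simp: comps_def)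
qed (rule finite_lists_length_eq, simp)

text \<open>The abbreviations fix the vector space once and for all; \<open>\<Lambda>s c\<close> is the tensor
  product of the exterior powers of degrees \<open>c\<close>.\<close>

locale exterior = vector_space scale for scale :: "'k::field \<Rightarrow> 'v::ab_group_add \<Rightarrow> 'v"
begin

abbreviation V :: "('k, 'v) module" where "V \<equiv> vec_module scale"
abbreviation "dimV \<equiv> vdim scale"
abbreviation "\<Lambda> \<equiv> ext_power scale"
abbreviation "wdg \<equiv> wedge scale"
abbreviation "Sym \<equiv> sym_power scale"
abbreviation "sprod \<equiv> sym_prod scale"
abbreviation "\<Lambda>s \<equiv> ext_tensor scale"
abbreviation "epure \<equiv> ext_pure scale"
abbreviation "T \<equiv> T_space scale"
abbreviation "\<delta> \<equiv> T_delta scale"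
abbreviation "sproj \<equiv> sym_proj scale"

lemma vsp_V: "vsp V"
  by (rule vsp_vec_module) (rule vector_space_axioms)

lemma listset_UNIV [simp]: "listset (replicate i UNIV) = {vs. length vs = i}"
  by (auto simp: mem_listset)

lemma listset_vec: "listset (map carrier (replicate i V)) = {vs. length vs = i}"
  by simp

lemma multilinear_vecI:
  assumes "\<And>pre x post. length pre + length post + 1 = i \<Longrightarrow> f (pre @ x # post) \<in> carrier N"
    and "\<And>pre post. length pre + length post + 1 = i \<Longrightarrow> (\<lambda>x. f (pre @ x # post)) \<in> lin V N"
    and "i = 0 \<Longrightarrow> f [] \<in> carrier N"
  shows "multilinear (replicate i V) N f"
  unfolding multilinear_def listset_vec
proof (intro ballI conjI allI impI)
  fix vs :: "'v list" assume vs: "vs \<in> {vs. length vs = i}"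
  then show "f vs \<in> carrier N" using assms(1)[of "[]" "tl vs" "hd vs"] assms(3) by (cases vs) auto
  fix j assume "j < length (replicate i V)"
  then show "(\<lambda>x. f (vs[j := x])) \<in> lin (replicate i V ! j) N"
    using vs assms(2)[of "take j vs" "drop (Suc j) vs"] by (simp add: upd_conv_take_nth_drop)
qed

lemma multilinear_vecD:
  assumes "multilinear (replicate i V) N f" "length pre + length post + 1 = i"
  shows "(\<lambda>x. f (pre @ x # post)) \<in> lin V N"
  using multilinear_lin[OF assms(1), of "pre @ 0 # post" "length pre"] assms(2)
  by (simp add: listset_vec list_update_append)

section \<open>Exterior powers\<close>

context
  fixes N :: "('k, 'b) module" and i f
  assumes N: "vsp N" and f: "multilinear (replicate i V) N f"
    and adj: "\<And>pre x post. length pre + length post + 2 = i \<Longrightarrow> f (pre @ x # x # post) = \<zero>\<^bsub>N\<^esub>"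
begin

text \<open>Expand the vanishing value at \<open>x + y\<close>, \<open>x + y\<close>.\<close>

lemma adjacent_swap:
  assumes l: "length pre + length post + 2 = i"
  shows "f (pre @ x # y # post) \<oplus>\<^bsub>N\<^esub> f (pre @ y # x # post) = \<zero>\<^bsub>N\<^esub>"
proof -
  have cl: "f vs \<in> carrier N" if "length vs = i" for vs
    using multilinear_closed[OF f, of vs] that by (simp add: listset_vec)
  have 1: "f (pre @ (a + b) # c # post) = f (pre @ a # c # post) \<oplus>\<^bsub>N\<^esub> f (pre @ b # c # post)" for a b c
    using lin_add[OF multilinear_vecD[OF f, of pre "c # post"], of a b] l by simp
  have 2: "f (pre @ c # (a + b) # post) = f (pre @ c # a # post) \<oplus>\<^bsub>N\<^esub> f (pre @ c # b # post)" for a b c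
    using lin_add[OF multilinear_vecD[OF f, of "pre @ [c]" "post"], of a b] l by simp
  have "f (pre @ (x + y) # (x + y) # post) = \<zero>\<^bsub>N\<^esub>" using adj[OF l] .
  then show ?thesis using l
    by (simp add: 1 2 adj cl vsp_closed[OF N] vsp_l_zero[OF N] vsp_r_zero[OF N] vsp_comm[OF N])
qed

text \<open>It is enough to have vanishing for equal neighbours: by \<open>adjacent_swap\<close> one of two
  equal entries can be moved next to the other one. In this form the alternating property is easy to verify
  for maps that are defined by recursion on lists.\<close>

lemma adjacent_alternating:
  assumes vs: "length vs = i" "\<not> distinct vs"
  shows "f vs = \<zero>\<^bsub>N\<^esub>"
proof -
  have cl: "f vs \<in> carrier N" if "length vs = i" for vs
    using multilinear_closed[OF f, of vs] that by (simp add: listset_vec)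
  have main: "f (pre @ x # mid @ x # post) = \<zero>\<^bsub>N\<^esub>" if "length pre + length mid + length post + 2 = i" for pre x mid post
    using that
  proof (induct mid arbitrary: pre)
    case (Cons m mid)
    have "f ((pre @ [m]) @ x # mid @ x # post) = \<zero>\<^bsub>N\<^esub>" using Cons(2) by (intro Cons(1)) simp
    with adjacent_swap[of pre "mid @ x # post" x m] Cons(2) cl show ?case by (simp add: vsp_r_zero[OF N])
  qed (simp add: adj)
  obtain pre x mid post where "vs = pre @ [x] @ mid @ [x] @ post" using not_distinct_decomp[OF vs(2)] by blast
  then show ?thesis using main[of pre mid post x] vs(1) by simp
qed

end

lemma vsp_replicate: "\<forall>M\<in>set (replicate i V). vsp M"
  by (simp add: vsp_V)

lemma ext_rels_supported: "ext_rels scale i \<subseteq> supported {vs. length vs = i}"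
  using multilinear_rels_supported[OF vsp_replicate, of i] unfolding listset_vec ext_rels_def by auto

lemma vsp_ext_power: "vsp (\<Lambda> i)"
  unfolding ext_power_def by (rule vsp_presented)

lemma wedge_multilinear: "multilinear (replicate i V) (\<Lambda> i) wdg"
proof -
  have "multilinear (replicate i V) (\<Lambda> i) (\<lambda>vs. cls (ext_rels scale i) (gen vs))"
    unfolding ext_power_def by (rule presented_multilinear[OF vsp_replicate]) (auto simp: ext_rels_def listset_vec)
  then show ?thesis
    unfolding multilinear_def listset_vec by (simp add: wedge_def)
qed

lemma wedge_closed: "length vs = i \<Longrightarrow> wdg vs \<in> carrier (\<Lambda> i)"
  using multilinear_closed[OF wedge_multilinear, of vs i] by (simp add: listset_vec)

lemma wedge_not_distinct: "length vs = i \<Longrightarrow> \<not> distinct vs \<Longrightarrow> wdg vs = \<zero>\<^bsub>\<Lambda> i\<^esub>"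
  by (auto simp: wedge_def ext_power_def presented_zero cls_eq_iff ext_rels_def intro!: free.span_base)

lemma wedge_swap:
  "length pre + length post + 2 = i \<Longrightarrow>
    wdg (pre @ x # y # post) \<oplus>\<^bsub>\<Lambda> i\<^esub> wdg (pre @ y # x # post) = \<zero>\<^bsub>\<Lambda> i\<^esub>"
  by (rule adjacent_swap[OF vsp_ext_power wedge_multilinear]) (rule wedge_not_distinct; simp)

lemma wedge_generators: "x \<in> carrier (\<Lambda> i) \<Longrightarrow> x \<in> lspan (\<Lambda> i) (wdg ` {vs. length vs = i})"
  using presented_generators[of x "{vs. length vs = i}" "ext_rels scale i"]
  by (simp add: ext_power_def wedge_def cong: image_cong_simp)

context
  fixes N :: "('k, 'b) module" and i f
  assumes N: "vsp N" and f: "multilinear (replicate i V) N f"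
    and adj: "\<And>pre x post. length pre + length post + 2 = i \<Longrightarrow> f (pre @ x # x # post) = \<zero>\<^bsub>N\<^esub>"
begin

lemma ext_kill: "r \<in> ext_rels scale i \<Longrightarrow> free_lift N f r = \<zero>\<^bsub>N\<^esub>"
  unfolding ext_rels_def
  using multilinear_kill[OF vsp_replicate N f] adjacent_alternating[OF N f adj]
    free_lift_gen[OF N, of "{vs. length vs = i}" f] multilinear_closed[OF f, unfolded listset_vec] by auto

lemma ext_lift_lin: "quot_lift N f \<in> lin (\<Lambda> i) N"
  unfolding ext_power_def
  by (rule quot_lift_lin[OF N multilinear_closed[OF f, unfolded listset_vec] ext_rels_supported ext_kill])

lemma ext_lift_wedge:
  assumes "length vs = i"
  shows "quot_lift N f (wdg vs) = f vs"
  unfolding wedge_def assms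
  by (subst quot_lift_cls[OF N multilinear_closed[OF f, unfolded listset_vec] ext_rels_supported ext_kill])
    (use assms multilinear_closed[OF f, unfolded listset_vec] in
      \<open>auto intro!: free_lift_gen[OF N, of "{vs. length vs = i}" f]\<close>)

end

section \<open>Symmetric powers\<close>

lemma sym_rels_supported: "sym_rels scale t \<subseteq> supported {vs. length vs = t}"
  using multilinear_rels_supported[OF vsp_replicate, of t] unfolding listset_vec sym_rels_def
  by (auto dest: mset_eq_length intro!: supported_diff)

lemma vsp_sym_power: "vsp (Sym t)"
  unfolding sym_power_def by (rule vsp_presented)

lemma sym_prod_multilinear: "multilinear (replicate t V) (Sym t) sprod"
proof -
  have "multilinear (replicate t V) (Sym t) (\<lambda>vs. cls (sym_rels scale t) (gen vs))"
    unfolding sym_power_def by (rule presented_multilinear[OF vsp_replicate]) (auto simp: sym_rels_def listset_vec)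
  then show ?thesis
    unfolding multilinear_def listset_vec by (simp add: sym_prod_def)
qed

lemma sym_prod_perm: "mset vs = mset ws \<Longrightarrow> sprod vs = sprod ws"
  using mset_eq_length[of vs ws]
  by (auto simp: sym_prod_def cls_eq_iff sym_rels_def intro!: free.span_base)

lemma sym_generators: "x \<in> carrier (Sym t) \<Longrightarrow> x \<in> lspan (Sym t) (sprod ` {vs. length vs = t})"
  using presented_generators[of x "{vs. length vs = t}" "sym_rels scale t"]
  by (simp add: sym_power_def sym_prod_def cong: image_cong_simp)

context
  fixes N :: "('k, 'b) module" and t f
  assumes N: "vsp N" and f: "multilinear (replicate t V) N f"
    and perm: "\<And>vs ws. length vs = t \<Longrightarrow> mset vs = mset ws \<Longrightarrow> f vs = f ws"
begin

lemma sym_kill: "r \<in> sym_rels scale t \<Longrightarrow> free_lift N f r = \<zero>\<^bsub>N\<^esub>"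
proof -
  note fc = multilinear_closed[OF f, unfolded listset_vec]
  assume "r \<in> sym_rels scale t"
  then consider "r \<in> multilinear_rels (replicate t V)"
    | vs ws where "r = gen vs - gen ws" "length vs = t" "mset vs = mset ws"
    by (auto simp: sym_rels_def)
  then show ?thesis
  proof cases
    case (2 vs ws)
    then have "length ws = t" using mset_eq_length by metis
    with 2 have "free_lift N f r = f vs \<oplus>\<^bsub>N\<^esub> (- 1) \<odot>\<^bsub>N\<^esub> f ws"
      using free_lift_diff[OF N, of "{vs. length vs = t}" f "gen vs" "gen ws"]
        free_lift_gen[OF N, of "{vs. length vs = t}" f] fc by simp
    also have "f ws = f vs" using perm 2 by simp
    finally show ?thesis using vsp_minus_self[OF N fc] 2 by simp
  qed (rule multilinear_kill[OF vsp_replicate N f])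
qed

lemma sym_lift_lin: "quot_lift N f \<in> lin (Sym t) N"
  unfolding sym_power_def
  by (rule quot_lift_lin[OF N multilinear_closed[OF f, unfolded listset_vec] sym_rels_supported sym_kill])

lemma sym_lift_prod:
  assumes "length vs = t"
  shows "quot_lift N f (sprod vs) = f vs"
  unfolding sym_prod_def assms
  by (subst quot_lift_cls[OF N multilinear_closed[OF f, unfolded listset_vec] sym_rels_supported sym_kill])
    (use assms multilinear_closed[OF f, unfolded listset_vec] in
      \<open>auto intro!: free_lift_gen[OF N, of "{vs. length vs = t}" f]\<close>)

end

section \<open>Lifting along the coproduct\<close>

text \<open>By induction on the part of the word in front of the slot, where \<open>\<Phi>\<close> varies as
  in \<open>free_lift_unshuffle_Cons\<close>. Together with \<open>unshuffle_adjacent\<close> it shows that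
  the coproduct is well defined on exterior powers.\<close>

lemma unshuffle_slot_lin:
  assumes N: "vsp N"
    and cl: "\<And>A B :: 'v list. length A + length B = K \<Longrightarrow> \<Phi> (A, B) \<in> carrier N"
    and l: "\<And>pre post B. length pre + length post + length B + 1 = K \<Longrightarrow> (\<lambda>x. \<Phi> (pre @ x # post, B)) \<in> lin V N"
    and r: "\<And>A pre post. length A + length pre + length post + 1 = K \<Longrightarrow> (\<lambda>x. \<Phi> (A, pre @ x # post)) \<in> lin V N"
    and K: "length pre + length post + 1 = K"
  shows "(\<lambda>x. free_lift N \<Phi> (unshuffle (pre @ x # post))) \<in> lin V N"
  using cl l r K
proof (induct pre arbitrary: \<Phi> K)
    case (Nil \<Phi> K)
    have "(\<lambda>x. \<Phi> (x # A, B) \<oplus>\<^bsub>N\<^esub> (-1) ^ length A \<odot>\<^bsub>N\<^esub> \<Phi> (A, x # B)) \<in> lin V N"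
      if "length A + length B = length post" for A B
      using Nil(2)[of "[]" A B] Nil(3)[of A "[]" B] Nil(4) that by (intro lin_plus lin_scaled N) auto
    then have "(\<lambda>x. free_lift N (\<lambda>(A, B). \<Phi> (x # A, B) \<oplus>\<^bsub>N\<^esub> (-1) ^ length A \<odot>\<^bsub>N\<^esub> \<Phi> (A, x # B)) (unshuffle post)) \<in> lin V N"
      unfolding free_lift_def
      by (intro lin_finsum_fun vsp_V N lin_scaled) (use unshuffle_length[of post] in \<open>force simp: supported_def split_def\<close>)
    then show ?case
      by (rule lin_cong[OF vsp_V]) (use Nil in \<open>auto intro!: free_lift_unshuffle_Cons N simp del: unshuffle.simps\<close>)
  next
    case (Cons v pre \<Phi> K)
    let ?\<Phi> = "\<lambda>(A, B). \<Phi> (v # A, B) \<oplus>\<^bsub>N\<^esub> (-1) ^ length A \<odot>\<^bsub>N\<^esub> \<Phi> (A, v # B)"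
    have "(\<lambda>x. free_lift N ?\<Phi> (unshuffle (pre @ x # post))) \<in> lin V N"
    proof (rule Cons(1)[of "length pre + length post + 1"])
      fix A B :: "'v list" assume "length A + length B = length pre + length post + 1"
      then show "?\<Phi> (A, B) \<in> carrier N" using Cons(5) by (auto intro!: vsp_closed[OF N] Cons(2))
    next
      fix pre' post' B :: "'v list" assume l: "length pre' + length post' + length B + 1 = length pre + length post + 1"
      have "(\<lambda>x. \<Phi> (v # pre' @ x # post', B)) \<in> lin V N" "(\<lambda>x. \<Phi> (pre' @ x # post', v # B)) \<in> lin V N"
        using Cons(3)[of "v # pre'" post' B] Cons(3)[of pre' post' "v # B"] l Cons(5) by auto
      then show "(\<lambda>x. ?\<Phi> (pre' @ x # post', B)) \<in> lin V N"
        using lin_plus[OF N _ lin_scaled[OF N]] by auto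
    next
      fix A pre' post' :: "'v list" assume l: "length A + length pre' + length post' + 1 = length pre + length post + 1"
      have "(\<lambda>x. \<Phi> (v # A, pre' @ x # post')) \<in> lin V N" "(\<lambda>x. \<Phi> (A, v # pre' @ x # post')) \<in> lin V N"
        using Cons(4)[of "v # A" pre' post'] Cons(4)[of A "v # pre'" post'] l Cons(5) by auto
      then show "(\<lambda>x. ?\<Phi> (A, pre' @ x # post')) \<in> lin V N"
        using lin_plus[OF N _ lin_scaled[OF N]] by auto
    qed simp
    then show ?case
      by (rule lin_cong[OF vsp_V]) (use Cons(2,5) in \<open>auto intro!: free_lift_unshuffle_Cons N simp del: unshuffle.simps\<close>)
qed

text \<open>The coproduct respects the alternating relations. If the two equal neighbours go to the same part,
  \<open>\<Phi>\<close> vanishes by assumption; if they go to different parts, the two possibilities differ by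
  a sign.\<close>

lemma unshuffle_adjacent:
  assumes N: "vsp N"
    and cl: "\<And>A B :: 'v list. length A + length B = K \<Longrightarrow> \<Phi> (A, B) \<in> carrier N"
    and l: "\<And>pre x post B. length pre + length post + length B + 2 = K \<Longrightarrow> \<Phi> (pre @ x # x # post, B) = \<zero>\<^bsub>N\<^esub>"
    and r: "\<And>A pre x post. length A + length pre + length post + 2 = K \<Longrightarrow> \<Phi> (A, pre @ x # x # post) = \<zero>\<^bsub>N\<^esub>"
    and K: "length pre + length post + 2 = K"
  shows "free_lift N \<Phi> (unshuffle (pre @ x # x # post)) = \<zero>\<^bsub>N\<^esub>"
  using cl l r K
proof (induct pre arbitrary: \<Phi> K)
  case (Nil \<Phi> K)
  let ?\<Phi> = "\<lambda>(A, B). \<Phi> (x # A, B) \<oplus>\<^bsub>N\<^esub> (-1) ^ length A \<odot>\<^bsub>N\<^esub> \<Phi> (A, x # B)"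
  have c: "?\<Phi> (A, B) \<in> carrier N" if "length A + length B = Suc (length post)" for A B :: "'v list"
    using that Nil(4) by (auto intro!: vsp_closed[OF N] Nil(1))
  have "free_lift N \<Phi> (unshuffle (x # x # post)) = free_lift N ?\<Phi> (unshuffle (x # post))"
    using Nil by (intro free_lift_unshuffle_Cons N) auto
  also have "\<dots> = free_lift N (\<lambda>(A, B). ?\<Phi> (x # A, B) \<oplus>\<^bsub>N\<^esub> (-1) ^ length A \<odot>\<^bsub>N\<^esub> ?\<Phi> (A, x # B)) (unshuffle post)"
    by (intro free_lift_unshuffle_Cons N c)
  also have "\<dots> = free_lift N (\<lambda>_. \<zero>\<^bsub>N\<^esub>) (unshuffle post)"
  proof (rule free_lift_cong[OF N _ unshuffle_length])
    fix AB :: "'v list \<times> 'v list" assume "AB \<in> {(A, B). length A + length B = length post}"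
    then obtain A B :: "'v list" where AB: "AB = (A, B)" "length A + length B = length post" by auto
    \<comment> \<open>the common value, up to sign, of the two terms that separate the equal letters\<close>
    let ?y = "(-1) ^ length A \<odot>\<^bsub>N\<^esub> \<Phi> (x # A, x # B)"
    have y: "\<Phi> (x # A, x # B) \<in> carrier N" "?y \<in> carrier N" using AB Nil(4) by (auto intro!: vsp_closed[OF N] Nil(1))
    have "\<Phi> (x # x # A, B) = \<zero>\<^bsub>N\<^esub>" "\<Phi> (A, x # x # B) = \<zero>\<^bsub>N\<^esub>"
      using Nil(2)[of "[]" A B x] Nil(3)[of A "[]" B x] AB Nil(4) by auto
    then have "?\<Phi> (x # A, B) \<oplus>\<^bsub>N\<^esub> (-1) ^ length A \<odot>\<^bsub>N\<^esub> ?\<Phi> (A, x # B) = (- 1) \<odot>\<^bsub>N\<^esub> ?y \<oplus>\<^bsub>N\<^esub> ?y"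
      using y by (simp add: vsp_l_zero[OF N] vsp_r_zero[OF N] vsp_smult_zero[OF N] vsp_closed[OF N] flip: vsp_smult_assoc[OF N])
    also have "\<dots> = \<zero>\<^bsub>N\<^esub>"
      using vsp_minus_self[OF N y(2)] vsp_comm[OF N y(2) vsp_smult_closed[OF N y(2)]] by simp
    finally show "(case AB of (A, B) \<Rightarrow> ?\<Phi> (x # A, B) \<oplus>\<^bsub>N\<^esub> (-1) ^ length A \<odot>\<^bsub>N\<^esub> ?\<Phi> (A, x # B)) = \<zero>\<^bsub>N\<^esub>"
      by (simp only: AB prod.case)
  qed (rule vsp_zero_closed[OF N])
  also have "\<dots> = \<zero>\<^bsub>N\<^esub>"
    unfolding free_lift_def by (rule vsp_finsum_zero[OF N]) (simp add: vsp_smult_zero[OF N])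
  finally show ?case by (simp only: append_Nil)
next
  case (Cons v pre \<Phi> K)
  let ?\<Phi> = "\<lambda>(A, B). \<Phi> (v # A, B) \<oplus>\<^bsub>N\<^esub> (-1) ^ length A \<odot>\<^bsub>N\<^esub> \<Phi> (A, v # B)"
  have "free_lift N ?\<Phi> (unshuffle (pre @ x # x # post)) = \<zero>\<^bsub>N\<^esub>"
  proof (rule Cons(1)[of "length pre + length post + 2"])
    fix A B :: "'v list" assume "length A + length B = length pre + length post + 2"
    then show "?\<Phi> (A, B) \<in> carrier N" using Cons(5) by (auto intro!: vsp_closed[OF N] Cons(2))
  next
    fix pre' post' B :: "'v list" and y assume l: "length pre' + length post' + length B + 2 = length pre + length post + 2"
    have "\<Phi> (v # pre' @ y # y # post', B) = \<zero>\<^bsub>N\<^esub>" "\<Phi> (pre' @ y # y # post', v # B) = \<zero>\<^bsub>N\<^esub>"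
      using Cons(3)[of "v # pre'" post' B] Cons(3)[of pre' post' "v # B"] l Cons(5) by auto
    then show "?\<Phi> (pre' @ y # y # post', B) = \<zero>\<^bsub>N\<^esub>"
      by (simp add: vsp_smult_zero[OF N] vsp_l_zero[OF N] vsp_zero_closed[OF N])
  next
    fix A pre' post' :: "'v list" and y assume l: "length A + length pre' + length post' + 2 = length pre + length post + 2"
    have "\<Phi> (v # A, pre' @ y # y # post') = \<zero>\<^bsub>N\<^esub>" "\<Phi> (A, v # pre' @ y # y # post') = \<zero>\<^bsub>N\<^esub>"
      using Cons(4)[of "v # A" pre' post'] Cons(4)[of A "v # pre'" post'] l Cons(5) by auto
    then show "?\<Phi> (A, pre' @ y # y # post') = \<zero>\<^bsub>N\<^esub>"
      by (simp add: vsp_smult_zero[OF N] vsp_l_zero[OF N] vsp_zero_closed[OF N])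
  qed simp
  moreover have "free_lift N \<Phi> (unshuffle (v # pre @ x # x # post)) = free_lift N ?\<Phi> (unshuffle (pre @ x # x # post))"
    using Cons(2,5) by (intro free_lift_unshuffle_Cons N) auto
  ultimately show ?case by (simp only: append_Cons)
qed

section \<open>Generators of the terms of the complex\<close>

text \<open>The lists of blocks of vectors whose wedges make up $T_t^p$. The bound on the lengths mirrors the
  condition on the degrees in \<open>comps\<close>.\<close>

definition blockwords :: "nat \<Rightarrow> nat \<Rightarrow> 'v list list set" where
  "blockwords t p = {vss. length vss = p \<and> length (concat vss) = t \<and> (\<forall>b\<in>set vss. b \<noteq> [] \<and> length b \<le> dimV)}"

lemma blockwords_comps: "vss \<in> blockwords t p \<longleftrightarrow> map length vss \<in> comps dimV t p"
  by (auto simp: blockwords_def comps_def length_concat Suc_le_eq)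

lemma rcobar_blockwords: "vss \<in> blockwords t p \<Longrightarrow> rcobar vss \<in> supported (blockwords t (Suc p))"
  using rcobar_blocks[of vss dimV] by (auto simp: blockwords_def elim!: supported_mono)

text \<open>The tensor of the wedges of the blocks, placed in its direct summand of $T_t^p$.\<close>

definition btensor :: "nat \<Rightarrow> nat \<Rightarrow> 'v list list \<Rightarrow> (nat list \<Rightarrow> (('v list \<Rightarrow>\<^sub>0 'k) set list \<Rightarrow>\<^sub>0 'k) set)" where
  "btensor t p vss = T_in scale t p (map length vss) (epure (map length vss) (map wdg vss))"

abbreviation btensor_lin :: "nat \<Rightarrow> nat \<Rightarrow> ('v list list \<Rightarrow>\<^sub>0 'k) \<Rightarrow> (nat list \<Rightarrow> (('v list \<Rightarrow>\<^sub>0 'k) set list \<Rightarrow>\<^sub>0 'k) set)" where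
  "btensor_lin t p \<equiv> free_lift (T t p) (btensor t p)"

lemma vsp_ext_powers: "\<forall>M\<in>set (map \<Lambda> c). vsp M"
  by (auto simp: vsp_ext_power)

lemma vsp_ext_tensor: "vsp (\<Lambda>s c)"
  unfolding ext_tensor_def by (rule vsp_tensor[OF vsp_ext_powers])

lemma vsp_T: "vsp (T t p)"
  unfolding T_space_def by (rule vsp_dsum) (auto simp: vsp_ext_tensor finite_comps)

lemma ext_pure_multilinear: "multilinear (map \<Lambda> c) (\<Lambda>s c) (epure c)"
  unfolding ext_tensor_def ext_pure_def[abs_def] by (rule pure_tensor_multilinear[OF vsp_ext_powers])

abbreviation ext_lists :: "nat list \<Rightarrow> ('v list \<Rightarrow>\<^sub>0 'k) set list set" where
  "ext_lists c \<equiv> listset (map carrier (map \<Lambda> c))"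

lemma wedges_mem: "map wdg vss \<in> ext_lists (map length vss)"
  unfolding mem_listset_carrier by (auto intro: wedge_closed)

lemma ext_pure_closed: "\<alpha>s \<in> ext_lists c \<Longrightarrow> epure c \<alpha>s \<in> carrier (\<Lambda>s c)"
  by (rule multilinear_closed[OF ext_pure_multilinear])

lemma T_in_lin: "c \<in> comps dimV t p \<Longrightarrow> T_in scale t p c \<in> lin (\<Lambda>s c) (T t p)"
  unfolding T_in_def T_space_def by (rule dsum_in_lin) (auto simp: vsp_ext_tensor finite_comps)

lemma btensor_closed: "vss \<in> blockwords t p \<Longrightarrow> btensor t p vss \<in> carrier (T t p)"
  unfolding btensor_def by (intro lin_closed[OF T_in_lin] ext_pure_closed wedges_mem) (simp add: blockwords_comps)

text \<open>The set \<open>W\<close> of words is a parameter, because the statement is used both for all words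
  of vectors and for increasing words of basis vectors.\<close>

lemma ext_tensor_generators:
  assumes W: "\<And>i a. a \<in> carrier (\<Lambda> i) \<Longrightarrow> a \<in> lspan (\<Lambda> i) (wdg ` {vs \<in> W. length vs = i})"
    and x: "x \<in> carrier (\<Lambda>s c)"
  shows "x \<in> lspan (\<Lambda>s c) ((\<lambda>vss. epure c (map wdg vss)) ` {vss. map length vss = c \<and> set vss \<subseteq> W})"
    (is "_ \<in> lspan _ (?e ` ?S)")
proof (rule lspan_trans)
  let ?Ms = "map \<Lambda> c" and ?G = "\<lambda>j. wdg ` {vs \<in> W. length vs = c ! j}"
  show "x \<in> lspan (\<Lambda>s c) (epure c ` ext_lists c)"
    using tensor_generators[OF vsp_ext_powers] x by (simp add: ext_tensor_def ext_pure_def[abs_def])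
  show "epure c ` ext_lists c \<subseteq> lspan (\<Lambda>s c) (?e ` ?S)"
  proof (rule image_subsetI)
    fix \<alpha>s assume "\<alpha>s \<in> ext_lists c"
    then have "epure c \<alpha>s \<in> lspan (\<Lambda>s c)
      (epure c ` {gs. length gs = length ?Ms \<and> (\<forall>j<length ?Ms. gs ! j \<in> ?G j)})"
      by (intro multilinear_lspan[OF vsp_ext_powers vsp_ext_tensor ext_pure_multilinear])
        (auto intro: wedge_closed dest: W)
    moreover have "{gs. length gs = length ?Ms \<and> (\<forall>j<length ?Ms. gs ! j \<in> ?G j)} \<subseteq> map wdg ` ?S"
    proof clarify
      fix gs assume l: "length gs = length ?Ms" and "\<forall>j<length ?Ms. gs ! j \<in> ?G j"
      then have "\<forall>j<length c. \<exists>vs\<in>W. length vs = c ! j \<and> gs ! j = wdg vs" by auto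
      then obtain f where f: "\<And>j. j < length c \<Longrightarrow> f j \<in> W \<and> length (f j) = c ! j \<and> gs ! j = wdg (f j)" by metis
      show "gs \<in> map wdg ` ?S"
        by (rule image_eqI[of _ _ "map f [0..<length c]"]) (use f l in \<open>auto intro!: nth_equalityI\<close>)
    qed
    ultimately show "epure c \<alpha>s \<in> lspan (\<Lambda>s c) (?e ` ?S)"
      by (elim lspan_trans) (auto intro!: lspan_base)
  qed
qed

lemma T_generators_of:
  assumes W: "\<And>i a. a \<in> carrier (\<Lambda> i) \<Longrightarrow> a \<in> lspan (\<Lambda> i) (wdg ` {vs \<in> W. length vs = i})"
    and x: "x \<in> carrier (T t p)"
  shows "x \<in> lspan (T t p) (btensor t p ` {vss \<in> blockwords t p. set vss \<subseteq> W})"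
proof -
  let ?G = "\<lambda>c. (\<lambda>vss. epure c (map wdg vss)) ` {vss. map length vss = c \<and> set vss \<subseteq> W}"
  have "x \<in> lspan (T t p) (\<Union>c\<in>comps dimV t p. dsum_in (comps dimV t p) \<Lambda>s c ` ?G c)"
    using x unfolding T_space_def
    by (intro dsum_generators) (auto simp: vsp_ext_tensor finite_comps ext_tensor_generators[OF W]
        intro!: ext_pure_closed wedges_mem[of _, simplified])
  then show ?thesis
    by (rule lspan_trans) (auto simp: blockwords_comps btensor_def T_in_def intro!: lspan_base)
qed

lemma T_generators: "x \<in> carrier (T t p) \<Longrightarrow> x \<in> lspan (T t p) (btensor t p ` blockwords t p)"
  using T_generators_of[of UNIV x t p] wedge_generators by simp

lemma btensor_subset: "btensor t p ` blockwords t p \<subseteq> carrier (T t p)"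
  using btensor_closed by auto

lemma T_lin_eq:
  assumes "vsp N" "f \<in> lin (T t p) N" "h \<in> lin (T t p) N" "\<And>vss. vss \<in> blockwords t p \<Longrightarrow> f (btensor t p vss) = h (btensor t p vss)"
    and "x \<in> carrier (T t p)"
  shows "f x = h x"
  by (rule lin_eq_on_lspan[OF vsp_T assms(1-3) btensor_subset T_generators[OF assms(5)]]) (use assms(4) in auto)

lemma btensor_lin_surj: "x \<in> carrier (T t p) \<Longrightarrow> \<exists>u\<in>supported (blockwords t p). x = btensor_lin t p u"
  by (rule lspan_free_lift[OF vsp_T btensor_closed]) (auto dest: T_generators)

lemma btensor_lin_closed: "u \<in> supported (blockwords t p) \<Longrightarrow> btensor_lin t p u \<in> carrier (T t p)"
  by (rule free_lift_closed[OF vsp_T btensor_closed])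

text \<open>Composing with the wedge map gives \<open>btensor_slot_vector\<close>, and evaluating at zero
  gives \<open>btensor_slot_adjacent\<close>.\<close>

lemma btensor_slot:
  assumes "pre @ b # post \<in> blockwords t p"
  shows "(\<lambda>\<alpha>. T_in scale t p (map length (pre @ b # post)) (epure (map length (pre @ b # post))
      (map wdg pre @ \<alpha> # map wdg post))) \<in> lin (\<Lambda> (length b)) (T t p)"
proof -
  let ?c = "map length (pre @ b # post)"
  have "(\<lambda>\<alpha>. epure ?c (map wdg pre @ \<alpha> # map wdg post)) \<in> lin (\<Lambda> (length b)) (\<Lambda>s ?c)"
    using multilinear_lin[OF ext_pure_multilinear wedges_mem, of "length pre" "pre @ b # post"]
    by (simp add: nth_append list_update_append)
  then show ?thesis using assms unfolding blockwords_comps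
    by (rule lin_comp[OF _ T_in_lin])
qed

lemma btensor_slot_vector:
  assumes "pre @ (a @ 0 # b) # post \<in> blockwords t p"
  shows "(\<lambda>x. btensor t p (pre @ (a @ x # b) # post)) \<in> lin V (T t p)"
proof -
  have "(\<lambda>x. wdg (a @ x # b)) \<in> lin V (\<Lambda> (length (a @ 0 # b)))"
    using multilinear_vecD[OF wedge_multilinear, of a b] by simp
  from lin_comp[OF this btensor_slot[OF assms]] show ?thesis by (simp add: btensor_def)
qed

lemma btensor_slot_adjacent:
  assumes "pre @ (a @ x # x # b) # post \<in> blockwords t p"
  shows "btensor t p (pre @ (a @ x # x # b) # post) = \<zero>\<^bsub>T t p\<^esub>"
  using lin_zero[OF vsp_ext_power vsp_T btensor_slot[OF assms]]
    wedge_not_distinct[of "a @ x # x # b" "length (a @ x # x # b)"]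
  by (simp add: btensor_def)

section \<open>The differential on generators\<close>

text \<open>The sum over pairs of sets of positions is the lift of the coproduct along a functional that
  vanishes on pairs with an empty part.\<close>

lemma ext_delta_summands:
  assumes i: "i \<le> dimV" and vs: "length vs = i"
  shows "finsum (T i 2) (\<lambda>(A, B). shuffle_sign A B \<odot>\<^bsub>T i 2\<^esub> T_in scale i 2 [card A, card B]
      (epure [card A, card B] [wdg (nths vs A), wdg (nths vs B)]))
      {(A, B). A \<noteq> {} \<and> B \<noteq> {} \<and> A \<inter> B = {} \<and> A \<union> B = {..<i}}
    = free_lift (T i 2) (\<lambda>(A, B). if A = [] \<or> B = [] then \<zero>\<^bsub>T i 2\<^esub> else btensor i 2 [A, B]) (unshuffle vs)"
    (is "finsum _ ?f ?S = free_lift _ ?\<Phi> _")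
proof -
  note N = vsp_T[of i 2]
  define X where "X = {(A :: 'v list, B :: 'v list). length A + length B = i}"
  have \<Phi>: "?\<Phi> x \<in> carrier (T i 2)" if "x \<in> X" for x
    using that i by (auto simp: X_def blockwords_def vsp_zero_closed[OF N] intro!: btensor_closed split: prod.split)
  have sp: "(nths vs A, nths vs B) \<in> X" "length (nths vs A) = card A" "length (nths vs B) = card B" "finite A" "finite B"
    if "(A, B) \<in> splits i" for A B
  proof -
    have AB: "A \<subseteq> {..<length vs}" "B \<subseteq> {..<length vs}" "A \<inter> B = {}" "A \<union> B = {..<length vs}"
      using that vs by (auto simp: splits_def)
    then show f: "finite A" "finite B" by (auto intro: finite_subset)
    show l: "length (nths vs A) = card A" "length (nths vs B) = card B" using AB by (auto simp: length_nths_subset)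
    show "(nths vs A, nths vs B) \<in> X"
      using card_Un_disjoint[OF f AB(3)] AB(4) vs by (simp add: X_def l)
  qed
  let ?F = "\<lambda>(A, B). shuffle_sign A B \<odot>\<^bsub>T i 2\<^esub> ?\<Phi> (nths vs A, nths vs B)"
  have F: "?F AB \<in> carrier (T i 2)" if "AB \<in> splits i" for AB
    using that vsp_smult_closed[OF N \<Phi>[OF sp(1)]] by (cases AB) (simp only: prod.case)
  have nil: "nths vs A = [] \<longleftrightarrow> A = {}" "nths vs B = [] \<longleftrightarrow> B = {}" if "(A, B) \<in> splits i" for A B
    using sp[OF that] by (metis card_eq_0_iff length_0_conv)+
  have S: "?S \<subseteq> splits i" by (auto simp: splits_def)
  have "free_lift (T i 2) ?\<Phi> (unshuffle vs) = finsum (T i 2) (\<lambda>x. free_lift (T i 2) ?\<Phi>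
      (case x of (A, B) \<Rightarrow> free_scale (shuffle_sign A B) (gen (nths vs A, nths vs B)))) (splits i)"
    unfolding unshuffle_sum vs
    by (rule free_lift_sum[where X = X, OF N \<Phi>]) (auto simp: finite_splits sp intro!: supported_scale)
  also have "\<dots> = finsum (T i 2) ?F (splits i)"
  proof (rule vsp_finsum_cong[OF N])
    fix AB assume AB: "AB \<in> splits i"
    obtain A B where [simp]: "AB = (A, B)" by (cases AB)
    show "free_lift (T i 2) ?\<Phi> (case AB of (A, B) \<Rightarrow> free_scale (shuffle_sign A B) (gen (nths vs A, nths vs B))) = ?F AB"
      using sp(1)[of A B] AB
      by (simp only: \<open>AB = (A, B)\<close> prod.case free_lift_scale[where X = X and f = ?\<Phi>, OF N \<Phi>]
          free_lift_gen[where X = X and f = ?\<Phi>, OF N \<Phi>] supported_gen)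
  qed (use F in blast)
  also have "\<dots> = finsum (T i 2) ?F ?S"
  proof (rule vsp_finsum_mono_neutral[OF N finite_splits S, symmetric])
    fix AB assume AB: "AB \<in> splits i - ?S"
    obtain A B where [simp]: "AB = (A, B)" by (cases AB)
    have "A = {} \<or> B = {}" using AB by (auto simp: splits_def)
    then show "?F AB = \<zero>\<^bsub>T i 2\<^esub>" using AB nil[of A B] by (auto simp: vsp_smult_zero[OF N])
  qed (use F in blast)
  also have "\<dots> = finsum (T i 2) ?f ?S"
  proof (rule vsp_finsum_cong[OF N, symmetric])
    fix AB assume AB: "AB \<in> ?S"
    obtain A B where [simp]: "AB = (A, B)" by (cases AB)
    have "(A, B) \<in> splits i" "A \<noteq> {}" "B \<noteq> {}" using AB S by auto
    then show "?f AB = ?F AB" using nil[of A B] sp(2,3)[of A B] by (simp add: btensor_def)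
  qed (use F S in blast)
  finally show ?thesis ..
qed

context
  fixes i :: nat
  assumes i: "i \<le> dimV"
begin

private definition \<Phi> where
  "\<Phi> = (\<lambda>(A, B). if A = [] \<or> B = [] then \<zero>\<^bsub>T i 2\<^esub> else btensor i 2 [A, B])"

private lemma \<Phi>_closed: "length A + length B = i \<Longrightarrow> \<Phi> (A, B) \<in> carrier (T i 2)"
  using i by (auto simp: \<Phi>_def blockwords_def vsp_zero_closed[OF vsp_T] intro!: btensor_closed)

private lemma \<Phi>_slot:
  shows "length pre + length post + length B + 1 = i \<Longrightarrow> (\<lambda>x. \<Phi> (pre @ x # post, B)) \<in> lin V (T i 2)"
    and "length A + length pre + length post + 1 = i \<Longrightarrow> (\<lambda>x. \<Phi> (A, pre @ x # post)) \<in> lin V (T i 2)"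
proof -
  assume l: "length pre + length post + length B + 1 = i"
  show "(\<lambda>x. \<Phi> (pre @ x # post, B)) \<in> lin V (T i 2)"
    using l i btensor_slot_vector[of "[]" pre post "[B]" i 2]
    by (cases "B = []") (auto simp: \<Phi>_def blockwords_def lin_const_zero[OF vsp_T])
next
  assume l: "length A + length pre + length post + 1 = i"
  show "(\<lambda>x. \<Phi> (A, pre @ x # post)) \<in> lin V (T i 2)"
    using l i btensor_slot_vector[of "[A]" pre post "[]" i 2]
    by (cases "A = []") (auto simp: \<Phi>_def blockwords_def lin_const_zero[OF vsp_T])
qed

private lemma \<Phi>_adjacent:
  "length pre + length post + length B + 2 = i \<Longrightarrow> \<Phi> (pre @ x # x # post, B) = \<zero>\<^bsub>T i 2\<^esub>"
  "length A + length pre + length post + 2 = i \<Longrightarrow> \<Phi> (A, pre @ x # x # post) = \<zero>\<^bsub>T i 2\<^esub>"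
  using i btensor_slot_adjacent[of "[]" pre x post "[B]" i 2] btensor_slot_adjacent[of "[A]" pre x post "[]" i 2]
  by (auto simp: \<Phi>_def blockwords_def)

private abbreviation split_sum where
  "split_sum vs \<equiv> finsum (T i 2) (\<lambda>(A, B). shuffle_sign A B \<odot>\<^bsub>T i 2\<^esub> T_in scale i 2 [card A, card B]
      (epure [card A, card B] [wdg (nths vs A), wdg (nths vs B)]))
      {(A, B). A \<noteq> {} \<and> B \<noteq> {} \<and> A \<inter> B = {} \<and> A \<union> B = {..<i}}"

private lemma split_sum: "length vs = i \<Longrightarrow> split_sum vs = free_lift (T i 2) \<Phi> (unshuffle vs)"
  using ext_delta_summands[OF i] by (simp add: \<Phi>_def)

private lemma \<Phi>_rcobar:
  assumes "length vs = i"
  shows "free_lift (T i 2) \<Phi> (unshuffle vs) = btensor_lin i 2 (rcobar [vs])"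
proof -
  let ?g = "\<lambda>(A, B). if A = [] \<or> B = [] then 0 else gen [A, B] :: 'v list list \<Rightarrow>\<^sub>0 'k"
  have *: "[A, B] \<in> blockwords i 2" if "length A + length B = i" "A \<noteq> []" "B \<noteq> []" for A B :: "'v list"
    using that i by (simp add: blockwords_def)
  have "btensor_lin i 2 (rcobar [vs]) = free_lift (T i 2) (\<lambda>x. btensor_lin i 2 (?g x)) (unshuffle vs)"
    unfolding rcobar_single
    by (rule free_lift_free_ext[OF vsp_T btensor_closed _ unshuffle_length]) (use assms * in auto)
  also have "\<dots> = free_lift (T i 2) \<Phi> (unshuffle vs)"
    by (rule free_lift_cong[OF vsp_T _ unshuffle_length])
      (use assms * in \<open>auto simp: \<Phi>_def free_lift_0[OF vsp_T] vsp_zero_closed[OF vsp_T] btensor_closed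
        intro!: free_lift_gen[OF vsp_T btensor_closed]\<close>)
  finally show ?thesis ..
qed

private lemma split_sum_multilinear: "multilinear (replicate i V) (T i 2) split_sum"
proof (rule multilinear_cong[OF vsp_replicate])
  show "multilinear (replicate i V) (T i 2) (\<lambda>vs. free_lift (T i 2) \<Phi> (unshuffle vs))"
  proof (rule multilinear_vecI)
    fix pre post :: "'v list" and x assume l: "length pre + length post + 1 = i"
    show lin: "(\<lambda>x. free_lift (T i 2) \<Phi> (unshuffle (pre @ x # post))) \<in> lin V (T i 2)"
      by (rule unshuffle_slot_lin[OF vsp_T \<Phi>_closed \<Phi>_slot l])
    show "free_lift (T i 2) \<Phi> (unshuffle (pre @ x # post)) \<in> carrier (T i 2)"
      using lin_closed[OF lin, of x] by simp
  next
    assume "i = 0"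
    then show "free_lift (T i 2) \<Phi> (unshuffle []) \<in> carrier (T i 2)"
      using \<Phi>_closed[of "[]" "[]"] by (auto intro!: free_lift_closed[OF vsp_T, of "{([], [])}"])
  qed
qed (use split_sum in simp)

private lemma split_sum_adjacent: "length pre + length post + 2 = i \<Longrightarrow> split_sum (pre @ x # x # post) = \<zero>\<^bsub>T i 2\<^esub>"
  using unshuffle_adjacent[where \<Phi> = \<Phi> and K = i, OF vsp_T \<Phi>_closed \<Phi>_adjacent, of pre post x] split_sum[of "pre @ x # x # post"] by simp

lemma ext_delta_lin: "ext_delta scale i \<in> lin (\<Lambda> i) (T i 2)"
  unfolding ext_delta_def by (rule ext_lift_lin[OF vsp_T split_sum_multilinear split_sum_adjacent])

lemma ext_delta_wedge: "length vs = i \<Longrightarrow> ext_delta scale i (wdg vs) = btensor_lin i 2 (rcobar [vs])"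
  unfolding ext_delta_def
  by (subst ext_lift_wedge[OF vsp_T split_sum_multilinear split_sum_adjacent]) (auto simp: split_sum \<Phi>_rcobar)

end

text \<open>The linear map $\beta \otimes \gamma \mapsto \alpha_1 \otimes \dots \otimes \beta \otimes \gamma
  \otimes \dots \otimes \alpha_p$ by which a component of $\delta(\alpha_{j+1})$ enters the differential. Here
  \<open>d\<close> is the list of the two degrees of $\beta$ and $\gamma$.\<close>

definition insert_pair :: "nat list \<Rightarrow> nat \<Rightarrow> nat list \<Rightarrow> ('v list \<Rightarrow>\<^sub>0 'k) set list
    \<Rightarrow> (('v list \<Rightarrow>\<^sub>0 'k) set list \<Rightarrow>\<^sub>0 'k) set \<Rightarrow> (('v list \<Rightarrow>\<^sub>0 'k) set list \<Rightarrow>\<^sub>0 'k) set" where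
  "insert_pair c j d \<alpha>s = quot_lift (\<Lambda>s (take j c @ d @ drop (j + 1) c))
     (\<lambda>\<beta>s. epure (take j c @ d @ drop (j + 1) c) (take j \<alpha>s @ \<beta>s @ drop (j + 1) \<alpha>s))"

lemma ext_lists_iff: "\<alpha>s \<in> ext_lists c \<longleftrightarrow> length \<alpha>s = length c \<and> (\<forall>i<length c. \<alpha>s ! i \<in> carrier (\<Lambda> (c ! i)))"
  unfolding mem_listset_carrier by auto

lemma ext_pure_middle:
  assumes "\<alpha>s \<in> ext_lists c" "j < length c"
  shows "multilinear (map \<Lambda> d) (\<Lambda>s (take j c @ d @ drop (j + 1) c))
    (\<lambda>\<beta>s. epure (take j c @ d @ drop (j + 1) c) (take j \<alpha>s @ \<beta>s @ drop (j + 1) \<alpha>s))"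
proof (rule multilinear_middle)
  show "multilinear (map \<Lambda> (take j c) @ map \<Lambda> d @ map \<Lambda> (drop (j + 1) c))
      (\<Lambda>s (take j c @ d @ drop (j + 1) c)) (epure (take j c @ d @ drop (j + 1) c))"
    using ext_pure_multilinear[of "take j c @ d @ drop (j + 1) c"] by simp
  show "take j \<alpha>s \<in> ext_lists (take j c)" "drop (j + 1) \<alpha>s \<in> ext_lists (drop (j + 1) c)"
    using assms by (auto simp only: ext_lists_iff length_take length_drop nth_take nth_drop min_def split: if_splits)
qed

lemma insert_pair_lin:
  assumes "\<alpha>s \<in> ext_lists c" "j < length c"
  shows "insert_pair c j d \<alpha>s \<in> lin (\<Lambda>s d) (\<Lambda>s (take j c @ d @ drop (j + 1) c))"
  unfolding insert_pair_def
  using tensor_lift_lin[OF vsp_ext_powers vsp_ext_tensor ext_pure_middle[OF assms]] by (simp add: ext_tensor_def)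

lemma insert_pair_pure:
  assumes "\<alpha>s \<in> ext_lists c" "j < length c" "\<beta>s \<in> ext_lists d"
  shows "insert_pair c j d \<alpha>s (epure d \<beta>s)
    = epure (take j c @ d @ drop (j + 1) c) (take j \<alpha>s @ \<beta>s @ drop (j + 1) \<alpha>s)"
  unfolding insert_pair_def
  using tensor_lift_pure[OF vsp_ext_powers vsp_ext_tensor ext_pure_middle[OF assms(1,2)] assms(3)] by (simp add: ext_pure_def)

text \<open>Linearity in an untouched factor is clear on pure tensors \<open>z\<close>, and
  \<open>lin_param\<close> extends it to all \<open>z\<close>.\<close>

lemma insert_pair_slot_lin:
  assumes \<alpha>s: "\<alpha>s \<in> ext_lists c" and j: "j < length c" and k: "k < length c" "k \<noteq> j"
    and z: "z \<in> carrier (\<Lambda>s d)" and d: "length d = 2"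
  shows "(\<lambda>x. insert_pair c j d (\<alpha>s[k := x]) z) \<in> lin (\<Lambda> (c ! k)) (\<Lambda>s (take j c @ d @ drop (j + 1) c))"
proof (rule lin_param[where M = "\<Lambda> (c ! k)" and Z = "\<Lambda>s d" and G = "epure d ` ext_lists d"
      and H = "\<lambda>x. insert_pair c j d (\<alpha>s[k := x])"])
  have upd: "\<alpha>s[k := x] \<in> ext_lists c" if "x \<in> carrier (\<Lambda> (c ! k))" for x
    using that k \<alpha>s by (auto simp: ext_lists_iff nth_list_update simp del: map_map)
  show "insert_pair c j d (\<alpha>s[k := x]) \<in> lin (\<Lambda>s d) (\<Lambda>s (take j c @ d @ drop (j + 1) c))"
    if x: "x \<in> carrier (\<Lambda> (c ! k))" for x
    using insert_pair_lin[OF upd[OF x] j] .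
  show "z \<in> lspan (\<Lambda>s d) (epure d ` ext_lists d)"
    using tensor_generators[OF vsp_ext_powers] z by (simp add: ext_tensor_def ext_pure_def[abs_def])
  show "epure d ` ext_lists d \<subseteq> carrier (\<Lambda>s d)"
    using ext_pure_closed by blast
  fix g assume "g \<in> epure d ` ext_lists d"
  then obtain \<beta>s where \<beta>s: "\<beta>s \<in> ext_lists d" "g = epure d \<beta>s" by blast
  let ?c = "take j c @ d @ drop (j + 1) c" and ?a = "take j \<alpha>s @ \<beta>s @ drop (j + 1) \<alpha>s"
  \<comment> \<open>the position of the factor \<open>k\<close> after the two factors have replaced the factor \<open>j\<close>\<close>
  define k' where "k' = (if k < j then k else k + 1)"
  have len: "length \<alpha>s = length c" "length \<beta>s = 2" using \<alpha>s \<beta>s d by (auto simp only: ext_lists_iff)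
  have a: "?a \<in> ext_lists ?c"
    using \<alpha>s \<beta>s j len d unfolding ext_lists_iff
    by (auto simp: nth_append)
  have k': "k' < length ?c" "?c ! k' = c ! k" using k j d by (auto simp: k'_def nth_append)
  have "take j (\<alpha>s[k := x]) @ \<beta>s @ drop (j + 1) (\<alpha>s[k := x]) = ?a[k' := x]" for x
    using k j len by (auto simp: k'_def list_update_append take_update_swap drop_update_swap list_update_beyond)
  moreover have "(\<lambda>x. epure ?c (?a[k' := x])) \<in> lin (\<Lambda> (c ! k)) (\<Lambda>s ?c)"
    using multilinear_lin[OF ext_pure_multilinear a, of k'] k' by (simp only: length_map nth_map)
  ultimately have "(\<lambda>x. epure ?c (take j (\<alpha>s[k := x]) @ \<beta>s @ drop (j + 1) (\<alpha>s[k := x]))) \<in> lin (\<Lambda> (c ! k)) (\<Lambda>s ?c)"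
    by simp
  then show "(\<lambda>x. insert_pair c j d (\<alpha>s[k := x]) g) \<in> lin (\<Lambda> (c ! k)) (\<Lambda>s ?c)"
    by (rule lin_cong[OF vsp_ext_power]) (simp only: \<beta>s(2) insert_pair_pure[OF upd j \<beta>s(1)])
qed (rule vsp_ext_power vsp_ext_tensor)+

context
  fixes t p :: nat and c :: "nat list" and j :: nat
  assumes c: "c \<in> comps dimV t p" and j: "j < p"
begin

private lemma len: "length c = p" and cj: "c ! j \<le> dimV" and cj0: "c ! j \<noteq> 0"
proof -
  show l: "length c = p" using c by (simp add: comps_def)
  have "c ! j \<in> {1..dimV}" using c j l nth_mem[of j c] by (auto simp: comps_def simp del: nth_mem)
  then show "c ! j \<le> dimV" "c ! j \<noteq> 0" by auto
qed

private lemma d: "d \<in> comps dimV (c ! j) 2 \<Longrightarrow> length d = 2 \<and> take j c @ d @ drop (j + 1) c \<in> comps dimV t (p + 1)"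
proof -
  assume d: "d \<in> comps dimV (c ! j) 2"
  have "c = take j c @ c ! j # drop (j + 1) c" using j len by (simp add: id_take_nth_drop)
  then have "sum_list c = sum_list (take j c) + c ! j + sum_list (drop (j + 1) c)"
    by (metis add.assoc sum_list.Cons sum_list_append)
  then show ?thesis using c d j
    by (auto simp: comps_def dest: in_set_takeD in_set_dropD)
qed

private abbreviation c' where "c' d \<equiv> take j c @ d @ drop (j + 1) c"

text \<open>The map \<open>delta_at\<close> with the value of \<open>ext_delta\<close> in the factor
  \<open>j\<close> replaced by a variable \<open>z\<close>, in which it is linear.\<close>

private definition \<Theta> where
  "\<Theta> \<alpha>s z = finsum (T t (p + 1)) (\<lambda>d. T_in scale t (p + 1) (c' d) (insert_pair c j d \<alpha>s (z d))) (comps dimV (c ! j) 2)"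

lemma delta_at_eq: "delta_at scale t p c j \<alpha>s = \<Theta> \<alpha>s (ext_delta scale (c ! j) (\<alpha>s ! j))"
  by (simp add: delta_at_def \<Theta>_def insert_pair_def Let_def)

private lemma pieces: "\<alpha>s \<in> ext_lists c \<Longrightarrow> d \<in> comps dimV (c ! j) 2 \<Longrightarrow>
    (\<lambda>z. T_in scale t (p + 1) (c' d) (insert_pair c j d \<alpha>s z)) \<in> lin (\<Lambda>s d) (T t (p + 1))"
  using d[of d] j len by (intro lin_comp[OF insert_pair_lin T_in_lin]) auto

private lemma \<Theta>_lin: "\<alpha>s \<in> ext_lists c \<Longrightarrow> \<Theta> \<alpha>s \<in> lin (T (c ! j) 2) (T t (p + 1))"
  unfolding \<Theta>_def[abs_def] T_space_def[of scale "c ! j"]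
  by (rule dsum_lift_in(1)) (rule vsp_ext_tensor finite_comps vsp_T pieces | assumption)+

text \<open>In the factor \<open>j\<close> the map is the composition of \<open>ext_delta\<close> with
  \<open>\<Theta>\<close>; in the other factors linearity is \<open>insert_pair_slot_lin\<close>, summed over
  the degrees \<open>d\<close>.\<close>

lemma delta_at_multilinear: "multilinear (map \<Lambda> c) (T t (p + 1)) (delta_at scale t p c j)"
  unfolding multilinear_def
proof (intro ballI conjI allI impI)
  fix \<alpha>s assume \<alpha>s: "\<alpha>s \<in> ext_lists c"
  then have \<alpha>j: "\<alpha>s ! j \<in> carrier (\<Lambda> (c ! j))" using j len by (auto simp only: ext_lists_iff)
  note z = lin_closed[OF ext_delta_lin[OF cj] \<alpha>j]
  show "delta_at scale t p c j \<alpha>s \<in> carrier (T t (p + 1))"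
    unfolding delta_at_eq by (rule lin_closed[OF \<Theta>_lin[OF \<alpha>s] z])
  fix k assume "k < length (map \<Lambda> c)"
  then have k: "k < length c" by simp
  have l: "length \<alpha>s = length c" using \<alpha>s by (auto simp only: ext_lists_iff)
  show "(\<lambda>x. delta_at scale t p c j (\<alpha>s[k := x])) \<in> lin (map \<Lambda> c ! k) (T t (p + 1))"
  proof (cases "k = j")
    case True
    have "\<Theta> (\<alpha>s[j := x]) = \<Theta> \<alpha>s" for x
      unfolding \<Theta>_def insert_pair_def by simp
    then have "delta_at scale t p c j (\<alpha>s[k := x]) = \<Theta> \<alpha>s (ext_delta scale (c ! j) x)" for x
      unfolding delta_at_eq using True k l by simp
    then show ?thesis using lin_comp[OF ext_delta_lin[OF cj] \<Theta>_lin[OF \<alpha>s]] True k by simp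
  next
    case False
    let ?z = "ext_delta scale (c ! j) (\<alpha>s ! j)"
    have zd: "?z d \<in> carrier (\<Lambda>s d)" if "d \<in> comps dimV (c ! j) 2" for d
      using z that by (auto simp: T_space_def dsum_carrier[OF _ finite_comps] vsp_ext_tensor)
    have "(\<lambda>x. \<Theta> (\<alpha>s[k := x]) ?z) \<in> lin (\<Lambda> (c ! k)) (T t (p + 1))"
      unfolding \<Theta>_def
      by (intro lin_finsum_fun vsp_ext_power vsp_T lin_comp[OF insert_pair_slot_lin[OF \<alpha>s _ k False zd] T_in_lin])
        (use d j len in auto)
    then show ?thesis unfolding delta_at_eq using False k by simp
  qed
qed

lemma delta_at_wedges:
  assumes vss: "map length vss = c"
  shows "delta_at scale t p c j (map wdg vss)
    = btensor_lin t (p + 1) (free_ext (\<lambda>ds. gen (take j vss @ ds @ drop (j + 1) vss)) (rcobar [vss ! j]))"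
proof -
  let ?w = "map wdg vss"
  have \<alpha>s: "?w \<in> ext_lists c" using wedges_mem[of vss] vss by simp
  have jv: "j < length vss" "length (vss ! j) = c ! j" using vss j len by auto
  have ds: "[vss ! j] \<in> blockwords (c ! j) 1"
    using jv cj cj0 by (auto simp: blockwords_def)
  have sub: "take j vss @ ds @ drop (j + 1) vss \<in> blockwords t (p + 1)"
    and \<Theta>_btensor: "\<Theta> ?w (btensor (c ! j) 2 ds) = btensor t (p + 1) (take j vss @ ds @ drop (j + 1) vss)"
    if "ds \<in> blockwords (c ! j) 2" for ds
  proof -
    have dc: "map length ds \<in> comps dimV (c ! j) 2" using that by (simp add: blockwords_comps)
    have cc: "map length (take j vss @ ds @ drop (j + 1) vss) = c' (map length ds)"
      using vss by (auto simp: take_map drop_map)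
    show "take j vss @ ds @ drop (j + 1) vss \<in> blockwords t (p + 1)"
      unfolding blockwords_comps cc using d[OF dc] by simp
    have "\<Theta> ?w (btensor (c ! j) 2 ds) = T_in scale t (p + 1) (c' (map length ds)) (insert_pair c j (map length ds) ?w
        (epure (map length ds) (map wdg ds)))"
      unfolding \<Theta>_def btensor_def T_in_def[of scale "c ! j"]
      by (rule dsum_lift_in(2)) (rule vsp_ext_tensor finite_comps vsp_T pieces[OF \<alpha>s] dc ext_pure_closed[OF wedges_mem] | assumption)+
    also have "insert_pair c j (map length ds) ?w (epure (map length ds) (map wdg ds))
       = epure (c' (map length ds)) (take j ?w @ map wdg ds @ drop (j + 1) ?w)"
      using insert_pair_pure[OF \<alpha>s _ wedges_mem] j len by simp
    finally show "\<Theta> ?w (btensor (c ! j) 2 ds) = btensor t (p + 1) (take j vss @ ds @ drop (j + 1) vss)"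
      unfolding btensor_def cc by (simp add: take_map drop_map)
  qed
  have "rcobar [vss ! j] \<in> supported (blockwords (c ! j) 2)"
    using rcobar_blockwords[OF ds] by (simp add: numeral_2_eq_2)
  note sup = this
  have "delta_at scale t p c j ?w = \<Theta> ?w (btensor_lin (c ! j) 2 (rcobar [vss ! j]))"
    unfolding delta_at_eq using jv ext_delta_wedge[OF cj jv(2)] by simp
  also have "\<dots> = free_lift (T t (p + 1)) (\<lambda>ds. \<Theta> ?w (btensor (c ! j) 2 ds)) (rcobar [vss ! j])"
    by (rule lin_free_lift[OF vsp_T btensor_closed vsp_T \<Theta>_lin[OF \<alpha>s] sup])
  also have "\<dots> = free_lift (T t (p + 1)) (\<lambda>ds. btensor_lin t (p + 1) (gen (take j vss @ ds @ drop (j + 1) vss))) (rcobar [vss ! j])"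
    by (rule free_lift_cong[OF vsp_T _ sup])
      (simp_all only: \<Theta>_btensor free_lift_gen[OF vsp_T btensor_closed sub] btensor_closed[OF sub])
  also have "\<dots> = btensor_lin t (p + 1) (free_ext (\<lambda>ds. gen (take j vss @ ds @ drop (j + 1) vss)) (rcobar [vss ! j]))"
    by (rule free_lift_free_ext[OF vsp_T btensor_closed _ sup, symmetric]) (use sub in auto)
  finally show ?thesis .
qed

end

context
  fixes t p :: nat
begin

private abbreviation \<phi> where
  "\<phi> c \<alpha>s \<equiv> finsum (T t (p + 1)) (\<lambda>j. (-1) ^ j \<odot>\<^bsub>T t (p + 1)\<^esub> delta_at scale t p c j \<alpha>s) {..<p}"

private lemma \<phi>_multilinear: "c \<in> comps dimV t p \<Longrightarrow> multilinear (map \<Lambda> c) (T t (p + 1)) (\<phi> c)"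
  by (intro multilinear_finsum vsp_ext_powers vsp_T multilinear_scaled delta_at_multilinear) auto

private lemma \<phi>_lin: "c \<in> comps dimV t p \<Longrightarrow> quot_lift (T t (p + 1)) (\<phi> c) \<in> lin (\<Lambda>s c) (T t (p + 1))"
  unfolding ext_tensor_def by (rule tensor_lift_lin[OF vsp_ext_powers vsp_T \<phi>_multilinear])

lemma T_delta_lin: "\<delta> t p \<in> lin (T t p) (T t (p + 1))"
  unfolding T_delta_def[abs_def] T_space_def[of scale t p]
  by (rule dsum_lift_in(1)) (rule vsp_ext_tensor finite_comps vsp_T \<phi>_lin | assumption)+

text \<open>The link between the complex and the lists of blocks: sum the values given by
  \<open>delta_at_wedges\<close> over the factors and compare with \<open>rcobar_sum\<close>.\<close>

lemma T_delta_btensor: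
  assumes vss: "vss \<in> blockwords t p"
  shows "\<delta> t p (btensor t p vss) = btensor_lin t (p + 1) (rcobar vss)"
proof -
  let ?c = "map length vss" and ?w = "map wdg vss"
  let ?g = "\<lambda>j. free_ext (\<lambda>ds. gen (take j vss @ ds @ drop (j + 1) vss)) (rcobar [vss ! j]) :: 'v list list \<Rightarrow>\<^sub>0 'k"
  have c: "?c \<in> comps dimV t p" and len: "length vss = p" and ne: "[] \<notin> set vss"
    using vss by (simp add: blockwords_comps) (use vss in \<open>auto simp: blockwords_def\<close>)
  have sub: "?g j \<in> supported (blockwords t (p + 1))" if j: "j < p" for j
  proof (rule free_ext_supported)
    let ?X = "{cs. (\<forall>b\<in>set cs. b \<noteq> [] \<and> length b \<le> dimV) \<and> length (concat cs) = length (vss ! j) \<and> length cs = 2}"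
    show "rcobar [vss ! j] \<in> supported ?X"
      using rcobar_blocks[of "[vss ! j]" dimV] vss nth_mem[of j vss] j len
      by (auto simp: blockwords_def numeral_2_eq_2)
    have v: "vss = take j vss @ vss ! j # drop (Suc j) vss" using j len by (simp add: id_take_nth_drop)
    have "length (concat vss) = length (concat (take j vss)) + length (vss ! j) + length (concat (drop (Suc j) vss))"
      by (subst v) simp
    then show "gen (take j vss @ ds @ drop (j + 1) vss) \<in> supported (blockwords t (p + 1))" if "ds \<in> ?X" for ds
      using that vss j by (auto simp: blockwords_def dest: in_set_takeD in_set_dropD)
  qed
  have "\<delta> t p (btensor t p vss) = quot_lift (T t (p + 1)) (\<phi> ?c) (epure ?c ?w)"
    unfolding T_delta_def btensor_def T_in_def[of scale t p]
    by (rule dsum_lift_in(2)) (rule vsp_ext_tensor finite_comps vsp_T \<phi>_lin c ext_pure_closed[OF wedges_mem] | assumption)+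
  also have "\<dots> = \<phi> ?c ?w"
    unfolding ext_pure_def by (rule tensor_lift_pure[OF vsp_ext_powers vsp_T \<phi>_multilinear[OF c] wedges_mem])
  also have "\<dots> = finsum (T t (p + 1)) (\<lambda>j. btensor_lin t (p + 1) (free_scale ((-1) ^ j) (?g j))) {..<p}"
    by (rule vsp_finsum_cong[OF vsp_T])
      (auto simp only: delta_at_wedges[OF c _ refl] lessThan_iff free_lift_scale[OF vsp_T btensor_closed sub]
        intro!: btensor_lin_closed sub supported_scale)
  also have "\<dots> = btensor_lin t (p + 1) (\<Sum>j<p. free_scale ((-1) ^ j) (?g j))"
    by (rule free_lift_sum[OF vsp_T btensor_closed, symmetric]) (auto intro!: supported_scale sub simp del: One_nat_def add_Suc_right)
  also have "(\<Sum>j<p. free_scale ((-1) ^ j) (?g j)) = rcobar vss" unfolding rcobar_sum[OF ne] len ..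
  finally show ?thesis .
qed

end

section \<open>The action of the general linear group\<close>

lemma GL_lin: "g \<in> GL scale \<Longrightarrow> g \<in> lin V V"
proof -
  assume "g \<in> GL scale"
  then interpret Vector_Spaces.linear scale scale g by (simp add: GL_def)
  show ?thesis by (rule linI) (simp_all add: add scale)
qed

context
  fixes g :: "'v \<Rightarrow> 'v"
  assumes g: "g \<in> lin V V"
begin

lemma multilinear_map_comp:
  assumes "multilinear (replicate i V) N f"
  shows "multilinear (replicate i V) N (\<lambda>vs. f (map g vs))"
proof (rule multilinear_vecI)
  fix pre post :: "'v list" and x assume "length pre + length post + 1 = i"
  then have *: "(\<lambda>x. f (map g pre @ x # map g post)) \<in> lin V N"
    by (intro multilinear_vecD[OF assms]) simp
  show "(\<lambda>x. f (map g (pre @ x # post))) \<in> lin V N" using lin_comp[OF g *] by simp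
  show "f (map g (pre @ x # post)) \<in> carrier N" using lin_closed[OF *, of "g x"] by simp
qed (use multilinear_closed[OF assms, of "[]"] in \<open>simp add: listset_vec\<close>)

lemma ext_act_lin: "ext_act scale i g \<in> lin (\<Lambda> i) (\<Lambda> i)"
  and ext_act_wedge: "length vs = i \<Longrightarrow> ext_act scale i g (wdg vs) = wdg (map g vs)"
proof -
  note m = multilinear_map_comp[OF wedge_multilinear[of i]]
  have adj: "wdg (map g (pre @ x # x # post)) = \<zero>\<^bsub>\<Lambda> i\<^esub>" if "length pre + length post + 2 = i" for pre x post
    using that by (intro wedge_not_distinct) auto
  show "ext_act scale i g \<in> lin (\<Lambda> i) (\<Lambda> i)"
    unfolding ext_act_def by (rule ext_lift_lin[OF vsp_ext_power m adj])
  show "length vs = i \<Longrightarrow> ext_act scale i g (wdg vs) = wdg (map g vs)"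
    unfolding ext_act_def by (rule ext_lift_wedge[OF vsp_ext_power m adj])
qed

lemma ext_tensor_act_lin: "ext_tensor_act scale c g \<in> lin (\<Lambda>s c) (\<Lambda>s c)"
  and ext_tensor_act_wedges: "map length vss = c \<Longrightarrow> ext_tensor_act scale c g (epure c (map wdg vss))
      = epure c (map wdg (map (map g) vss))"
proof -
  let ?a = "map2 (\<lambda>i \<alpha>. ext_act scale i g \<alpha>) c"
  have mem: "?a \<alpha>s \<in> ext_lists c" if "\<alpha>s \<in> ext_lists c" for \<alpha>s
    using that unfolding ext_lists_iff by (auto intro!: lin_closed[OF ext_act_lin])
  have m: "multilinear (map \<Lambda> c) (\<Lambda>s c) (\<lambda>\<alpha>s. epure c (?a \<alpha>s))"
    unfolding multilinear_def
  proof (intro ballI conjI allI impI)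
    fix \<alpha>s assume \<alpha>s: "\<alpha>s \<in> ext_lists c"
    show "epure c (?a \<alpha>s) \<in> carrier (\<Lambda>s c)" by (rule ext_pure_closed[OF mem[OF \<alpha>s]])
    fix j assume "j < length (map \<Lambda> c)"
    then have j: "j < length c" by simp
    have len: "length \<alpha>s = length c" using \<alpha>s unfolding ext_lists_iff by simp
    have u: "?a (\<alpha>s[j := x]) = (?a \<alpha>s)[j := ext_act scale (c ! j) g x]" for x
      using j len by (intro nth_equalityI) (auto simp: nth_list_update)
    show "(\<lambda>x. epure c (?a (\<alpha>s[j := x]))) \<in> lin (map \<Lambda> c ! j) (\<Lambda>s c)"
    proof -
      have "(\<lambda>y. epure c ((?a \<alpha>s)[j := y])) \<in> lin (\<Lambda> (c ! j)) (\<Lambda>s c)"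
        using multilinear_lin[OF ext_pure_multilinear mem[OF \<alpha>s], of j] j by (simp only: length_map nth_map)
      from lin_comp[OF ext_act_lin this] show ?thesis unfolding u nth_map[OF j] .
    qed
  qed
  show "ext_tensor_act scale c g \<in> lin (\<Lambda>s c) (\<Lambda>s c)"
    unfolding ext_tensor_act_def
    using tensor_lift_lin[OF vsp_ext_powers vsp_ext_tensor m] by (simp add: ext_tensor_def)
  assume vss: "map length vss = c"
  have "ext_tensor_act scale c g (epure c (map wdg vss)) = epure c (?a (map wdg vss))"
    unfolding ext_tensor_act_def using tensor_lift_pure[OF vsp_ext_powers vsp_ext_tensor m wedges_mem[of vss, unfolded vss]]
    by (simp add: ext_pure_def)
  also have "?a (map wdg vss) = map wdg (map (map g) vss)"
    unfolding vss[symmetric] by (induct vss) (simp_all add: ext_act_wedge)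
  finally show "ext_tensor_act scale c g (epure c (map wdg vss))
      = epure c (map wdg (map (map g) vss))" .
qed

lemma T_act_lin: "T_act scale t p g \<in> lin (T t p) (T t p)"
  unfolding T_act_def[abs_def] T_space_def
  by (rule dsum_map(1)) (rule vsp_ext_tensor finite_comps ext_tensor_act_lin)+

lemma T_act_btensor:
  assumes "vss \<in> blockwords t p"
  shows "T_act scale t p g (btensor t p vss) = btensor t p (map (map g) vss)"
proof -
  have l: "map length (map (map g) vss) = map length vss" by simp
  have "T_act scale t p g (btensor t p vss) = T_in scale t p (map length vss)
     (ext_tensor_act scale (map length vss) g (epure (map length vss) (map wdg vss)))"
    unfolding T_act_def btensor_def T_in_def
    by (rule dsum_map(2)) (use assms in \<open>auto simp: vsp_ext_tensor finite_comps blockwords_comps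
      intro: ext_tensor_act_lin ext_pure_closed wedges_mem simp del: map_map\<close>)
  then show ?thesis unfolding ext_tensor_act_wedges[OF refl] btensor_def l .
qed

lemma T_act_btensor_lin:
  assumes "u \<in> supported (blockwords t p)"
  shows "T_act scale t p g (btensor_lin t p u) = btensor_lin t p (free_ext (\<lambda>vss. gen (map (map g) vss)) u)"
proof -
  have bw: "map (map g) vss \<in> blockwords t p" if "vss \<in> blockwords t p" for vss
    using that by (simp add: blockwords_comps comp_def)
  have "T_act scale t p g (btensor_lin t p u) = free_lift (T t p) (\<lambda>vss. T_act scale t p g (btensor t p vss)) u"
    by (rule lin_free_lift[OF vsp_T btensor_closed vsp_T T_act_lin assms])
  also have "\<dots> = free_lift (T t p) (\<lambda>vss. btensor_lin t p (gen (map (map g) vss))) u"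
    by (rule free_lift_cong[OF vsp_T _ assms])
      (simp_all add: T_act_btensor bw free_lift_gen[OF vsp_T btensor_closed bw] btensor_closed del: map_map)
  also have "\<dots> = btensor_lin t p (free_ext (\<lambda>vss. gen (map (map g) vss)) u)"
  proof (rule free_lift_free_ext[OF vsp_T btensor_closed _ assms, symmetric])
    fix vss assume "vss \<in> blockwords t p"
    from bw[OF this] show "(gen (map (map g) vss) :: _ \<Rightarrow>\<^sub>0 'k) \<in> supported (blockwords t p)" by (simp del: map_map)
  qed
  finally show ?thesis .
qed

lemma sym_act_lin: "sym_act scale t g \<in> lin (Sym t) (Sym t)"
  and sym_act_prod: "length vs = t \<Longrightarrow> sym_act scale t g (sprod vs) = sprod (map g vs)"
proof -
  note m = multilinear_map_comp[OF sym_prod_multilinear[of t]]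
  have perm: "sprod (map g vs) = sprod (map g ws)" if "mset vs = mset ws" for vs ws
    using that by (intro sym_prod_perm) simp
  show "sym_act scale t g \<in> lin (Sym t) (Sym t)"
    unfolding sym_act_def by (rule sym_lift_lin[OF vsp_sym_power m perm])
  show "length vs = t \<Longrightarrow> sym_act scale t g (sprod vs) = sprod (map g vs)"
    unfolding sym_act_def by (rule sym_lift_prod[OF vsp_sym_power m perm])
qed

text \<open>On generators both sides are \<open>rcobar\<close> with the letters replaced by their images, by
  \<open>rcobar_map\<close>.\<close>

lemma T_delta_equivariant:
  assumes "x \<in> carrier (T t p)"
  shows "\<delta> t p (T_act scale t p g x) = T_act scale t (p + 1) g (\<delta> t p x)"
proof (rule T_lin_eq[OF vsp_T lin_comp[OF T_act_lin T_delta_lin] lin_comp[OF T_delta_lin T_act_lin] _ assms])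
  fix vss assume vss: "vss \<in> blockwords t p"
  then have vss': "map (map g) vss \<in> blockwords t p" by (simp add: blockwords_comps comp_def)
  have s: "rcobar vss \<in> supported (blockwords t (p + 1))" using rcobar_blockwords[OF vss] by simp
  show "\<delta> t p (T_act scale t p g (btensor t p vss)) = T_act scale t (p + 1) g (\<delta> t p (btensor t p vss))"
    by (simp only: T_act_btensor[OF vss] T_delta_btensor[OF vss] T_delta_btensor[OF vss'] T_act_btensor_lin[OF s] rcobar_map)
qed

end

lemma GL_representation_T: "GL_representation scale (T t p) (T_act scale t p)"
  unfolding GL_representation_def linear_map_iff
proof (intro conjI ballI vsp_T)
  fix g assume g: "g \<in> GL scale"
  show "T_act scale t p g \<in> lin (T t p) (T t p)" by (rule T_act_lin[OF GL_lin[OF g]])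
  fix h x assume h: "h \<in> GL scale" and x: "x \<in> carrier (T t p)"
  have gh: "g \<circ> h \<in> lin V V" using lin_comp[OF GL_lin[OF h] GL_lin[OF g]] by (simp add: comp_def)
  have bw: "map (map h) vss \<in> blockwords t p" if "vss \<in> blockwords t p" for vss
    using that by (simp add: blockwords_comps comp_def)
  show "T_act scale t p (g \<circ> h) x = T_act scale t p g (T_act scale t p h x)"
    by (rule T_lin_eq[OF vsp_T T_act_lin[OF gh] lin_comp[OF T_act_lin[OF GL_lin[OF h]] T_act_lin[OF GL_lin[OF g]]] _ x])
      (simp add: T_act_btensor[OF gh] T_act_btensor[OF GL_lin[OF g] bw] T_act_btensor[OF GL_lin[OF h]])
next
  fix x assume x: "x \<in> carrier (T t p)"
  have id: "id \<in> lin V V" "(\<lambda>x. x) \<in> lin (T t p) (T t p)" by (auto intro: linI)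
  show "T_act scale t p id x = x"
    by (rule T_lin_eq[OF vsp_T T_act_lin[OF id(1)] id(2) _ x]) (simp add: T_act_btensor[OF id(1)])
qed

lemma sym_lin_eq:
  assumes "vsp N" "f \<in> lin (Sym t) N" "h \<in> lin (Sym t) N"
    "\<And>vs. length vs = t \<Longrightarrow> f (sprod vs) = h (sprod vs)" "x \<in> carrier (Sym t)"
  shows "f x = h x"
proof (rule lin_eq_on_lspan[OF vsp_sym_power assms(1-3) _ sym_generators[OF assms(5)]])
  show "sprod ` {vs. length vs = t} \<subseteq> carrier (Sym t)"
    using multilinear_closed[OF sym_prod_multilinear[of t]] by (auto simp: listset_vec)
qed (use assms(4) in auto)

lemma GL_representation_sym: "GL_representation scale (Sym t) (sym_act scale t)"
  unfolding GL_representation_def linear_map_iff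
proof (intro conjI ballI vsp_sym_power)
  fix g assume g: "g \<in> GL scale"
  show "sym_act scale t g \<in> lin (Sym t) (Sym t)" by (rule sym_act_lin[OF GL_lin[OF g]])
  fix h x assume h: "h \<in> GL scale" and x: "x \<in> carrier (Sym t)"
  have gh: "g \<circ> h \<in> lin V V" using lin_comp[OF GL_lin[OF h] GL_lin[OF g]] by (simp add: comp_def)
  show "sym_act scale t (g \<circ> h) x = sym_act scale t g (sym_act scale t h x)"
    by (rule sym_lin_eq[OF vsp_sym_power sym_act_lin[OF gh] lin_comp[OF sym_act_lin[OF GL_lin[OF h]] sym_act_lin[OF GL_lin[OF g]]] _ x])
      (simp add: sym_act_prod[OF gh] sym_act_prod[OF GL_lin[OF g]] sym_act_prod[OF GL_lin[OF h]])
next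
  fix x assume x: "x \<in> carrier (Sym t)"
  have id: "id \<in> lin V V" "(\<lambda>x. x) \<in> lin (Sym t) (Sym t)" by (auto intro: linI)
  show "sym_act scale t id x = x"
    by (rule sym_lin_eq[OF vsp_sym_power sym_act_lin[OF id(1)] id(2) _ x]) (simp add: sym_act_prod[OF id(1)])
qed

lemma GL_hom_T_delta: "GL_hom scale (T t p) (T_act scale t p) (T t (p + 1)) (T_act scale t (p + 1)) (\<delta> t p)"
  unfolding GL_hom_def linear_map_iff
  using vsp_T T_delta_lin T_delta_equivariant[OF GL_lin] by blast

lemma T_delta_btensor_lin:
  assumes "u \<in> supported (blockwords t p)"
  shows "\<delta> t p (btensor_lin t p u) = btensor_lin t (p + 1) (free_ext rcobar u)"
proof -
  have rc: "rcobar vss \<in> supported (blockwords t (p + 1))" if "vss \<in> blockwords t p" for vss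
    using rcobar_blockwords[OF that] by simp
  have "\<delta> t p (btensor_lin t p u) = free_lift (T t (p + 1)) (\<lambda>vss. \<delta> t p (btensor t p vss)) u"
    by (rule lin_free_lift[OF vsp_T btensor_closed vsp_T T_delta_lin assms])
  also have "\<dots> = free_lift (T t (p + 1)) (\<lambda>vss. btensor_lin t (p + 1) (rcobar vss)) u"
    by (rule free_lift_cong[OF vsp_T _ assms]) (simp_all only: T_delta_btensor btensor_lin_closed[OF rc])
  also have "\<dots> = btensor_lin t (p + 1) (free_ext rcobar u)"
    by (rule free_lift_free_ext[OF vsp_T btensor_closed rc assms, symmetric])
  finally show ?thesis .
qed

lemma T_delta_T_delta: "x \<in> carrier (T t p) \<Longrightarrow> \<delta> t (p + 1) (\<delta> t p x) = \<zero>\<^bsub>T t (p + 2)\<^esub>"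
proof -
  assume "x \<in> carrier (T t p)"
  then obtain u where u: "u \<in> supported (blockwords t p)" "x = btensor_lin t p u" using btensor_lin_surj by blast
  have "free_ext rcobar u \<in> supported (blockwords t (p + 1))"
    using rcobar_blockwords by (intro free_ext_supported[OF u(1)]) simp
  then show ?thesis
    using u by (simp add: T_delta_btensor_lin[OF u(1), simplified] T_delta_btensor_lin[of _ t "Suc p", simplified]
        free_ext_comp rcobar_rcobar free_lift_0[OF vsp_T])
qed

section \<open>The projection onto the symmetric power\<close>

text \<open>The identification of the first exterior power with \<open>V\<close>.\<close>

definition unwedge :: "('v list \<Rightarrow>\<^sub>0 'k) set \<Rightarrow> 'v" where
  "unwedge = the_inv (\<lambda>v. wdg [v])"

text \<open>The universal property of the exterior power provides a linear inverse of \<open>v \<mapsto> wdg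
  [v]\<close>, and \<open>unwedge\<close> has to agree with it.\<close>

lemma unwedge_lin: "unwedge \<in> lin (\<Lambda> 1) V"
  and unwedge_wedge: "unwedge (wdg [v]) = v"
proof -
  have m: "multilinear (replicate 1 V) V hd"
    by (rule multilinear_vecI) (auto intro: linI)
  let ?q = "quot_lift V hd"
  have q: "?q \<in> lin (\<Lambda> 1) V" by (rule ext_lift_lin[OF vsp_V m]) simp
  have qw: "?q (wdg [v]) = v" for v
    using ext_lift_wedge[OF vsp_V m, of "[v]"] by simp
  then have inj: "inj (\<lambda>v. wdg [v])" by (intro inj_on_inverseI[of _ ?q])
  then show uw: "unwedge (wdg [v]) = v" for v unfolding unwedge_def by (rule the_inv_f_f)
  have w: "(\<lambda>v. wdg [v]) \<in> lin V (\<Lambda> 1)"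
    using multilinear_vecD[OF wedge_multilinear, of "[]" "[]" 1] by simp
  have x: "x = wdg [?q x]" if "x \<in> carrier (\<Lambda> 1)" for x
  proof (rule lin_eq_on_lspan[where f = "\<lambda>x. x", OF vsp_ext_power vsp_ext_power _ lin_comp[OF q w] _ wedge_generators[OF that]])
    show "wdg ` {vs. length vs = 1} \<subseteq> carrier (\<Lambda> 1)" by (auto intro: wedge_closed)
    show "g = wdg [?q g]" if "g \<in> wdg ` {vs. length vs = 1}" for g
      using that by (auto simp: length_Suc_conv qw)
    show "(\<lambda>x. x) \<in> lin (\<Lambda> 1) (\<Lambda> 1)" by (rule linI) simp_all
  qed
  show "unwedge \<in> lin (\<Lambda> 1) V"
  proof (rule lin_cong[OF vsp_ext_power q])
    fix a assume "a \<in> carrier (\<Lambda> 1)"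
    from arg_cong[OF x[OF this], of unwedge] show "unwedge a = ?q a" by (rule trans) (rule uw)
  qed
qed

context
  fixes t :: nat
  assumes t: "t \<ge> 1" and dim: "dimV \<ge> 1"
begin

private abbreviation ones :: "nat list" where "ones \<equiv> replicate t 1"

private lemma ones_comps: "ones \<in> comps dimV t t"
  using dim by (auto simp: comps_def sum_list_replicate)

private lemma sym_proj_multilinear:
  "multilinear (map \<Lambda> ones) (Sym t) (\<lambda>\<alpha>s. sprod (map unwedge \<alpha>s))"
  unfolding multilinear_def
proof (intro ballI conjI allI impI)
  fix \<alpha>s assume \<alpha>s: "\<alpha>s \<in> ext_lists ones"
  then have len: "length \<alpha>s = t" by (simp only: ext_lists_iff length_replicate)
  then have m: "map unwedge \<alpha>s \<in> listset (map carrier (replicate t V))" by simp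
  show "sprod (map unwedge \<alpha>s) \<in> carrier (Sym t)"
    by (rule multilinear_closed[OF sym_prod_multilinear m])
  fix j assume "j < length (map \<Lambda> ones)"
  then have j: "j < t" by simp
  have "(\<lambda>x. sprod ((map unwedge \<alpha>s)[j := x])) \<in> lin V (Sym t)"
    using multilinear_lin[OF sym_prod_multilinear m, of j] j by simp
  from lin_comp[OF unwedge_lin this]
  show "(\<lambda>x. sprod (map unwedge (\<alpha>s[j := x]))) \<in> lin (map \<Lambda> ones ! j) (Sym t)"
    using j by (simp add: map_update)
qed

lemma sym_proj_lin: "sproj t \<in> lin (T t t) (Sym t)"
proof -
  have "quot_lift (Sym t) (\<lambda>\<alpha>s. sprod (map unwedge \<alpha>s)) \<in> lin (\<Lambda>s ones) (Sym t)"
    unfolding ext_tensor_def by (rule tensor_lift_lin[OF vsp_ext_powers vsp_sym_power sym_proj_multilinear])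
  moreover have "(\<lambda>x. x ones) \<in> lin (T t t) (\<Lambda>s ones)"
    unfolding T_space_def by (rule dsum_proj_lin[OF _ finite_comps ones_comps]) (rule vsp_ext_tensor)
  ultimately show ?thesis
    unfolding sym_proj_def[abs_def] unwedge_def[symmetric] by (rule lin_comp[rotated])
qed

lemma sym_proj_btensor:
  assumes "length vs = t"
  shows "sproj t (btensor t t (singles vs)) = sprod vs"
proof -
  have l: "map length (singles vs) = ones" using assms by (auto simp: comp_def intro: map_replicate_const)
  have "btensor t t (singles vs) ones = epure ones (map wdg (singles vs))"
    unfolding btensor_def T_in_def l
    by (simp only: dsum_in_component[OF vsp_ext_tensor finite_comps ones_comps] simp_thms if_True)
  moreover have "quot_lift (Sym t) (\<lambda>\<alpha>s. sprod (map unwedge \<alpha>s)) (epure ones (map wdg (singles vs)))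
     = sprod (map unwedge (map wdg (singles vs)))"
    unfolding ext_pure_def
    by (rule tensor_lift_pure[OF vsp_ext_powers vsp_sym_power sym_proj_multilinear wedges_mem[of "singles vs", unfolded l]])
  ultimately show ?thesis
    unfolding sym_proj_def unwedge_def[symmetric] by (simp add: comp_def unwedge_wedge)
qed

lemma singles_blockwords: "length vs = t \<Longrightarrow> singles vs \<in> blockwords t t"
  using dim by (auto simp: blockwords_def length_concat comp_def sum_list_triv)

lemma blockwords_singles: "vss \<in> blockwords t t \<Longrightarrow> \<exists>vs. length vs = t \<and> vss = singles vs"
proof -
  assume vss: "vss \<in> blockwords t t"
  then obtain vs where "vss = singles vs" using blocks_all_singles[of vss] by (auto simp: blockwords_def)
  moreover have "length vss = t" using vss by (simp add: blockwords_def)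
  ultimately show ?thesis by (intro exI[of _ vs]) simp
qed

text \<open>The identification of tensors of vectors, that is of combinations of words of length
  \<open>t\<close>, with elements of $T_t^t$.\<close>

definition singles_lin :: "('v list \<Rightarrow>\<^sub>0 'k) \<Rightarrow> _" where
  "singles_lin = free_lift (T t t) (\<lambda>vs. btensor t t (singles vs))"

private lemma singles_btensor_closed: "vs \<in> {vs. length vs = t} \<Longrightarrow> btensor t t (singles vs) \<in> carrier (T t t)"
  by (simp add: btensor_closed singles_blockwords)

lemma singles_lin_closed: "u \<in> supported {vs. length vs = t} \<Longrightarrow> singles_lin u \<in> carrier (T t t)"
  unfolding singles_lin_def by (rule free_lift_closed[OF vsp_T singles_btensor_closed])

lemma singles_lin_surj: "x \<in> carrier (T t t) \<Longrightarrow> \<exists>u\<in>supported {vs. length vs = t}. x = singles_lin u"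
  unfolding singles_lin_def
proof (rule lspan_free_lift[OF vsp_T singles_btensor_closed])
  assume "x \<in> carrier (T t t)"
  from T_generators[OF this] show "x \<in> lspan (T t t) ((\<lambda>vs. btensor t t (singles vs)) ` {vs. length vs = t})"
    by (rule lspan_trans) (auto dest: blockwords_singles intro!: lspan_base)
qed

lemma sym_prod_closed: "vs \<in> {vs. length vs = t} \<Longrightarrow> sprod vs \<in> carrier (Sym t)"
  using multilinear_closed[OF sym_prod_multilinear[of t]] by (simp add: listset_vec)

lemma sym_proj_singles_lin:
  assumes u: "u \<in> supported {vs. length vs = t}"
  shows "sproj t (singles_lin u) = free_lift (Sym t) sprod u"
proof -
  have "sproj t (singles_lin u) = free_lift (Sym t) (\<lambda>vs. sproj t (btensor t t (singles vs))) u"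
    unfolding singles_lin_def by (rule lin_free_lift[OF vsp_T singles_btensor_closed vsp_sym_power sym_proj_lin u])
  also have "\<dots> = free_lift (Sym t) sprod u"
    by (rule free_lift_cong[OF vsp_sym_power sym_prod_closed u]) (auto simp: sym_proj_btensor)
  finally show ?thesis .
qed

lemma free_lift_sym_prod:
  assumes u: "u \<in> supported {vs. length vs = t}"
  shows "free_lift (Sym t) sprod u = cls (sym_rels scale t) u"
proof -
  have "free_lift (Sym t) sprod u = free_lift (Sym t) (\<lambda>vs. cls (sym_rels scale t) (gen vs)) u"
  proof (rule free_lift_cong[OF vsp_sym_power _ u])
    show "cls (sym_rels scale t) (gen vs) \<in> carrier (Sym t)" if "vs \<in> {vs. length vs = t}" for vs
      using sym_prod_closed[OF that] that by (simp add: sym_prod_def)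
  qed (auto simp: sym_prod_def)
  also have "\<dots> = cls (sym_rels scale t) (free_ext gen u)"
    unfolding sym_power_def by (rule free_lift_presented[OF u]) simp
  finally show ?thesis using free_ext_eq_id[OF u, of gen] by simp
qed

lemma sym_proj_surj: "sproj t ` carrier (T t t) = carrier (Sym t)"
proof
  show "sproj t ` carrier (T t t) \<subseteq> carrier (Sym t)"
    using lin_closed[OF sym_proj_lin] by auto
  show "carrier (Sym t) \<subseteq> sproj t ` carrier (T t t)"
  proof
    fix x assume "x \<in> carrier (Sym t)"
    from lspan_free_lift[OF vsp_sym_power sym_prod_closed sym_generators[OF this]]
    obtain u where "u \<in> supported {vs. length vs = t}" "x = free_lift (Sym t) sprod u" by blast
    then show "x \<in> sproj t ` carrier (T t t)"
      by (intro image_eqI[of _ _ "singles_lin u"]) (simp_all add: sym_proj_singles_lin singles_lin_closed)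
  qed
qed

lemma GL_hom_sym_proj: "GL_hom scale (T t t) (T_act scale t t) (Sym t) (sym_act scale t) (sproj t)"
  unfolding GL_hom_def linear_map_iff
proof (intro conjI ballI vsp_T vsp_sym_power sym_proj_lin)
  fix g x assume g: "g \<in> GL scale" and x: "x \<in> carrier (T t t)"
  show "sproj t (T_act scale t t g x) = sym_act scale t g (sproj t x)"
  proof (rule T_lin_eq[OF vsp_sym_power lin_comp[OF T_act_lin[OF GL_lin[OF g]] sym_proj_lin] lin_comp[OF sym_proj_lin sym_act_lin[OF GL_lin[OF g]]] _ x])
    fix vss assume vss: "vss \<in> blockwords t t"
    then obtain vs where vs: "length vs = t" "vss = singles vs" using blockwords_singles by blast
    have m: "map (map g) vss = singles (map g vs)" by (simp add: vs)
    have "sproj t (T_act scale t t g (btensor t t vss)) = sprod (map g vs)"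
      unfolding T_act_btensor[OF GL_lin[OF g] vss] m by (rule sym_proj_btensor) (simp add: vs)
    then show "sproj t (T_act scale t t g (btensor t t vss)) = sym_act scale t g (sproj t (btensor t t vss))"
      by (simp only: vs(2) sym_proj_btensor[OF vs(1)] sym_act_prod[OF GL_lin[OF g] vs(1)])
  qed
qed

lemma singles_btensor_multilinear: "multilinear (replicate t V) (T t t) (\<lambda>vs. btensor t t (singles vs))"
proof (rule multilinear_vecI)
  fix pre post :: "'v list" and x assume "length pre + length post + 1 = t"
  then have "singles (pre @ y # post) \<in> blockwords t t" for y by (intro singles_blockwords) simp
  from this[of 0] show lin: "(\<lambda>x. btensor t t (singles (pre @ x # post))) \<in> lin V (T t t)"
    using btensor_slot_vector[of "singles pre" "[]" "[]" "singles post" t t] by simp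
  from lin_closed[OF lin, of x] show "btensor t t (singles (pre @ x # post)) \<in> carrier (T t t)" by simp
qed (use t in simp)

text \<open>Permutations are composed of adjacent transpositions: the head of \<open>vs\<close> is moved to
  its place in \<open>ws\<close>, and the induction hypothesis takes care of the rest. The errors are
  collected in a set \<open>I\<close> that is closed under addition and accounts for each adjacent
  transposition.\<close>

lemma btensor_perm:
  assumes I0: "\<zero>\<^bsub>T t t\<^esub> \<in> I" and Ia: "\<And>a b. a \<in> I \<Longrightarrow> b \<in> I \<Longrightarrow> a \<oplus>\<^bsub>T t t\<^esub> b \<in> I" and Ic: "I \<subseteq> carrier (T t t)"
    and sw: "\<And>pre x y post. length pre + length post + 2 = t \<Longrightarrow>
      \<exists>i\<in>I. btensor t t (singles (pre @ x # y # post)) = btensor t t (singles (pre @ y # x # post)) \<oplus>\<^bsub>T t t\<^esub> i"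
    and l: "length (pre @ vs) = t" and m: "mset vs = mset ws"
  shows "\<exists>i\<in>I. btensor t t (singles (pre @ vs)) = btensor t t (singles (pre @ ws)) \<oplus>\<^bsub>T t t\<^esub> i"
proof -
  define e where "e vs = btensor t t (singles vs)" for vs
  have ec: "e vs \<in> carrier (T t t)" if "length vs = t" for vs
    using singles_btensor_closed that by (simp add: e_def)
  have tr: "\<exists>i\<in>I. e a = e c \<oplus>\<^bsub>T t t\<^esub> i"
    if "\<exists>i\<in>I. e a = e b \<oplus>\<^bsub>T t t\<^esub> i" "\<exists>i\<in>I. e b = e c \<oplus>\<^bsub>T t t\<^esub> i" "length c = t" for a b c
  proof -
    from that(1,2) obtain i j where ij: "i \<in> I" "j \<in> I" "e a = e c \<oplus>\<^bsub>T t t\<^esub> j \<oplus>\<^bsub>T t t\<^esub> i" by auto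
    then have "e a = e c \<oplus>\<^bsub>T t t\<^esub> (j \<oplus>\<^bsub>T t t\<^esub> i)"
      using Ic ec that(3) by (simp add: vsp_assoc[OF vsp_T] subset_iff)
    then show ?thesis using Ia ij by blast
  qed
  have re: "\<exists>i\<in>I. e a = e a \<oplus>\<^bsub>T t t\<^esub> i" if "length a = t" for a
    using I0 ec that by (intro bexI[of _ "\<zero>\<^bsub>T t t\<^esub>"]) (simp_all add: vsp_r_zero[OF vsp_T])
  have mv: "\<exists>i\<in>I. e (pre @ v # as @ bs) = e (pre @ as @ v # bs) \<oplus>\<^bsub>T t t\<^esub> i"
    if "length pre + length as + length bs + 1 = t" for pre v as bs
    using that
  proof (induct as arbitrary: pre)
    case Nil
    then show ?case using re[of "pre @ v # bs"] by simp
  next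
    case (Cons a as)
    have "\<exists>i\<in>I. e (pre @ v # a # as @ bs) = e (pre @ a # v # as @ bs) \<oplus>\<^bsub>T t t\<^esub> i"
      unfolding e_def using Cons(2) by (intro sw) simp
    moreover have "\<exists>i\<in>I. e (pre @ a # v # as @ bs) = e (pre @ a # as @ v # bs) \<oplus>\<^bsub>T t t\<^esub> i"
      using Cons(1)[of "pre @ [a]"] Cons(2) by simp
    ultimately show ?case using tr[of "pre @ v # a # as @ bs" "pre @ a # v # as @ bs" "pre @ a # as @ v # bs"] Cons(2) by simp
  qed
  show ?thesis unfolding e_def[symmetric] using l m
  proof (induct vs arbitrary: pre ws)
    case Nil
    then show ?case using re[of pre] by simp
  next
    case (Cons v vs)
    from Cons(3) have "v \<in> set ws" by (metis list.set_intros(1) mset_eq_setD)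
    then obtain as bs where ws: "ws = as @ v # bs" by (meson split_list)
    with Cons(3) have m: "mset vs = mset (as @ bs)" by simp
    from mset_eq_length[OF m] Cons(2) have l: "length pre + length as + length bs + 1 = t" by simp
    have "\<exists>i\<in>I. e (pre @ v # vs) = e (pre @ v # as @ bs) \<oplus>\<^bsub>T t t\<^esub> i"
      using Cons(1)[of "pre @ [v]" "as @ bs"] Cons(2) m by simp
    from tr[OF this mv[OF l]] show ?case using l by (simp add: ws)
  qed
qed

text \<open>A combination of words that vanishes in the symmetric power lies in the span of the relations. The
  multilinear relations vanish in $T_t^t$, and the permutation relations lie in \<open>I\<close> by
  \<open>btensor_perm\<close>. In the applications \<open>I\<close> is the image of the differential if
  \<open>t \<ge> 2\<close> and zero if \<open>t = 1\<close>.\<close>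

lemma sym_proj_kernel:
  assumes I0: "\<zero>\<^bsub>T t t\<^esub> \<in> I" and Ia: "\<And>a b. a \<in> I \<Longrightarrow> b \<in> I \<Longrightarrow> a \<oplus>\<^bsub>T t t\<^esub> b \<in> I" and Ic: "I \<subseteq> carrier (T t t)"
    and Is: "\<And>c a. a \<in> I \<Longrightarrow> c \<odot>\<^bsub>T t t\<^esub> a \<in> I"
    and sw: "\<And>pre x y post. length pre + length post + 2 = t \<Longrightarrow>
      \<exists>i\<in>I. btensor t t (singles (pre @ x # y # post)) = btensor t t (singles (pre @ y # x # post)) \<oplus>\<^bsub>T t t\<^esub> i"
    and x: "x \<in> carrier (T t t)" "sproj t x = \<zero>\<^bsub>Sym t\<^esub>"
  shows "x \<in> I"
proof -
  note N = vsp_T[of t t]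
  obtain u where u: "u \<in> supported {vs. length vs = t}" "x = singles_lin u" using singles_lin_surj[OF x(1)] by blast
  have "cls (sym_rels scale t) u = cls (sym_rels scale t) 0"
    using x(2) u by (simp add: sym_proj_singles_lin free_lift_sym_prod) (simp add: sym_power_def presented_zero)
  then have "u \<in> free.span (sym_rels scale t)" by (simp add: cls_eq_iff)
  then have "u \<in> supported {vs. length vs = t} \<and> singles_lin u \<in> I"
  proof (induct rule: free.span_induct_alt)
    case base
    show ?case using I0 by (simp add: singles_lin_def free_lift_0[OF N])
  next
    case (step c r v)
    have r: "r \<in> supported {vs. length vs = t}" using step(1) sym_rels_supported by blast
    have "singles_lin r \<in> I"
    proof (cases "r \<in> multilinear_rels (replicate t V)")
      case True
      then show ?thesis unfolding singles_lin_def using multilinear_kill[OF vsp_replicate N singles_btensor_multilinear] I0 by metis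
    next
      case False
      with step(1) obtain vs ws where vw: "r = gen vs - gen ws" "length vs = t" "mset vs = mset ws"
        by (auto simp: sym_rels_def)
      then have lw: "length ws = t" using mset_eq_length by metis
      let ?a = "btensor t t (singles vs)" and ?b = "btensor t t (singles ws)"
      obtain i where i: "i \<in> I" "?a = ?b \<oplus>\<^bsub>T t t\<^esub> i"
        using btensor_perm[OF I0 Ia Ic sw, of "[]" vs ws] vw by auto
      have "singles_lin r = ?a \<oplus>\<^bsub>T t t\<^esub> (-1) \<odot>\<^bsub>T t t\<^esub> ?b"
        unfolding singles_lin_def using vw lw
          free_lift_diff[OF N, of "{vs. length vs = t}" "\<lambda>vs. btensor t t (singles vs)" "gen vs" "gen ws"]
          free_lift_gen[OF N, of "{vs. length vs = t}" "\<lambda>vs. btensor t t (singles vs)"] singles_btensor_closed by simp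
      also have "\<dots> = i \<oplus>\<^bsub>T t t\<^esub> (?b \<oplus>\<^bsub>T t t\<^esub> (-1) \<odot>\<^bsub>T t t\<^esub> ?b)"
        using i Ic singles_btensor_closed[of ws] lw vsp_comm[OF N, of ?b i] by (simp add: vsp_assoc[OF N] vsp_closed[OF N] subset_iff)
      also have "\<dots> = i" using i Ic singles_btensor_closed[of ws] lw by (auto simp: vsp_minus_self[OF N] vsp_r_zero[OF N] subset_iff)
      finally show ?thesis using i by simp
    qed
    moreover have "singles_lin (free_scale c r + v) = c \<odot>\<^bsub>T t t\<^esub> singles_lin r \<oplus>\<^bsub>T t t\<^esub> singles_lin v"
      unfolding singles_lin_def using step(2) r
      by (subst free_lift_add[OF N singles_btensor_closed]) (auto simp only: free_lift_scale[OF N singles_btensor_closed r] intro: supported_scale)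
    ultimately show ?case using step(2) r Ia Is by (auto intro: supported_add supported_scale)
  qed
  then show ?thesis using u by simp
qed

end

section \<open>Exactness at the tensor power\<close>

text \<open>The witness is the boundary of the tensor with a factor \<open>x \<and> y\<close>, multiplied by
  the sign in \<open>rcobar_one_pair\<close>.\<close>

lemma swap_boundary:
  assumes t: "length pre + length post + 2 = t" and dim: "dimV \<ge> 2"
  shows "\<exists>i\<in>\<delta> t (t - 1) ` carrier (T t (t - 1)).
    btensor t t (singles (pre @ x # y # post)) = btensor t t (singles (pre @ y # x # post)) \<oplus>\<^bsub>T t t\<^esub> i"
proof -
  note N = vsp_T[of t t]
  let ?vss = "singles pre @ [x, y] # singles post" and ?s = "(-1) ^ length pre :: 'k"
  define p q where "p = btensor t t (singles (pre @ x # y # post))" and "q = btensor t t (singles (pre @ y # x # post))"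
  have t1: "t - 1 + 1 = t" using t by simp
  have bw: "?vss \<in> blockwords t (t - 1)" using t dim by (auto simp: blockwords_def length_concat comp_def sum_list_triv)
  have c: "p \<in> carrier (T t t)" "q \<in> carrier (T t t)"
    unfolding p_def q_def by (rule btensor_closed, rule singles_blockwords; use t dim in simp)+
  define i where "i = \<delta> t (t - 1) (?s \<odot>\<^bsub>T t (t - 1)\<^esub> btensor t (t - 1) ?vss)"
  have ss: "?s * ?s = 1" by (simp flip: power_add)
  have "i = ?s \<odot>\<^bsub>T t t\<^esub> btensor_lin t t (rcobar ?vss)"
    unfolding i_def using lin_smult[OF T_delta_lin btensor_closed[OF bw]] T_delta_btensor[OF bw] unfolding t1 by simp
  also have "btensor_lin t t (rcobar ?vss) = ?s \<odot>\<^bsub>T t t\<^esub> (p \<oplus>\<^bsub>T t t\<^esub> (-1) \<odot>\<^bsub>T t t\<^esub> q)"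
    unfolding p_def q_def by (rule free_lift_rcobar_pair[OF N c[unfolded p_def q_def]])
  also have "?s \<odot>\<^bsub>T t t\<^esub> \<dots> = p \<oplus>\<^bsub>T t t\<^esub> (-1) \<odot>\<^bsub>T t t\<^esub> q"
    using c by (simp add: vsp_closed[OF N] ss vsp_one_smult[OF N] flip: vsp_smult_assoc[OF N])
  finally have i: "i = p \<oplus>\<^bsub>T t t\<^esub> (-1) \<odot>\<^bsub>T t t\<^esub> q" .
  have "q \<oplus>\<^bsub>T t t\<^esub> i = p \<oplus>\<^bsub>T t t\<^esub> (q \<oplus>\<^bsub>T t t\<^esub> (-1) \<odot>\<^bsub>T t t\<^esub> q)"
    unfolding i using c by (intro vsp_lcomm[OF N] vsp_smult_closed[OF N])
  also have "\<dots> = p" using c by (simp only: vsp_minus_self[OF N] vsp_r_zero[OF N])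
  finally have "p = q \<oplus>\<^bsub>T t t\<^esub> i" ..
  moreover have "i \<in> \<delta> t (t - 1) ` carrier (T t (t - 1))"
    unfolding i_def by (rule imageI) (rule vsp_smult_closed[OF vsp_T btensor_closed[OF bw]])
  ultimately show ?thesis unfolding p_def q_def by blast
qed

text \<open>A list of \<open>t - 1\<close> nonempty blocks with \<open>t\<close> letters has exactly one block
  of two letters.\<close>

lemma sym_proj_T_delta:
  assumes t: "t \<ge> 2" and dim: "dimV \<ge> 2" and x: "x \<in> carrier (T t (t - 1))"
  shows "sproj t (\<delta> t (t - 1) x) = \<zero>\<^bsub>Sym t\<^esub>"
proof -
  note N = vsp_sym_power[of t]
  have t1: "t - 1 + 1 = t" "1 \<le> t" "1 \<le> dimV" "Suc (t - 1) = t" using t dim by auto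
  have dl: "\<delta> t (t - 1) \<in> lin (T t (t - 1)) (T t t)" using T_delta_lin[of t "t - 1"] t1 by simp
  note pl = sym_proj_lin[OF t1(2,3)]
  show ?thesis
  proof (rule T_lin_eq[OF N lin_comp[OF dl pl] lin_const_zero[OF N] _ x])
    fix vss assume vss: "vss \<in> blockwords t (t - 1)"
    then have "[] \<notin> set vss" "length (concat vss) = Suc (length vss)" using t1(4) by (auto simp: blockwords_def)
    from blocks_one_pair[OF this] obtain pre a c post where v: "vss = singles pre @ [a, c] # singles post" by blast
    let ?p = "pre @ a # c # post" and ?q = "pre @ c # a # post"
    have l: "length ?p = t" "length ?q = t" using vss v t by (auto simp: blockwords_def)
    have eq: "sproj t (btensor t t (singles ?p)) = sproj t (btensor t t (singles ?q))"
      unfolding sym_proj_btensor[OF t1(2,3) l(1)] sym_proj_btensor[OF t1(2,3) l(2)] by (rule sym_prod_perm) simp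
    have cl: "sproj t (btensor t t (singles ?q)) \<in> carrier (Sym t)"
      by (rule lin_closed[OF pl btensor_closed[OF singles_blockwords[OF t1(2,3) l(2)]]])
    have "\<delta> t (t - 1) (btensor t (t - 1) vss) = btensor_lin t t (rcobar vss)"
      using T_delta_btensor[OF vss] unfolding t1(1) .
    then have "sproj t (\<delta> t (t - 1) (btensor t (t - 1) vss))
       = free_lift (Sym t) (\<lambda>vss. sproj t (btensor t t vss)) (rcobar vss)"
      using lin_free_lift[OF vsp_T btensor_closed N pl rcobar_blockwords[OF vss, unfolded t1(4)]] by simp
    also have "\<dots> = (-1) ^ length pre \<odot>\<^bsub>Sym t\<^esub> (sproj t (btensor t t (singles ?p))
        \<oplus>\<^bsub>Sym t\<^esub> (-1) \<odot>\<^bsub>Sym t\<^esub> sproj t (btensor t t (singles ?q)))"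
      unfolding v by (rule free_lift_rcobar_pair[OF N, where f = "\<lambda>vss. sproj t (btensor t t vss)"]) (simp_all only: eq cl)
    finally show "sproj t (\<delta> t (t - 1) (btensor t (t - 1) vss)) = \<zero>\<^bsub>Sym t\<^esub>"
      unfolding eq vsp_minus_self[OF N cl] vsp_smult_zero[OF N] .
  qed
qed

lemma sym_proj_kernel_image:
  assumes t: "t \<ge> 2" and dim: "dimV \<ge> 2"
  shows "\<delta> t (t - 1) ` carrier (T t (t - 1)) = a_kernel (T t t) (Sym t) (sproj t)"
proof -
  have t1: "t - 1 + 1 = t" "1 \<le> t" "1 \<le> dimV" using t dim by auto
  have dl: "\<delta> t (t - 1) \<in> lin (T t (t - 1)) (T t t)" using T_delta_lin[of t "t - 1"] t1 by simp
  let ?I = "\<delta> t (t - 1) ` carrier (T t (t - 1))"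
  show ?thesis unfolding a_kernel_def'
  proof (intro equalityI subsetI)
    fix y assume "y \<in> ?I"
    then show "y \<in> {x \<in> carrier (T t t). sproj t x = \<zero>\<^bsub>Sym t\<^esub>}"
      using sym_proj_T_delta[OF t dim] lin_closed[OF dl] by auto
  next
    fix x assume x: "x \<in> {x \<in> carrier (T t t). sproj t x = \<zero>\<^bsub>Sym t\<^esub>}"
    show "x \<in> ?I"
    proof (rule sym_proj_kernel[OF t1(2,3)])
      note im = lin_image_closed[OF vsp_T vsp_T dl]
      show "\<zero>\<^bsub>T t t\<^esub> \<in> ?I" by (rule im(1))
      show "a \<oplus>\<^bsub>T t t\<^esub> c \<in> ?I" if "a \<in> ?I" "c \<in> ?I" for a c by (rule im(2)[OF that])
      show "k \<odot>\<^bsub>T t t\<^esub> a \<in> ?I" if "a \<in> ?I" for k a by (rule im(3)[OF that])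
      show "?I \<subseteq> carrier (T t t)" using lin_closed[OF dl] by auto
      show "\<exists>i\<in>?I. btensor t t (singles (pre @ y # z # post)) = btensor t t (singles (pre @ z # y # post)) \<oplus>\<^bsub>T t t\<^esub> i"
        if "length pre + length post + 2 = t" for pre y z post
        by (rule swap_boundary[OF that dim])
      show "x \<in> carrier (T t t)" "sproj t x = \<zero>\<^bsub>Sym t\<^esub>" using x by blast+
    qed
  qed
qed

text \<open>For \<open>t = 1\<close> there are no adjacent transpositions, so the zero subspace is admissible
  in \<open>sym_proj_kernel\<close>.\<close>

lemma sym_proj_injective_1:
  assumes dim: "dimV \<ge> 1"
  shows "a_kernel (T 1 1) (Sym 1) (sproj 1) = {\<zero>\<^bsub>T 1 1\<^esub>}"
  unfolding a_kernel_def'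
proof (intro equalityI subsetI)
  fix x assume x: "x \<in> {x \<in> carrier (T 1 1). sproj 1 x = \<zero>\<^bsub>Sym 1\<^esub>}"
  show "x \<in> {\<zero>\<^bsub>T 1 1\<^esub>}"
    by (rule sym_proj_kernel[OF order_refl dim])
      (use x in \<open>auto simp: vsp_l_zero[OF vsp_T] vsp_smult_zero[OF vsp_T] vsp_zero_closed[OF vsp_T]\<close>)
next
  fix x assume "x \<in> {\<zero>\<^bsub>T 1 1\<^esub>}"
  then show "x \<in> {x \<in> carrier (T 1 1). sproj 1 x = \<zero>\<^bsub>Sym 1\<^esub>}"
    using lin_zero[OF vsp_T vsp_sym_power sym_proj_lin[OF order_refl dim]] by (simp add: vsp_zero_closed[OF vsp_T])
qed

end

section \<open>Left multiplication in the exterior algebra\<close>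

text \<open>Left multiplication by the basis vector \<open>k\<close> on the exterior algebra with increasing
  words as a basis: sort the new letter in and count the letters it passes.\<close>

fun wedge_left :: "nat \<Rightarrow> nat list \<Rightarrow> (nat list \<Rightarrow>\<^sub>0 'k::field)" where
  "wedge_left k [] = gen [k]"
| "wedge_left k (x # S) = (if k < x then gen (k # x # S) else if k = x then 0 else - free_ext (\<lambda>S. gen (x # S)) (wedge_left k S))"

lemma wedge_left_Cons_greater: "x < k \<Longrightarrow> free_ext (wedge_left k) (free_ext (\<lambda>S. gen (x # S)) u) = - free_ext (\<lambda>S. gen (x # S)) (free_ext (wedge_left k) u)"
  by (simp add: free_ext_comp free_ext_fun_neg)

lemma wedge_left_square: "free_ext (wedge_left k) (wedge_left k S) = (0 :: nat list \<Rightarrow>\<^sub>0 'k::field)"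
proof (induct S)
  case (Cons x S)
  then show ?case by (auto simp: free_ext_neg wedge_left_Cons_greater)
qed simp

lemma wedge_left_anticommute_less:
  assumes "k < l"
  shows "free_ext (wedge_left k) (wedge_left l S) + free_ext (wedge_left l) (wedge_left k S) = (0 :: nat list \<Rightarrow>\<^sub>0 'k::field)"
proof (induct S)
  case Nil
  then show ?case using assms by (simp add: free_ext_neg)
next
  case (Cons x S)
  let ?p = "\<lambda>x. free_ext (\<lambda>S. gen (x # S)) :: (nat list \<Rightarrow>\<^sub>0 'k) \<Rightarrow> _"
  consider "k < x" | "k = x" | "x < k" by linarith
  then show ?case
  proof cases
    case 1
    then show ?thesis using assms
      by (cases l x rule: linorder_cases) (auto simp: free_ext_neg free_ext_comp)
  next
    case 2
    then show ?thesis using assms by (auto simp: free_ext_neg free_ext_comp)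
  next
    case 3
    then have "free_ext (wedge_left k) (wedge_left l (x # S)) + free_ext (wedge_left l) (wedge_left k (x # S))
      = ?p x (free_ext (wedge_left k) (wedge_left l S) + free_ext (wedge_left l) (wedge_left k S))"
      using assms by (simp add: free_ext_neg wedge_left_Cons_greater free_ext_add)
    then show ?thesis using Cons by simp
  qed
qed

lemma wedge_left_anticommute:
  assumes "k \<noteq> l"
  shows "free_ext (wedge_left k) (free_ext (wedge_left l) u) + free_ext (wedge_left l) (free_ext (wedge_left k) u) = (0 :: nat list \<Rightarrow>\<^sub>0 'k::field)"
proof -
  have "free_ext (wedge_left k) (wedge_left l S) + free_ext (wedge_left l) (wedge_left k S) = (0 :: nat list \<Rightarrow>\<^sub>0 'k)" for S
    using wedge_left_anticommute_less[of k l S] wedge_left_anticommute_less[of l k S] assms by (cases k l rule: linorder_cases) (auto simp: add.commute)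
  then show ?thesis by (simp add: free_ext_comp flip: free_ext_fun_add)
qed

text \<open>The square of multiplication by a vector with coordinates \<open>c\<close> vanishes. Adding one
  basis vector at a time uses anticommutation for different basis vectors and the vanishing of the squares
  separately, so that no division by 2 occurs.\<close>

lemma combination_square_zero:
  "free_ext (\<lambda>S. \<Sum>k<n. free_scale (c k) (wedge_left k S)) (\<Sum>k<n. free_scale (c k) (free_ext (wedge_left k) u)) = (0 :: nat list \<Rightarrow>\<^sub>0 'k::field)"
proof -
  define op where "op m u = (\<Sum>k<m. free_scale (c k) (free_ext (wedge_left k) u))" for m and u :: "nat list \<Rightarrow>\<^sub>0 'k"
  have op: "free_ext (\<lambda>S. \<Sum>k<m. free_scale (c k) (wedge_left k S)) u = op m u" for m u
    unfolding op_def by (simp add: free_ext_fun_sum free_ext_fun_scale)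
  have add: "op m (u + v) = op m u + op m v" and sc: "op m (free_scale a u) = free_scale a (op m u)" for m u v a
    unfolding op[symmetric] by (simp_all add: free_ext_simps)
  have anti: "op m (free_ext (wedge_left l) u) + free_ext (wedge_left l) (op m u) = 0" if "m \<le> l" for m l u
    using that
  proof (induct m)
    case (Suc m)
    have "op (Suc m) (free_ext (wedge_left l) u) + free_ext (wedge_left l) (op (Suc m) u)
      = (op m (free_ext (wedge_left l) u) + free_ext (wedge_left l) (op m u))
        + free_scale (c m) (free_ext (wedge_left m) (free_ext (wedge_left l) u) + free_ext (wedge_left l) (free_ext (wedge_left m) u))"
      by (simp add: op_def free_ext_add free_ext_scale free.scale_right_distrib)
    then show ?case using Suc wedge_left_anticommute[of m l u] by simp
  qed (simp add: op_def)
  have "op m (op m u) = 0" for m u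
  proof (induct m)
    case (Suc m)
    have S: "op (Suc m) u = op m u + free_scale (c m) (free_ext (wedge_left m) u)" for u by (simp add: op_def)
    have "op (Suc m) (op (Suc m) u) = op m (op m u)
        + free_scale (c m) (op m (free_ext (wedge_left m) u) + free_ext (wedge_left m) (op m u))
        + free_scale (c m * c m) (free_ext (wedge_left m) (free_ext (wedge_left m) u))"
      by (simp only: S add sc free_ext_add free_ext_scale free.scale_right_distrib free.scale_scale add.assoc)
        (simp add: algebra_simps)
    then show ?case by (simp add: Suc anti free_ext_comp wedge_left_square)
  qed (simp add: op_def)
  then show ?thesis unfolding op op_def[symmetric] .
qed

lemma wedge_left_increasing: "sorted_wrt (<) (k # S) \<Longrightarrow> wedge_left k S = gen (k # S)"
  by (cases S) auto

text \<open>The tensor product of elements of free spaces, as an element of the free space on lists.\<close>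

fun tprod :: "('x \<Rightarrow>\<^sub>0 'k::field) list \<Rightarrow> ('x list \<Rightarrow>\<^sub>0 'k)" where
  "tprod [] = gen []"
| "tprod (u # us) = free_ext (\<lambda>S. free_ext (\<lambda>Ss. gen (S # Ss)) (tprod us)) u"

lemma tprod_gen: "tprod (map gen Ss) = gen Ss"
  by (induct Ss) simp_all

abbreviation Free :: "('k::field, 'x \<Rightarrow>\<^sub>0 'k) module" where "Free \<equiv> vec_module free_scale"

lemma vsp_Free: "vsp Free"
  by (rule vsp_vec_module[OF vector_space_free_scale])

lemma free_ext_lin: "free_ext f \<in> lin Free Free"
  by (rule linI) (simp_all add: free_ext_add free_ext_scale)

lemma tprod_slot: "j < length us \<Longrightarrow> (\<lambda>x. tprod (us[j := x])) \<in> lin Free Free"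
proof (induct us arbitrary: j)
  case (Cons u us)
  show ?case
  proof (cases j)
    case 0
    then show ?thesis by (simp add: free_ext_lin)
  next
    case (Suc i)
    then have *: "(\<lambda>x. tprod (us[i := x])) \<in> lin Free Free" using Cons by simp
    have "(\<lambda>x. tprod ((u # us)[j := x])) = (\<lambda>x. free_ext (\<lambda>S. free_ext (\<lambda>Ss. gen (S # Ss)) (tprod (us[i := x]))) u)"
      by (simp add: Suc)
    also have "\<dots> \<in> lin Free Free"
      by (rule linI) (simp_all add: lin_add[OF *, simplified] lin_smult[OF *, simplified] free_ext_add free_ext_scale
          free_ext_fun_add free_ext_fun_scale)
    finally show ?thesis .
  qed
qed simp

lemma free_lift_Free: "free_lift Free f u = free_ext f u"
proof -
  have "u \<in> supported UNIV" by (simp add: supported_def)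
  then show ?thesis
  proof (induct rule: supported_induct)
    case zero
    show ?case by (simp add: free_lift_0[OF vsp_Free])
  next
    case (step c x v)
    then show ?case
      by (simp add: free_lift_add[OF vsp_Free, of UNIV] free_lift_scale[OF vsp_Free, of UNIV] free_lift_gen[OF vsp_Free, of UNIV]
          supported_scale free_ext_add free_ext_scale)
  qed
qed

section \<open>Coordinates on the terms of the complex\<close>

text \<open>A basis with its dual basis.\<close>

locale exterior_basis = exterior scale for scale :: "'k::field \<Rightarrow> 'v::ab_group_add \<Rightarrow> 'v" +
  fixes b :: "nat \<Rightarrow> 'v" and coord :: "nat \<Rightarrow> 'v \<Rightarrow> 'k"
  assumes coord_add: "coord k (v + w) = coord k v + coord k w"
    and coord_scale: "coord k (scale c v) = c * coord k v"
    and coord_basis: "j < dimV \<Longrightarrow> k < dimV \<Longrightarrow> coord k (b j) = (if k = j then 1 else 0)"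
    and basis_expansion: "(\<Sum>k<dimV. scale (coord k v) (b k)) = v"
begin

definition left_mult :: "'v \<Rightarrow> nat list \<Rightarrow> (nat list \<Rightarrow>\<^sub>0 'k)" where
  "left_mult v S = (\<Sum>k<dimV. free_scale (coord k v) (wedge_left k S))"

text \<open>The coordinates of a wedge: apply the left multiplications by its factors to the unit of the
  exterior algebra. The result is alternating by \<open>left_mult_square\<close>.\<close>

fun wedge_coords :: "'v list \<Rightarrow> (nat list \<Rightarrow>\<^sub>0 'k)" where
  "wedge_coords [] = gen []"
| "wedge_coords (v # vs) = free_ext (left_mult v) (wedge_coords vs)"

lemma left_mult_sum: "free_ext (left_mult v) u = (\<Sum>k<dimV. free_scale (coord k v) (free_ext (wedge_left k) u))"
  by (simp add: left_mult_def[abs_def] free_ext_fun_sum free_ext_fun_scale)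

lemma left_mult_lin: "(\<lambda>v. free_ext (left_mult v) u) \<in> lin V Free"
  by (rule linI) (simp_all add: left_mult_sum coord_add coord_scale free.scale_left_distrib sum.distrib free.scale_sum_right)

lemma left_mult_square: "free_ext (left_mult v) (free_ext (left_mult v) u) = 0"
  using combination_square_zero[of "\<lambda>k. coord k v" dimV u]
  by (simp add: left_mult_sum[of v u]) (simp add: left_mult_def[abs_def])

lemma wedge_coords_multilinear: "multilinear (replicate i V) Free wedge_coords"
proof (rule multilinear_vecI)
  fix pre post :: "'v list"
  show "(\<lambda>x. wedge_coords (pre @ x # post)) \<in> lin V Free"
  proof (induct pre)
    case (Cons v pre)
    from lin_comp[OF this free_ext_lin] show ?case by simp
  qed (simp add: left_mult_lin)
qed simp_all

lemma wedge_coords_adjacent: "wedge_coords (pre @ x # x # post) = 0"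
  by (induct pre) (simp_all add: left_mult_square)

lemma wedge_coords_basis:
  assumes "sorted_wrt (<) S" "set S \<subseteq> {..<dimV}"
  shows "wedge_coords (map b S) = gen S"
  using assms
proof (induct S)
  case (Cons k S)
  have "left_mult (b k) S = (\<Sum>j<dimV. if j = k then wedge_left k S else 0)"
    unfolding left_mult_def by (rule sum.cong) (use Cons.prems in \<open>auto simp: coord_basis\<close>)
  also have "\<dots> = wedge_left k S" using Cons.prems by simp
  also have "\<dots> = gen (k # S)" by (rule wedge_left_increasing) (use Cons.prems in simp)
  finally show ?case using Cons by simp
qed simp

abbreviation ext_coords :: "('v list \<Rightarrow>\<^sub>0 'k) set \<Rightarrow> (nat list \<Rightarrow>\<^sub>0 'k)" where
  "ext_coords \<equiv> quot_lift Free wedge_coords"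

lemma ext_coords_lin: "ext_coords \<in> lin (\<Lambda> i) Free"
  by (rule ext_lift_lin[OF vsp_Free wedge_coords_multilinear]) (simp add: wedge_coords_adjacent)

lemma ext_coords_wedge: "ext_coords (wdg vs) = wedge_coords vs"
  by (rule ext_lift_wedge[OF vsp_Free wedge_coords_multilinear _ refl]) (simp add: wedge_coords_adjacent)

definition tensor_coords :: "(('v list \<Rightarrow>\<^sub>0 'k) set list \<Rightarrow>\<^sub>0 'k) set \<Rightarrow> (nat list list \<Rightarrow>\<^sub>0 'k)" where
  "tensor_coords = quot_lift Free (\<lambda>\<alpha>s. tprod (map ext_coords \<alpha>s))"

lemma tprod_coords_multilinear: "multilinear (map \<Lambda> c) Free (\<lambda>\<alpha>s. tprod (map ext_coords \<alpha>s))"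
  unfolding multilinear_def
proof (intro ballI conjI allI impI)
  fix \<alpha>s j assume \<alpha>s: "\<alpha>s \<in> ext_lists c" and "j < length (map \<Lambda> c)"
  then have j: "j < length c" "j < length (map ext_coords \<alpha>s)" by (auto simp only: ext_lists_iff length_map)
  from lin_comp[OF ext_coords_lin tprod_slot[OF j(2)]]
  show "(\<lambda>x. tprod (map ext_coords (\<alpha>s[j := x]))) \<in> lin (map \<Lambda> c ! j) Free"
    using j(1) by (simp add: map_update)
qed simp

lemma tensor_coords_lin: "tensor_coords \<in> lin (\<Lambda>s c) Free"
  unfolding tensor_coords_def ext_tensor_def by (rule tensor_lift_lin[OF vsp_ext_powers vsp_Free tprod_coords_multilinear])

lemma tensor_coords_wedges: "tensor_coords (epure (map length vss) (map wdg vss)) = tprod (map wedge_coords vss)"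
  unfolding tensor_coords_def ext_pure_def
  by (subst tensor_lift_pure[OF vsp_ext_powers vsp_Free tprod_coords_multilinear wedges_mem]) (simp add: comp_def ext_coords_wedge)

definition T_coords :: "nat \<Rightarrow> nat \<Rightarrow> (nat list \<Rightarrow> (('v list \<Rightarrow>\<^sub>0 'k) set list \<Rightarrow>\<^sub>0 'k) set) \<Rightarrow> (nat list list \<Rightarrow>\<^sub>0 'k)" where
  "T_coords t p x = finsum Free (\<lambda>c. tensor_coords (x c)) (comps dimV t p)"

lemma T_coords_lin: "T_coords t p \<in> lin (T t p) Free"
  unfolding T_coords_def[abs_def] T_space_def
  by (rule dsum_lift_in(1)) (rule vsp_ext_tensor finite_comps vsp_Free tensor_coords_lin)+

abbreviation bmap :: "nat list list \<Rightarrow> 'v list list" where "bmap \<equiv> map (map b)"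

lemma T_coords_btensor:
  assumes "vss \<in> blockwords t p"
  shows "T_coords t p (btensor t p vss) = tprod (map wedge_coords vss)"
proof -
  have "T_coords t p (btensor t p vss) = tensor_coords (epure (map length vss) (map wdg vss))"
    unfolding T_coords_def btensor_def T_in_def
    by (rule dsum_lift_in(2)) (rule vsp_ext_tensor finite_comps vsp_Free tensor_coords_lin ext_pure_closed[OF wedges_mem]
      assms[unfolded blockwords_comps])+
  then show ?thesis by (simp only: tensor_coords_wedges)
qed

lemma inc_words_blockwords:
  assumes "bs \<in> inc_words dimV t p"
  shows "bmap bs \<in> blockwords t p"
proof -
  have "length B \<le> dimV" if "B \<in> set bs" for B
  proof -
    have "sorted_wrt (<) B" "set B \<subseteq> {..<dimV}" using assms that by (auto simp: inc_words_def inc_blocks_def)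
    then have "card (set B) = length B" "card (set B) \<le> dimV"
      using card_mono[of "{..<dimV}" "set B"] by (auto simp: strict_sorted_iff distinct_card)
    then show ?thesis by simp
  qed
  then show ?thesis using assms by (auto simp: blockwords_def inc_words_def inc_blocks_def length_concat comp_def)
qed

lemma T_coords_basis:
  assumes "bs \<in> inc_words dimV t p"
  shows "T_coords t p (btensor t p (bmap bs)) = gen bs"
proof -
  have "map wedge_coords (bmap bs) = map gen bs"
    using assms wedge_coords_basis by (auto simp: inc_words_def inc_blocks_def)
  then show ?thesis by (simp only: T_coords_btensor[OF inc_words_blockwords[OF assms]] tprod_gen)
qed

subsection \<open>Generation by basis vectors\<close>

lemma basis_spans_V: "v \<in> lspan V (b ` {..<dimV})"
proof -
  have "(\<Sum>k<m. scale (coord k v) (b k)) \<in> lspan V (b ` {..<dimV})" if "m \<le> dimV" for m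
    using that
  proof (induct m)
    case 0
    show ?case using lspan_zero[of V] by simp
  next
    case (Suc m)
    then show ?case
      using lspan_add[of "\<Sum>k<m. scale (coord k v) (b k)" V "b ` {..<dimV}" "scale (coord m v) (b m)"]
        lspan_smult[of "b m" V "b ` {..<dimV}" "coord m v"] by (simp add: lspan_base)
  qed
  then show ?thesis using basis_expansion[of v] by (metis order_refl)
qed

definition basis_words :: "'v list set" where
  "basis_words = map b ` {S. sorted_wrt (<) S \<and> set S \<subseteq> {..<dimV}}"

text \<open>Sort the word: swapping neighbours that are out of order reduces the number of inversions and only
  changes the sign.\<close>

lemma wedge_basis_lspan:
  "set S \<subseteq> {..<dimV} \<Longrightarrow> length S = i \<Longrightarrow> wdg (map b S) \<in> lspan (\<Lambda> i) (wdg ` {vs \<in> basis_words. length vs = i})"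
proof (induct "inversions S" arbitrary: S rule: less_induct)
  case less
  note N = vsp_ext_power[of i]
  show ?case
  proof (cases "sorted_wrt (<) S")
    case True
    then show ?thesis using less.prems by (intro lspan_base) (auto simp: basis_words_def)
  next
    case False
    then obtain pre x y post where S: "S = pre @ x # y # post" "y \<le> x" using not_increasing_split by blast
    show ?thesis
    proof (cases "y = x")
      case True
      then have "\<not> distinct (map b S)" by (simp add: S)
      then have "wdg (map b S) = \<zero>\<^bsub>\<Lambda> i\<^esub>" using less.prems by (intro wedge_not_distinct) simp
      then show ?thesis by (simp add: lspan_zero)
    next
      case False
      let ?S = "pre @ y # x # post"
      have "y < x" using S(2) False by simp
      then have inv: "inversions ?S < inversions S" by (simp add: S(1) inversions_append add_mset_commute[of y x])
      have IH: "wdg (map b ?S) \<in> lspan (\<Lambda> i) (wdg ` {vs \<in> basis_words. length vs = i})"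
        by (rule less.hyps[OF inv]) (use less.prems S in auto)
      let ?u = "wdg (map b S)" and ?w = "wdg (map b ?S)"
      have c: "?u \<in> carrier (\<Lambda> i)" "?w \<in> carrier (\<Lambda> i)"
        using less.prems S by (auto intro!: wedge_closed)
      have "?u \<oplus>\<^bsub>\<Lambda> i\<^esub> ?w = \<zero>\<^bsub>\<Lambda> i\<^esub>"
        using wedge_swap[of "map b pre" "map b post" i "b x" "b y"] less.prems S by simp
      then have "?u = (?u \<oplus>\<^bsub>\<Lambda> i\<^esub> ?w) \<oplus>\<^bsub>\<Lambda> i\<^esub> (-1) \<odot>\<^bsub>\<Lambda> i\<^esub> ?w \<Longrightarrow> ?u = (-1) \<odot>\<^bsub>\<Lambda> i\<^esub> ?w"
        using c by (simp add: vsp_l_zero[OF N] vsp_smult_closed[OF N])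
      moreover have "?u = (?u \<oplus>\<^bsub>\<Lambda> i\<^esub> ?w) \<oplus>\<^bsub>\<Lambda> i\<^esub> (-1) \<odot>\<^bsub>\<Lambda> i\<^esub> ?w"
        using c by (simp add: vsp_assoc[OF N] vsp_smult_closed[OF N] vsp_minus_self[OF N] vsp_r_zero[OF N])
      ultimately have "?u = (-1) \<odot>\<^bsub>\<Lambda> i\<^esub> ?w" by blast
      then show ?thesis using lspan_smult[OF IH, of "-1"] by simp
    qed
  qed
qed

lemma ext_power_basis_generators:
  assumes "a \<in> carrier (\<Lambda> i)"
  shows "a \<in> lspan (\<Lambda> i) (wdg ` {vs \<in> basis_words. length vs = i})"
proof (rule lspan_trans[OF wedge_generators[OF assms]], rule image_subsetI)
  fix vs :: "'v list" assume "vs \<in> {vs. length vs = i}"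
  then have vs: "vs \<in> listset (map carrier (replicate i V))" "length vs = i" by auto
  let ?Ms = "replicate i V"
  have "wdg vs \<in> lspan (\<Lambda> i)
      (wdg ` {gs. length gs = length ?Ms \<and> (\<forall>j<length ?Ms. gs ! j \<in> b ` {..<dimV})})"
    by (rule multilinear_lspan[OF vsp_replicate vsp_ext_power wedge_multilinear _ _ vs(1)]) (auto intro: basis_spans_V)
  then show "wdg vs \<in> lspan (\<Lambda> i) (wdg ` {vs \<in> basis_words. length vs = i})"
  proof (rule lspan_trans, intro image_subsetI)
    fix gs assume "gs \<in> {gs. length gs = length ?Ms \<and> (\<forall>j<length ?Ms. gs ! j \<in> b ` {..<dimV})}"
    then have l: "length gs = i" and "\<forall>j<i. \<exists>k<dimV. gs ! j = b k" by auto
    then obtain f where f: "\<And>j. j < i \<Longrightarrow> f j < dimV \<and> gs ! j = b (f j)" by metis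
    have "gs = map b (map f [0..<i])" using f l by (intro nth_equalityI) auto
    moreover have "wdg (map b (map f [0..<i])) \<in> lspan (\<Lambda> i) (wdg ` {vs \<in> basis_words. length vs = i})"
      by (rule wedge_basis_lspan) (use f in auto)
    ultimately show "wdg gs \<in> lspan (\<Lambda> i) (wdg ` {vs \<in> basis_words. length vs = i})" by simp
  qed
qed

text \<open>Combinations of increasing blocks of indices as elements of $T_t^p$. By
  \<open>basis_lin_surj\<close> and \<open>T_coords_basis_lin\<close> this is an isomorphism on the
  combinations supported in \<open>inc_words dimV t p\<close>, and by \<open>T_delta_basis_lin\<close> it
  commutes with the differentials.\<close>

definition basis_lin :: "nat \<Rightarrow> nat \<Rightarrow> (nat list list \<Rightarrow>\<^sub>0 'k) \<Rightarrow> _" where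
  "basis_lin t p = free_lift (T t p) (\<lambda>bs. btensor t p (bmap bs))"

lemma basis_btensor_closed: "bs \<in> inc_words dimV t p \<Longrightarrow> btensor t p (bmap bs) \<in> carrier (T t p)"
  by (rule btensor_closed[OF inc_words_blockwords])

lemma basis_lin_closed: "u \<in> supported (inc_words dimV t p) \<Longrightarrow> basis_lin t p u \<in> carrier (T t p)"
  unfolding basis_lin_def by (rule free_lift_closed[OF vsp_T basis_btensor_closed])

lemma basis_lin_surj:
  assumes "x \<in> carrier (T t p)"
  shows "\<exists>u\<in>supported (inc_words dimV t p). x = basis_lin t p u"
  unfolding basis_lin_def
proof (rule lspan_free_lift[OF vsp_T basis_btensor_closed])
  have "{vss \<in> blockwords t p. set vss \<subseteq> basis_words} \<subseteq> bmap ` inc_words dimV t p"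
  proof clarify
    fix vss assume vss: "vss \<in> blockwords t p" "set vss \<subseteq> basis_words"
    then have "\<forall>vs\<in>set vss. \<exists>S. sorted_wrt (<) S \<and> set S \<subseteq> {..<dimV} \<and> vs = map b S" by (auto simp: basis_words_def)
    then obtain f where f: "\<And>vs. vs \<in> set vss \<Longrightarrow> sorted_wrt (<) (f vs) \<and> set (f vs) \<subseteq> {..<dimV} \<and> vs = map b (f vs)" by metis
    have eq: "vss = bmap (map f vss)" using f by (induct vss) auto
    have "map f vss \<in> inc_words dimV t p"
    proof -
      have "map length (map f vss) = map length vss" using f by simp (metis length_map)
      then have "length (concat (map f vss)) = length (concat vss)" by (simp only: length_concat)
      moreover have "f vs \<noteq> []" if "vs \<in> set vss" for vs using f[OF that] vss(1) that by (auto simp: blockwords_def)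
      ultimately show ?thesis using f vss(1) by (auto simp: inc_words_def inc_blocks_def blockwords_def)
    qed
    with eq show "vss \<in> bmap ` inc_words dimV t p" by (rule image_eqI)
  qed
  then show "x \<in> lspan (T t p) ((\<lambda>bs. btensor t p (bmap bs)) ` inc_words dimV t p)"
    by (intro lspan_trans[OF T_generators_of[OF ext_power_basis_generators assms]]) (auto intro!: lspan_base)
qed

lemma T_coords_basis_lin:
  assumes u: "u \<in> supported (inc_words dimV t p)"
  shows "T_coords t p (basis_lin t p u) = u"
proof -
  have "T_coords t p (basis_lin t p u) = free_lift Free (\<lambda>bs. T_coords t p (btensor t p (bmap bs))) u"
    unfolding basis_lin_def by (rule lin_free_lift[OF vsp_T basis_btensor_closed vsp_Free T_coords_lin u])
  also have "\<dots> = u"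
    unfolding free_lift_Free by (rule free_ext_eq_id[OF u]) (rule T_coords_basis)
  finally show ?thesis .
qed

lemma T_delta_basis_lin:
  assumes u: "u \<in> supported (inc_words dimV t p)"
  shows "\<delta> t p (basis_lin t p u) = basis_lin t (p + 1) (free_ext rcobar u)"
proof -
  have B: "basis_lin t p u = btensor_lin t p (free_ext (\<lambda>bs. gen (bmap bs)) u)"
    if u: "u \<in> supported (inc_words dimV t p)" for p u
  proof -
    have "btensor_lin t p (free_ext (\<lambda>bs. gen (bmap bs)) u) = free_lift (T t p) (\<lambda>bs. btensor_lin t p (gen (bmap bs))) u"
      by (rule free_lift_free_ext[OF vsp_T btensor_closed _ u]) (assumption | rule supported_gen[THEN iffD2] inc_words_blockwords)+
    also have "\<dots> = basis_lin t p u"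
      unfolding basis_lin_def
      by (rule free_lift_cong[OF vsp_T basis_btensor_closed u])
        (assumption | rule free_lift_gen[OF vsp_T btensor_closed inc_words_blockwords])+
    finally show ?thesis ..
  qed
  have "free_ext (\<lambda>bs. gen (bmap bs)) u \<in> supported (blockwords t p)"
    using u by (rule free_ext_supported) (rule supported_gen[THEN iffD2, OF inc_words_blockwords])
  then have "\<delta> t p (basis_lin t p u) = btensor_lin t (p + 1) (free_ext rcobar (free_ext (\<lambda>bs. gen (bmap bs)) u))"
    unfolding B[OF u] by (rule T_delta_btensor_lin)
  also have "free_ext rcobar (free_ext (\<lambda>bs. gen (bmap bs)) u) = free_ext (\<lambda>bs. gen (bmap bs)) (free_ext rcobar u)"
    by (simp only: free_ext_comp free_ext_gen rcobar_map)
  also have "btensor_lin t (p + 1) \<dots> = basis_lin t (p + 1) (free_ext rcobar u)"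
    using rcobar_inc_words by (intro B[symmetric] free_ext_supported[OF u]) simp
  finally show ?thesis .
qed

section \<open>Exactness below the tensor power\<close>

text \<open>Transport of \<open>rcobar_exact\<close> along \<open>basis_lin\<close>.\<close>

lemma T_delta_exact:
  assumes "Suc p < t" "x \<in> carrier (T t (Suc p))" "\<delta> t (Suc p) x = \<zero>\<^bsub>T t (Suc p + 1)\<^esub>"
  shows "\<exists>u\<in>supported (inc_words dimV t p). x = basis_lin t (Suc p) (free_ext rcobar u)"
proof -
  obtain u where u: "u \<in> supported (inc_words dimV t (Suc p))" "x = basis_lin t (Suc p) u" using basis_lin_surj[OF assms(2)] by blast
  have ru: "free_ext rcobar u \<in> supported (inc_words dimV t (Suc p + 1))"
    using rcobar_inc_words by (intro free_ext_supported[OF u(1)]) simp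
  have "basis_lin t (Suc p + 1) (free_ext rcobar u) = \<zero>\<^bsub>T t (Suc p + 1)\<^esub>"
    using T_delta_basis_lin[OF u(1)] u(2) assms(3) by simp
  then have "free_ext rcobar u = 0"
    using T_coords_basis_lin[OF ru] lin_zero[OF vsp_T vsp_Free T_coords_lin, of t "Suc p + 1"] by simp
  then show ?thesis using rcobar_exact[OF u(1) assms(1)] u(2) by blast
qed

lemma T_delta_injective:
  assumes "1 < t" "x \<in> carrier (T t 1)" "\<delta> t 1 x = \<zero>\<^bsub>T t 2\<^esub>"
  shows "x = \<zero>\<^bsub>T t 1\<^esub>"
proof -
  have "inc_words dimV t 0 = {}" using assms(1) by (auto simp: inc_words_def)
  then show ?thesis using T_delta_exact[of 0 t x] assms
    by (auto simp: numeral_2_eq_2 dest!: supported_empty) (simp add: basis_lin_def free_lift_0[OF vsp_T])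
qed

lemma T_delta_kernel:
  assumes "2 \<le> p" "p < t"
  shows "\<delta> t (p - 1) ` carrier (T t (p - 1)) = a_kernel (T t p) (T t (p + 1)) (\<delta> t p)"
proof -
  obtain q where p: "p = Suc q" using assms(1) by (cases p) auto
  show ?thesis unfolding a_kernel_def'
  proof (intro equalityI subsetI)
    fix y assume "y \<in> \<delta> t (p - 1) ` carrier (T t (p - 1))"
    then obtain x where x: "x \<in> carrier (T t q)" "y = \<delta> t q x" by (auto simp: p)
    then show "y \<in> {x \<in> carrier (T t p). \<delta> t p x = \<zero>\<^bsub>T t (p + 1)\<^esub>}"
      using T_delta_T_delta[OF x(1)] lin_closed[OF T_delta_lin x(1)] by (simp add: p)
  next
    fix x assume "x \<in> {x \<in> carrier (T t p). \<delta> t p x = \<zero>\<^bsub>T t (p + 1)\<^esub>}"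
    then obtain u where u: "u \<in> supported (inc_words dimV t q)" "x = basis_lin t p (free_ext rcobar u)"
      using T_delta_exact[of q t x] assms(2) by (auto simp: p)
    then have "x = \<delta> t q (basis_lin t q u)" using T_delta_basis_lin[OF u(1)] by (simp add: p)
    then show "x \<in> \<delta> t (p - 1) ` carrier (T t (p - 1))" using basis_lin_closed[OF u(1)] by (simp add: p)
  qed
qed

end

section \<open>The theorem\<close>

lemma exterior_basis_exists:
  assumes "finite_dimensional_vector_space scale B"
  shows "\<exists>b coord. exterior_basis scale b coord"
proof -
  interpret finite_dimensional_vector_space scale B by (rule assms)
  obtain h where h: "bij_betw h {0..<card B} B" using ex_bij_betw_nat_finite[OF finite_Basis] by blast
  have n: "dim UNIV = card B" by (rule dim_UNIV)
  have hB: "h k \<in> B" if "k < card B" for k using h that by (auto simp: bij_betw_def)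
  have "exterior_basis scale h (\<lambda>k v. representation B v (h k))"
  proof unfold_locales
    fix k and v w :: 'b and c :: 'a
    have sp: "v \<in> span B" for v using span_Basis by simp
    show "representation B (v + w) (h k) = representation B v (h k) + representation B w (h k)"
      by (simp add: representation_add[OF independent_Basis sp sp])
    show "representation B (scale c v) (h k) = c * representation B v (h k)"
      by (simp add: representation_scale[OF independent_Basis sp])
    have "(\<Sum>k<dim UNIV. scale (representation B v (h k)) (h k)) = (\<Sum>e\<in>B. scale (representation B v e) e)"
      unfolding n lessThan_atLeast0 by (rule sum.reindex_bij_betw[OF h])
    also have "\<dots> = v" by (rule sum_representation_eq[OF independent_Basis sp finite_Basis order_refl])
    finally show "(\<Sum>k<dim UNIV. scale (representation B v (h k)) (h k)) = v" .
  next
    fix j k assume "j < dim UNIV" "k < dim UNIV"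
    then show "representation B (h j) (h k) = (if k = j then 1 else 0)"
      using hB representation_basis[OF independent_Basis, of "h j"] h by (auto simp: n bij_betw_def inj_on_def)
  qed
  then show ?thesis by blast
qed

theorem theorem2:
  fixes scale :: "'k::field \<Rightarrow> 'v::ab_group_add \<Rightarrow> 'v" and n t :: nat
  assumes "\<exists>B. finite_dimensional_vector_space scale B"
    and "vector_space.dim scale UNIV = n" and "n \<ge> 2" and "t \<ge> 1"
  shows "(\<forall>p\<in>{1..t}. GL_representation scale (T_space scale t p) (T_act scale t p)) \<and>
    GL_representation scale (sym_power scale t) (sym_act scale t) \<and>
    (\<forall>p\<in>{1..<t}. GL_hom scale (T_space scale t p) (T_act scale t p)
       (T_space scale t (p + 1)) (T_act scale t (p + 1)) (T_delta scale t p)) \<and>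
    GL_hom scale (T_space scale t t) (T_act scale t t)
       (sym_power scale t) (sym_act scale t) (sym_proj scale t) \<and>
    (if t = 1 then a_kernel (T_space scale t 1) (sym_power scale t) (sym_proj scale t)
       else a_kernel (T_space scale t 1) (T_space scale t 2) (T_delta scale t 1))
     = {\<zero>\<^bsub>T_space scale t 1\<^esub>} \<and>
    (\<forall>p\<in>{2..<t}. T_delta scale t (p - 1) ` carrier (T_space scale t (p - 1))
       = a_kernel (T_space scale t p) (T_space scale t (p + 1)) (T_delta scale t p)) \<and>
    (t \<ge> 2 \<longrightarrow> T_delta scale t (t - 1) ` carrier (T_space scale t (t - 1))
       = a_kernel (T_space scale t t) (sym_power scale t) (sym_proj scale t)) \<and>
    sym_proj scale t ` carrier (T_space scale t t) = carrier (sym_power scale t)"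
proof -
  obtain b coord where "exterior_basis scale b coord" using assms(1) exterior_basis_exists by blast
  then interpret exterior_basis scale b coord .
  have dim: "dimV \<ge> 2" "dimV \<ge> 1" using assms(2,3) by auto
  have "(if t = 1 then a_kernel (T t 1) (sym_power scale t) (sym_proj scale t)
       else a_kernel (T t 1) (T t 2) (T_delta scale t 1)) = {\<zero>\<^bsub>T t 1\<^esub>}"
  proof (cases "t = 1")
    case True
    then show ?thesis using sym_proj_injective_1[OF dim(2)] by simp
  next
    case False
    then have t: "1 < t" using assms(4) by simp
    have d0: "T_delta scale t 1 \<zero>\<^bsub>T t 1\<^esub> = \<zero>\<^bsub>T t 2\<^esub>"
      using lin_zero[OF vsp_T vsp_T T_delta_lin, of t 1] by (simp only: one_add_one)
    show ?thesis
      unfolding a_kernel_def' if_not_P[OF False]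
      using T_delta_injective[OF t] d0 vsp_zero_closed[OF vsp_T, of t 1] by blast
  qed
  then show ?thesis
    using T_delta_kernel
    by (intro conjI ballI impI GL_representation_T GL_representation_sym GL_hom_T_delta
        GL_hom_sym_proj[OF assms(4) dim(2)] sym_proj_kernel_image[OF _ dim(1)] sym_proj_surj[OF assms(4) dim(2)]) simp_all
qed

end
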